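(* Let $\Omega\subset\mathbb{R}^n$ ($n\ge1$) be a bounded domain and $(d_1,d_2,f,\kappa)\in(0,\infty)^4$. For $\ell\in\{1,2\}$ let $\gamma_\ell:\Omega\times\Omega\to[0,\infty)$ be measurable with $$\int_\Omega\gamma_\ell(y,x)\,\mathrm{d}y=\int_\Omega\gamma_\ell(x,y)\,\mathrm{d}y\le\gamma_\infty<\infty,\qquad x\in\Omega,$$ for some $\gamma_\infty\ge1$, and let $(u^0,v^0)\in X^+\times X^+$. Then there is a unique non-negative global solution $(u,v)\in C^1([0,\infty),X^+\times X^+)$ to $$\partial_t u=d_1\Gamma_{\gamma_1}u-uv^2+f(1-u),\qquad \partial_t v=d_2\Gamma_{\gamma_2}v+uv^2-(f+\kappa)v\quad\text{in }(0,\infty)\times\Omega,\qquad (u,v)(0)=(u^0,v^0),$$ which is bounded, i.e. $\sup_{t\ge0}\{\|u(t)\|_\infty+\|v(t)\|_\infty\}<\infty$. Moreover, the map $(u^0,v^0)\mapsto(u,v)$ defines a global semiflow on $X^+\times X^+$. If in addition $\gamma_\ell\in C(\bar\Omega\times\bar\Omega)$ for $\ell\in\{1,2\}$, the same statements hold with $X=L_\infty(\Omega)$ replaced by $C(\bar\Omega)$ (and $X^+$ by the non-negative continuous functions).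
   Context: $X:=L_\infty(\Omega)$ with norm $\|\cdot\|_\infty$, $X^+:=\{z\in X: z\ge0\text{ a.e. in }\Omega\}$. For a measurable $\gamma:\Omega\times\Omega\to[0,\infty)$, the nonlocal operator is $\Gamma_\gamma z(x):=\int_\Omega\gamma(x,y)(z(y)-z(x))\,\mathrm{d}y$, $x\in\Omega$. *)

theory Defs
  imports "HOL-Analysis.Analysis" "HOL-Probability.Essential_Supremum"
begin

text \<open>Functions on the ambient space 'a are used as representatives of elements of
  the phase space X. A phase space is given by a set M of admissible representatives
  and a seminorm N; two representatives denote the same element iff their difference
  has N-seminorm 0.\<close>

definition Linf_space :: "'a::euclidean_space set \<Rightarrow> ('a \<Rightarrow> real) set" where
  "Linf_space \<Omega> = {z. z \<in> borel_measurable (lebesgue_on \<Omega>) \<and>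
      esssup (lebesgue_on \<Omega>) (\<lambda>x. ereal \<bar>z x\<bar>) < \<infinity>}"

definition Linf_norm :: "'a::euclidean_space set \<Rightarrow> ('a \<Rightarrow> real) \<Rightarrow> real" where
  "Linf_norm \<Omega> z = real_of_ereal (esssup (lebesgue_on \<Omega>) (\<lambda>x. ereal \<bar>z x\<bar>))"

definition Cbar_space :: "'a::euclidean_space set \<Rightarrow> ('a \<Rightarrow> real) set" where
  "Cbar_space \<Omega> = {z. continuous_on (closure \<Omega>) z}"

definition Cbar_norm :: "'a::euclidean_space set \<Rightarrow> ('a \<Rightarrow> real) \<Rightarrow> real" where
  "Cbar_norm \<Omega> z = Sup ((\<lambda>x. \<bar>z x\<bar>) ` closure \<Omega>)"

definition Xeq :: "('a \<Rightarrow> real) set \<Rightarrow> (('a \<Rightarrow> real) \<Rightarrow> real) \<Rightarrow> ('a \<Rightarrow> real) \<Rightarrow> ('a \<Rightarrow> real) \<Rightarrow> bool" where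
  "Xeq M N z w \<longleftrightarrow> (\<lambda>x. z x - w x) \<in> M \<and> N (\<lambda>x. z x - w x) = 0"

text \<open>Positive cone X^+: elements whose negative part vanishes in X
  (i.e. z \<ge> 0 a.e. in Omega, resp. z \<ge> 0 on closure Omega).\<close>
definition Xplus :: "('a \<Rightarrow> real) set \<Rightarrow> (('a \<Rightarrow> real) \<Rightarrow> real) \<Rightarrow> ('a \<Rightarrow> real) set" where
  "Xplus M N = {z \<in> M. N (\<lambda>x. min (z x) 0) = 0}"

definition Gam :: "'a::euclidean_space set \<Rightarrow> ('a \<Rightarrow> 'a \<Rightarrow> real) \<Rightarrow> ('a \<Rightarrow> real) \<Rightarrow> 'a \<Rightarrow> real" where
  "Gam \<Omega> \<gamma> z x = (\<integral>y. \<gamma> x y * (z y - z x) \<partial>(lebesgue_on \<Omega>))"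

definition kernel_cond :: "'a::euclidean_space set \<Rightarrow> real \<Rightarrow> ('a \<Rightarrow> 'a \<Rightarrow> real) \<Rightarrow> bool" where
  "kernel_cond \<Omega> \<gamma>inf \<gamma> \<longleftrightarrow>
     (\<forall>x\<in>\<Omega>. \<forall>y\<in>\<Omega>. \<gamma> x y \<ge> 0) \<and>
     (\<lambda>(x, y). \<gamma> x y) \<in> borel_measurable (lebesgue_on (\<Omega> \<times> \<Omega>)) \<and>
     (\<forall>x\<in>\<Omega>. (\<integral>\<^sup>+ y. ennreal (\<gamma> y x) \<partial>(lebesgue_on \<Omega>))
                 = (\<integral>\<^sup>+ y. ennreal (\<gamma> x y) \<partial>(lebesgue_on \<Omega>)) \<and>
              (\<integral>\<^sup>+ y. ennreal (\<gamma> x y) \<partial>(lebesgue_on \<Omega>)) \<le> ennreal \<gamma>inf)"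

definition X_deriv :: "('a \<Rightarrow> real) set \<Rightarrow> (('a \<Rightarrow> real) \<Rightarrow> real) \<Rightarrow> (real \<Rightarrow> 'a \<Rightarrow> real) \<Rightarrow> (real \<Rightarrow> 'a \<Rightarrow> real) \<Rightarrow> bool" where
  "X_deriv M N u u' \<longleftrightarrow> (\<forall>t\<ge>0. u' t \<in> M \<and>
     (\<forall>\<epsilon>>0. \<exists>\<delta>>0. \<forall>s\<ge>0. \<bar>s - t\<bar> < \<delta> \<longrightarrow>
        N (\<lambda>x. u s x - u t x - (s - t) * u' t x) \<le> \<epsilon> * \<bar>s - t\<bar>))"

definition X_cont :: "('a \<Rightarrow> real) set \<Rightarrow> (('a \<Rightarrow> real) \<Rightarrow> real) \<Rightarrow> (real \<Rightarrow> 'a \<Rightarrow> real) \<Rightarrow> bool" where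
  "X_cont M N w \<longleftrightarrow> (\<forall>t\<ge>0. w t \<in> M \<and>
     (\<forall>\<epsilon>>0. \<exists>\<delta>>0. \<forall>s\<ge>0. \<bar>s - t\<bar> < \<delta> \<longrightarrow> N (\<lambda>x. w s x - w t x) \<le> \<epsilon>))"

definition GS_sol ::
  "('a \<Rightarrow> real) set \<Rightarrow> (('a \<Rightarrow> real) \<Rightarrow> real) \<Rightarrow> 'a::euclidean_space set \<Rightarrow>
   ('a \<Rightarrow> 'a \<Rightarrow> real) \<Rightarrow> ('a \<Rightarrow> 'a \<Rightarrow> real) \<Rightarrow> real \<Rightarrow> real \<Rightarrow> real \<Rightarrow> real \<Rightarrow>
   ('a \<Rightarrow> real) \<Rightarrow> ('a \<Rightarrow> real) \<Rightarrow> (real \<Rightarrow> 'a \<Rightarrow> real) \<Rightarrow> (real \<Rightarrow> 'a \<Rightarrow> real) \<Rightarrow> bool" where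
  "GS_sol M N \<Omega> \<gamma>1 \<gamma>2 d1 d2 f \<kappa> u0 v0 u v \<longleftrightarrow>
     (\<forall>t\<ge>0. u t \<in> Xplus M N \<and> v t \<in> Xplus M N) \<and>
     (\<exists>u' v'. X_deriv M N u u' \<and> X_deriv M N v v' \<and> X_cont M N u' \<and> X_cont M N v' \<and>
        (\<forall>t>0. Xeq M N (u' t)
                 (\<lambda>x. d1 * Gam \<Omega> \<gamma>1 (u t) x - u t x * (v t x)\<^sup>2 + f * (1 - u t x)) \<and>
               Xeq M N (v' t)
                 (\<lambda>x. d2 * Gam \<Omega> \<gamma>2 (v t) x + u t x * (v t x)\<^sup>2 - (f + \<kappa>) * v t x))) \<and>
     Xeq M N (u 0) u0 \<and> Xeq M N (v 0) v0"

definition GS_wellposed ::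
  "('a \<Rightarrow> real) set \<Rightarrow> (('a \<Rightarrow> real) \<Rightarrow> real) \<Rightarrow> 'a::euclidean_space set \<Rightarrow>
   ('a \<Rightarrow> 'a \<Rightarrow> real) \<Rightarrow> ('a \<Rightarrow> 'a \<Rightarrow> real) \<Rightarrow> real \<Rightarrow> real \<Rightarrow> real \<Rightarrow> real \<Rightarrow> bool" where
  "GS_wellposed M N \<Omega> \<gamma>1 \<gamma>2 d1 d2 f \<kappa> \<longleftrightarrow>
     (\<forall>u0\<in>Xplus M N. \<forall>v0\<in>Xplus M N.
        \<exists>u v. GS_sol M N \<Omega> \<gamma>1 \<gamma>2 d1 d2 f \<kappa> u0 v0 u v \<and>
          (\<exists>B. \<forall>t\<ge>0. N (u t) + N (v t) \<le> B) \<and>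
          (\<forall>u2 v2. GS_sol M N \<Omega> \<gamma>1 \<gamma>2 d1 d2 f \<kappa> u0 v0 u2 v2 \<longrightarrow>
               (\<forall>t\<ge>0. Xeq M N (u2 t) (u t) \<and> Xeq M N (v2 t) (v t)))) \<and>
     (\<exists>\<Phi> :: real \<Rightarrow> ('a \<Rightarrow> real) \<times> ('a \<Rightarrow> real) \<Rightarrow> ('a \<Rightarrow> real) \<times> ('a \<Rightarrow> real).
        (\<forall>u0\<in>Xplus M N. \<forall>v0\<in>Xplus M N.
           GS_sol M N \<Omega> \<gamma>1 \<gamma>2 d1 d2 f \<kappa> u0 v0
             (\<lambda>t. fst (\<Phi> t (u0, v0))) (\<lambda>t. snd (\<Phi> t (u0, v0)))) \<and>
        (\<forall>u0\<in>Xplus M N. \<forall>v0\<in>Xplus M N. \<forall>s\<ge>0. \<forall>t\<ge>0.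
           Xeq M N (fst (\<Phi> (t + s) (u0, v0))) (fst (\<Phi> t (\<Phi> s (u0, v0)))) \<and>
           Xeq M N (snd (\<Phi> (t + s) (u0, v0))) (snd (\<Phi> t (\<Phi> s (u0, v0))))) \<and>
        (\<forall>t0\<ge>0. \<forall>u0\<in>Xplus M N. \<forall>v0\<in>Xplus M N. \<forall>\<epsilon>>0. \<exists>\<delta>>0.
           \<forall>t\<ge>0. \<forall>u1\<in>Xplus M N. \<forall>v1\<in>Xplus M N.
             \<bar>t - t0\<bar> < \<delta> \<and> N (\<lambda>x. u1 x - u0 x) < \<delta> \<and> N (\<lambda>x. v1 x - v0 x) < \<delta> \<longrightarrow>
               N (\<lambda>x. fst (\<Phi> t (u1, v1)) x - fst (\<Phi> t0 (u0, v0)) x) < \<epsilon> \<and>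
               N (\<lambda>x. snd (\<Phi> t (u1, v1)) x - snd (\<Phi> t0 (u0, v0)) x) < \<epsilon>))"

end

theory Submission
  imports Defs "HOL-Probability.Discrete_Topology"
begin

text \<open>The nonlocal operators are bounded on the phase space, so the system is an ODE with a locally
  Lipschitz right-hand side F. With m the maximum of 1 and the norm of u0, the set D of pairs with
  0 \<le> u \<le> m, 0 \<le> v, u + v \<le> k is invariant for large k: the sum w = u + v satisfies
  w' \<le> const + d2 * Gam w - f * w, where the constant only depends on m because Gam u is bounded by
  a multiple of m. Invariance takes the form that z + F(z) / \<Lambda> lies in D for z in D and \<Lambda> large. Hence
  z' = F(z) reads z' = \<Lambda> (H z - z) with H mapping the closed convex set D into itself, and the Duhamel
  formula represents z(t) as a convex average of points of D. This gives existence, nonnegativity and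
  boundedness at once by a contraction argument in D, carried out for bounded functions with the
  supremum norm, and then transferred to the seminormed space of representatives. Uniqueness and
  continuous dependence follow from a Gronwall inequality for Dini derivatives of the seminorm.\<close>

section \<open>Differential equations in closed convex sets\<close>

text \<open>The phase space is only seminormed, and the values of its elements on null sets or off
  \<open>\<Omega>\<close> are arbitrary, whereas a fixed point argument wants a complete metric
  space and an order argument wants pointwise inequalities. Both come from representatives that are
  bounded everywhere: the supremum norm makes bounded functions a Banach space, and it dominates
  \<open>N\<close>.

  The term u * v^2 only damps u but feeds v, so a bound for v alone does not propagate; in u + v it
  cancels. As the two diffusions differ, the sum does not diffuse by a single operator. Rewriting d2
  * Gam v through the sum leaves a remainder in u alone, which m controls and which the decay f
  dominates once k is large.

  All constants depend on the size of the data, not on the data themselves. Nearby solutions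
  therefore share one bound and one Lipschitz constant, from which joint continuity of the semiflow
  follows.\<close>

lemma gronwall_dini:
  fixes e :: "real \<Rightarrow> real"
  assumes cont: "continuous_on {0..T} e"
    and dini: "\<And>t \<epsilon>. 0 < t \<Longrightarrow> t < T \<Longrightarrow> \<epsilon> > 0 \<Longrightarrow>
      \<exists>\<delta>>0. \<forall>s. t < s \<and> s < t + \<delta> \<longrightarrow> e s \<le> e t + (s - t) * (L * e t + \<epsilon>)"
    and t: "0 \<le> t" "t \<le> T"
  shows "e t \<le> e 0 * exp (L * t)"
proof -
  have main: "e t \<le> (e 0 + \<eta> + \<eta> * t) * exp (L * t)" if \<eta>: "\<eta> > 0" for \<eta>
  proof (rule ccontr)
    \<comment> \<open>\<open>h\<close> starts above \<open>e 0\<close> by \<open>\<eta>\<close> and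
      is a strict supersolution: its slope is L * h plus the surplus \<eta> * exp (L * s). After the
      last time at which e \<le> h, e would have to outgrow h, against the Dini bound. The limit
      \<eta> -> 0 removes the surplus.\<close>
    define h where "h = (\<lambda>s. (e 0 + \<eta> + \<eta> * s) * exp (L * s))"
    assume "\<not> ?thesis"
    then have viol: "h t < e t" by (simp add: h_def)
    have hc: "continuous_on {0..t} h" unfolding h_def by (intro continuous_intros)
    have ec: "continuous_on {0..t} e" using cont t by (auto intro: continuous_on_subset)
    define A where "A = {s \<in> {0..t}. e s \<le> h s}"
    have "closed A"
      unfolding A_def using continuous_closed_preimage[of "{0..t}" "\<lambda>s. h s - e s" "{0..}"]
      by (simp add: continuous_on_diff hc ec vimage_def Int_def)
    moreover have "bounded A" unfolding A_def by (rule bounded_subset[of "{0..t}"]) auto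
    ultimately have "compact A" by (simp add: compact_eq_bounded_closed)
    moreover have "0 \<in> A" using \<eta> t by (simp add: A_def h_def)
    ultimately obtain a where a: "a \<in> A" "\<And>s. s \<in> A \<Longrightarrow> s \<le> a"
      using compact_attains_sup[of A] by auto
    have a0: "0 \<le> a" "a < t" "e a \<le> h a"
      using a viol by (auto simp: A_def order_less_le)
    have after: "h s < e s" if "a < s" "s \<le> t" for s
    proof (rule ccontr)
      assume "\<not> h s < e s"
      then have "s \<in> A" using that a0 by (simp add: A_def)
      then show False using a(2)[of s] that by simp
    qed
    have eq: "e a = h a"
    proof (rule antisym)
      have "((\<lambda>s. e s - h s) \<longlongrightarrow> e a - h a) (at a within {a..t})"
        using continuous_on_diff[OF ec hc] a0
        by (auto simp: continuous_on_def intro!: tendsto_within_subset[where S = "{0..t}" and T="{a..t}"])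
      moreover have "\<forall>\<^sub>F s in at a within {a..t}. 0 \<le> e s - h s"
        using after by (auto simp: eventually_at_filter less_eq_real_def)
      moreover have "at a within {a..t} \<noteq> bot"
        using a0 by (simp add: at_within_Icc_at_right)
      ultimately have "0 \<le> e a - h a"
        using tendsto_lowerbound by blast
      then show "h a \<le> e a" by simp
    qed (rule a0(3))
    \<comment> \<open>At 0 the function \<open>h\<close> exceeds \<open>e\<close> by
      \<open>\<eta>\<close>. Positivity of \<open>a\<close> matters, since \<open>dini\<close> is
      assumed only inside the interval.\<close>
    have "a \<noteq> 0" using eq \<eta> by (auto simp: h_def)
    with a0 have apos: "0 < a" by simp
    \<comment> \<open>The surplus slope of \<open>h\<close> at \<open>a\<close> is 2 * \<epsilon>.
      Difference quotients of \<open>h\<close> near \<open>a\<close> thus exceed L * h a +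
      \<epsilon>, the very slope that \<open>dini\<close> allows to \<open>e\<close>.\<close>
    define \<epsilon> where "\<epsilon> = \<eta> * exp (L * a) / 2"
    have \<epsilon>: "\<epsilon> > 0" using \<eta> by (simp add: \<epsilon>_def)
    obtain \<delta>1 where \<delta>1: "\<delta>1 > 0" "\<And>s. a < s \<Longrightarrow> s < a + \<delta>1 \<Longrightarrow> e s \<le> e a + (s - a) * (L * e a + \<epsilon>)"
      using dini[OF apos _ \<epsilon>] a0 t by (meson less_le_trans)
    have "(h has_real_derivative (L * h a + 2 * \<epsilon>)) (at a)"
      unfolding h_def \<epsilon>_def by (auto intro!: derivative_eq_intros simp: algebra_simps)
    then have "((\<lambda>y. (h y - h a) / (y - a)) \<longlongrightarrow> L * h a + 2 * \<epsilon>) (at a)"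
      by (simp add: has_field_derivative_iff)
    then have "\<forall>\<^sub>F y in at a. (h y - h a) / (y - a) > L * h a + \<epsilon>"
      by (rule order_tendstoD) (use \<epsilon> in auto)
    then obtain \<delta>2 where \<delta>2: "\<delta>2 > 0" "\<And>y. y \<noteq> a \<Longrightarrow> dist y a < \<delta>2 \<Longrightarrow> (h y - h a) / (y - a) > L * h a + \<epsilon>"
      by (auto simp: eventually_at)
    define s where "s = a + min (t - a) (min \<delta>1 \<delta>2) / 2"
    have s: "a < s" "s \<le> t" "s < a + \<delta>1" "dist s a < \<delta>2"
      using a0 \<delta>1(1) \<delta>2(1) by (auto simp: s_def dist_real_def min_def field_simps)
    have "(h s - h a) / (s - a) > L * h a + \<epsilon>" using \<delta>2(2)[of s] s by simp
    then have "h s > h a + (s - a) * (L * h a + \<epsilon>)"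
      using s(1) by (simp add: field_simps)
    moreover have "e s \<le> e a + (s - a) * (L * e a + \<epsilon>)" using \<delta>1(2) s by simp
    ultimately show False using after[OF s(1,2)] eq by simp
  qed
  have "((\<lambda>\<eta>. (e 0 + \<eta> + \<eta> * t) * exp (L * t)) \<longlongrightarrow> (e 0 + 0 + 0 * t) * exp (L * t)) (at_right 0)"
    by (intro tendsto_intros)
  moreover have "\<forall>\<^sub>F \<eta> in at_right 0. e t \<le> (e 0 + \<eta> + \<eta> * t) * exp (L * t)"
    using main by (auto simp: eventually_at_filter)
  ultimately have "e t \<le> (e 0 + 0 + 0 * t) * exp (L * t)"
    by (intro tendsto_lowerbound) auto
  then show ?thesis by simp
qed

section \<open>Duhamel averages and invariance of closed convex sets\<close>

lemma infdist_convex_step: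
  fixes D :: "'b::real_normed_vector set"
  assumes "convex D" "d \<in> D" "0 \<le> \<theta>" "\<theta> \<le> 1"
  shows "infdist ((1 - \<theta>) *\<^sub>R y + \<theta> *\<^sub>R d) D \<le> infdist y D"
proof -
  have "D \<noteq> {}" using assms by auto
  have "infdist ((1 - \<theta>) *\<^sub>R y + \<theta> *\<^sub>R d) D \<le> dist y a" if "a \<in> D" for a
  proof (rule infdist_le2)
    \<comment> \<open>Comparison point: \<open>a\<close> is moved towards \<open>d\<close> by the
      same fraction as \<open>y\<close>. Convexity keeps it in \<open>D\<close>, and the distance
      shrinks by the factor 1 - \<theta>.\<close>
    show "(1 - \<theta>) *\<^sub>R a + \<theta> *\<^sub>R d \<in> D"
      using assms that by (auto intro: convexD)
    have "dist ((1 - \<theta>) *\<^sub>R y + \<theta> *\<^sub>R d) ((1 - \<theta>) *\<^sub>R a + \<theta> *\<^sub>R d) = norm ((1 - \<theta>) *\<^sub>R (y - a))"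
      by (simp add: dist_norm algebra_simps)
    also have "\<dots> \<le> 1 * norm (y - a)"
      unfolding norm_scaleR using assms by (intro mult_right_mono) auto
    finally show "dist ((1 - \<theta>) *\<^sub>R y + \<theta> *\<^sub>R d) ((1 - \<theta>) *\<^sub>R a + \<theta> *\<^sub>R d) \<le> dist y a"
      by (simp add: dist_norm)
  qed
  then show ?thesis
    unfolding infdist_notempty[OF \<open>D \<noteq> {}\<close>, of y] using \<open>D \<noteq> {}\<close> by (intro cINF_greatest)
qed

text \<open>Variation of constants for y' = \<Lambda> * (f - y), y 0 = z0. For \<Lambda> > 0 the
  weights exp (- \<Lambda> * t) of z0 and \<Lambda> * exp (- \<Lambda> * (t - s)) of f s are
  positive with total mass 1.\<close>

definition duhamel :: "real \<Rightarrow> 'b::banach \<Rightarrow> (real \<Rightarrow> 'b) \<Rightarrow> real \<Rightarrow> 'b" where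
  "duhamel \<Lambda> z0 f t = exp (- \<Lambda> * t) *\<^sub>R (z0 + integral {0..t} (\<lambda>s. (\<Lambda> * exp (\<Lambda> * s)) *\<^sub>R f s))"

lemma duhamel_0 [simp]: "duhamel \<Lambda> z0 f 0 = z0"
  by (simp add: duhamel_def)

lemma duhamel_has_vector_derivative:
  assumes f: "continuous_on {0..} f" and t: "t \<ge> 0"
  shows "(duhamel \<Lambda> z0 f has_vector_derivative \<Lambda> *\<^sub>R (f t - duhamel \<Lambda> z0 f t)) (at t within {0..})"
proof -
  have at: "at t within {0..} = at t within {0..t+1}"
    by (rule at_within_nhd[of t "{..<t+1}"]) auto
  have "((\<lambda>u. integral {0..u} (\<lambda>s. (\<Lambda> * exp (\<Lambda> * s)) *\<^sub>R f s)) has_vector_derivative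
      (\<Lambda> * exp (\<Lambda> * t)) *\<^sub>R f t) (at t within {0..t+1})"
    using t by (intro integral_has_vector_derivative continuous_intros continuous_on_subset[OF f]) auto
  note [derivative_intros] = this
  have e: "((\<lambda>u. exp (- \<Lambda> * u)) has_real_derivative - \<Lambda> * exp (- \<Lambda> * t)) (at t within {0..t+1})"
    by (auto intro!: derivative_eq_intros)
  have ee: "exp (- \<Lambda> * t) * (\<Lambda> * exp (\<Lambda> * t)) = \<Lambda>"
    by (simp add: exp_minus)
  have "(duhamel \<Lambda> z0 f has_vector_derivative
      exp (- \<Lambda> * t) *\<^sub>R (0 + (\<Lambda> * exp (\<Lambda> * t)) *\<^sub>R f t) +
      (- \<Lambda> * exp (- \<Lambda> * t)) *\<^sub>R (z0 + integral {0..t} (\<lambda>s. (\<Lambda> * exp (\<Lambda> * s)) *\<^sub>R f s))) (at t within {0..t+1})"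
    unfolding duhamel_def[abs_def] using e
    by (intro has_vector_derivative_scaleR derivative_intros)
  also have "exp (- \<Lambda> * t) *\<^sub>R (0 + (\<Lambda> * exp (\<Lambda> * t)) *\<^sub>R f t) +
      (- \<Lambda> * exp (- \<Lambda> * t)) *\<^sub>R (z0 + integral {0..t} (\<lambda>s. (\<Lambda> * exp (\<Lambda> * s)) *\<^sub>R f s))
      = \<Lambda> *\<^sub>R (f t - duhamel \<Lambda> z0 f t)"
    using ee by (simp add: duhamel_def algebra_simps)
  finally show ?thesis by (simp add: at)
qed

lemma continuous_on_duhamel:
  assumes "continuous_on {0..} f"
  shows "continuous_on {0..} (duhamel \<Lambda> z0 f)"
  unfolding continuous_on_eq_continuous_within
  using duhamel_has_vector_derivative[OF assms, of _ \<Lambda> z0]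
  by (auto dest!: has_vector_derivative_continuous)

text \<open>Instead of averaging under the integral, the distance of the curve y to \<open>D\<close>
  is shown not to grow: an Euler step of y' = \<Lambda> * (f - y) of length at most 1 / \<Lambda> is
  a convex combination of y and f, hence no farther from \<open>D\<close> than y, up to a small
  error. \<open>gronwall_dini\<close> with rate 0 keeps the distance at 0, and closedness gives
  membership.\<close>

lemma duhamel_mem_convex:
  assumes D: "closed D" "convex D" and \<Lambda>: "\<Lambda> > 0" and z0: "z0 \<in> D"
    and f: "continuous_on {0..} f" "\<And>s. s \<ge> 0 \<Longrightarrow> f s \<in> D" and t: "t \<ge> 0"
  shows "duhamel \<Lambda> z0 f t \<in> D"
proof -
  define y where "y = duhamel \<Lambda> z0 f"
  have yc: "continuous_on {0..} y" unfolding y_def by (rule continuous_on_duhamel[OF f(1)])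
  have "infdist (y t) D \<le> infdist (y 0) D * exp (0 * t)"
  proof (rule gronwall_dini[where T = t])
    show "continuous_on {0..t} (\<lambda>t. infdist (y t) D)"
      using yc by (intro continuous_intros) (auto intro: continuous_on_subset)
    fix r \<epsilon> :: real assume r: "0 < r" "r < t" and \<epsilon>: "\<epsilon> > 0"
    have "(y has_derivative (\<lambda>h. h *\<^sub>R (\<Lambda> *\<^sub>R (f r - y r)))) (at r within {0..})"
      using duhamel_has_vector_derivative[OF f(1), of r \<Lambda> z0] r
      by (simp add: y_def has_vector_derivative_def)
    then obtain \<delta> where \<delta>: "\<delta> > 0" "\<And>s. s \<in> {0..} \<Longrightarrow> norm (s - r) < \<delta> \<Longrightarrow>
        norm (y s - y r - (s - r) *\<^sub>R (\<Lambda> *\<^sub>R (f r - y r))) \<le> \<epsilon> * norm (s - r)"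
      using \<epsilon> unfolding has_derivative_within_alt by blast
    have "infdist (y s) D \<le> infdist (y r) D + (s - r) * (0 * infdist (y r) D + \<epsilon>)"
      if s: "r < s" "s < r + min \<delta> (1 / \<Lambda>)" for s
    proof -
      define \<theta> where "\<theta> = (s - r) * \<Lambda>"
      have "s - r \<le> 1 / \<Lambda>" using s by simp
      then have \<theta>: "0 \<le> \<theta>" "\<theta> \<le> 1" using s \<Lambda> by (auto simp: \<theta>_def pos_le_divide_eq)
      have "infdist (y s) D \<le> infdist ((1 - \<theta>) *\<^sub>R y r + \<theta> *\<^sub>R f r) D + dist (y s) ((1 - \<theta>) *\<^sub>R y r + \<theta> *\<^sub>R f r)"
        by (rule infdist_triangle)
      also have "infdist ((1 - \<theta>) *\<^sub>R y r + \<theta> *\<^sub>R f r) D \<le> infdist (y r) D"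
        using D f(2)[of r] r \<theta> by (intro infdist_convex_step) auto
      also have "dist (y s) ((1 - \<theta>) *\<^sub>R y r + \<theta> *\<^sub>R f r) = norm (y s - y r - (s - r) *\<^sub>R (\<Lambda> *\<^sub>R (f r - y r)))"
        by (simp add: dist_norm \<theta>_def algebra_simps)
      also have "\<dots> \<le> \<epsilon> * norm (s - r)" using r s by (intro \<delta>(2)) auto
      finally show ?thesis using s by (simp add: algebra_simps)
    qed
    then show "\<exists>\<delta>>0. \<forall>s. r < s \<and> s < r + \<delta> \<longrightarrow>
        infdist (y s) D \<le> infdist (y r) D + (s - r) * (0 * infdist (y r) D + \<epsilon>)"
      using \<delta>(1) \<Lambda> by (intro exI[of _ "min \<delta> (1 / \<Lambda>)"]) auto
  qed (use t in auto)
  then have "infdist (y t) D = 0"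
    using z0 infdist_nonneg[of "y t" D] by (simp add: y_def)
  then show ?thesis using D z0 in_closed_iff_infdist_zero[of D "y t"] by (auto simp: y_def)
qed

text \<open>Against the weight exp (a * s) the kernel \<Lambda> * exp (- \<Lambda> * (t - s)) gains
  the factor \<Lambda> / (\<Lambda> + a), uniformly in t. For a = \<Lambda> * L, this factor times L
  is L / (1 + L) < 1.\<close>

lemma duhamel_diff_le:
  assumes f: "continuous_on {0..} f" "continuous_on {0..} g" and \<Lambda>: "\<Lambda> > 0" "a \<ge> 0"
    and b: "\<And>s. s \<ge> 0 \<Longrightarrow> norm (f s - g s) \<le> b * exp (a * s)" and t: "t \<ge> 0"
  shows "norm (duhamel \<Lambda> z0 f t - duhamel \<Lambda> z0 g t) \<le> \<Lambda> / (\<Lambda> + a) * b * exp (a * t)"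
proof -
  have fc: "continuous_on {0..t} f" "continuous_on {0..t} g"
    using f by (auto intro: continuous_on_subset)
  have b0: "b \<ge> 0" using order_trans[OF norm_ge_zero b[of 0]] by simp
  have i: "(\<lambda>s. (\<Lambda> * exp (\<Lambda> * s)) *\<^sub>R f s) integrable_on {0..t}" "(\<lambda>s. (\<Lambda> * exp (\<Lambda> * s)) *\<^sub>R g s) integrable_on {0..t}"
    using fc by (auto intro!: integrable_continuous_interval continuous_intros)
  have hi: "((\<lambda>s. \<Lambda> * b * exp ((\<Lambda> + a) * s)) has_integral
      (\<Lambda> / (\<Lambda> + a) * b * exp ((\<Lambda> + a) * t) - \<Lambda> / (\<Lambda> + a) * b * exp ((\<Lambda> + a) * 0))) {0..t}"
    using t \<Lambda> by (intro fundamental_theorem_of_calculus)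
      (auto intro!: derivative_eq_intros simp: has_real_derivative_iff_has_vector_derivative[symmetric])
  have "norm (integral {0..t} (\<lambda>s. (\<Lambda> * exp (\<Lambda> * s)) *\<^sub>R f s - (\<Lambda> * exp (\<Lambda> * s)) *\<^sub>R g s))
      \<le> integral {0..t} (\<lambda>s. \<Lambda> * b * exp ((\<Lambda> + a) * s))"
  proof (rule integral_norm_bound_integral)
    show "(\<lambda>s. \<Lambda> * b * exp ((\<Lambda> + a) * s)) integrable_on {0..t}" using hi by blast
    fix s assume s: "s \<in> {0..t}"
    have "norm ((\<Lambda> * exp (\<Lambda> * s)) *\<^sub>R f s - (\<Lambda> * exp (\<Lambda> * s)) *\<^sub>R g s) = (\<Lambda> * exp (\<Lambda> * s)) * norm (f s - g s)"
      using \<Lambda> by (simp add: scaleR_diff_right[symmetric])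
    also have "\<dots> \<le> (\<Lambda> * exp (\<Lambda> * s)) * (b * exp (a * s))"
      using \<Lambda> s by (intro mult_left_mono b) auto
    finally show "norm ((\<Lambda> * exp (\<Lambda> * s)) *\<^sub>R f s - (\<Lambda> * exp (\<Lambda> * s)) *\<^sub>R g s) \<le> \<Lambda> * b * exp ((\<Lambda> + a) * s)"
      by (simp add: algebra_simps exp_add)
  qed (use i in \<open>auto intro: integrable_diff\<close>)
  also have "\<dots> \<le> \<Lambda> / (\<Lambda> + a) * b * exp ((\<Lambda> + a) * t)"
    unfolding integral_unique[OF hi] using \<Lambda> b0 by simp
  finally have I: "norm (integral {0..t} (\<lambda>s. (\<Lambda> * exp (\<Lambda> * s)) *\<^sub>R f s - (\<Lambda> * exp (\<Lambda> * s)) *\<^sub>R g s))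
      \<le> \<Lambda> / (\<Lambda> + a) * b * exp ((\<Lambda> + a) * t)" .
  have "duhamel \<Lambda> z0 f t - duhamel \<Lambda> z0 g t =
      exp (- \<Lambda> * t) *\<^sub>R (integral {0..t} (\<lambda>s. (\<Lambda> * exp (\<Lambda> * s)) *\<^sub>R f s - (\<Lambda> * exp (\<Lambda> * s)) *\<^sub>R g s))"
    unfolding duhamel_def integral_diff[OF i] by (simp add: algebra_simps)
  then have "norm (duhamel \<Lambda> z0 f t - duhamel \<Lambda> z0 g t) \<le>
      exp (- \<Lambda> * t) * (\<Lambda> / (\<Lambda> + a) * b * exp ((\<Lambda> + a) * t))"
    using mult_left_mono[OF I, of "exp (- \<Lambda> * t)"] by simp
  also have "\<dots> = \<Lambda> / (\<Lambda> + a) * b * (exp (- \<Lambda> * t) * exp ((\<Lambda> + a) * t))"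
    by (simp add: mult_ac)
  also have "exp (- \<Lambda> * t) * exp ((\<Lambda> + a) * t) = exp (a * t)"
    by (simp add: exp_add[symmetric] algebra_simps)
  finally show ?thesis .
qed

text \<open>Picard iterates stay in \<open>D\<close> by \<open>duhamel_mem_convex\<close>, so
  \<open>H\<close> is evaluated only where it is Lipschitz. The fixed point is global in time at
  once, without a continuation argument.\<close>

theorem ode_closed_convex:
  fixes D :: "'b::banach set"
  assumes D: "closed D" "convex D" "bounded D" and H: "\<And>z. z \<in> D \<Longrightarrow> H z \<in> D"
    and lip: "L-lipschitz_on D H" and \<Lambda>: "\<Lambda> > 0" and z0: "z0 \<in> D"
  obtains z where "z 0 = z0" "\<And>t. t \<ge> 0 \<Longrightarrow> z t \<in> D"
    "\<And>t. t \<ge> 0 \<Longrightarrow> (z has_vector_derivative \<Lambda> *\<^sub>R (H (z t) - z t)) (at t within {0..})"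
proof -
  have L0: "L \<ge> 0" using lip by (simp add: lipschitz_on_def)
  \<comment> \<open>The weight exp (- a t) turns the Duhamel map into a contraction on the whole half-line.\<close>
  define a where "a = \<Lambda> * L"
  have a0: "a \<ge> 0" using \<Lambda> L0 by (simp add: a_def)
  \<comment> \<open>Bounded continuous functions live on the whole real line here; clamping time at
    0 extends curves constantly to negative times.\<close>
  define p where "p = (\<lambda>t::real. max 0 t)"
  have p: "p t \<ge> 0" "t \<ge> 0 \<Longrightarrow> p t = t" for t by (auto simp: p_def)
  have pc: "continuous_on S p" for S unfolding p_def by (intro continuous_intros)
  \<comment> \<open>The unknown \<open>\<psi>\<close> is the weighted curve, and \<open>S\<close>
    asks that the unweighted curve \<open>ph \<psi>\<close> stays in \<open>D\<close>. Written as a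
    product of scaled copies of \<open>D\<close>, this set is closed.\<close>
  define S where "S = PiC UNIV (\<lambda>t. (\<lambda>d. exp (- a * p t) *\<^sub>R d) ` D)"
  define ph where "ph = (\<lambda>(\<psi>::real \<Rightarrow>\<^sub>C 'b) t. exp (a * p t) *\<^sub>R \<psi> t)"
  define T where "T = (\<lambda>\<psi>. Bcontfun (\<lambda>t. exp (- a * p t) *\<^sub>R duhamel \<Lambda> z0 (\<lambda>s. H (ph \<psi> s)) (p t)))"
  have S_iff: "\<psi> \<in> S \<longleftrightarrow> (\<forall>t. ph \<psi> t \<in> D)" for \<psi>
  proof -
    have "x \<in> (\<lambda>d. exp (- a * p t) *\<^sub>R d) ` D \<longleftrightarrow> exp (a * p t) *\<^sub>R x \<in> D" for x t
      by (auto simp: exp_minus image_iff intro!: bexI[of _ "exp (a * p t) *\<^sub>R x"])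
    then show ?thesis by (auto simp: S_def mem_PiC_iff ph_def Pi_iff)
  qed
  have "closed S" unfolding S_def using D(1) by (intro closed_PiC closed_scaling)
  then have Sc: "complete S" by (simp add: complete_eq_closed)
  have phc: "continuous_on A (ph \<psi>)" for \<psi> A
    unfolding ph_def by (intro continuous_intros pc continuous_on_apply_bcontfun)
  have Hc: "continuous_on {0..} (\<lambda>s. H (ph \<psi> s))" if "\<psi> \<in> S" for \<psi>
    using that by (intro continuous_on_compose2[OF lipschitz_on_continuous_on[OF lip] phc]) (auto simp: S_iff)
  have duD: "duhamel \<Lambda> z0 (\<lambda>s. H (ph \<psi> s)) t \<in> D" if "\<psi> \<in> S" "t \<ge> 0" for \<psi> t
    using that H by (intro duhamel_mem_convex D \<Lambda> z0 Hc) (auto simp: S_iff)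
  obtain R where R: "\<And>d. d \<in> D \<Longrightarrow> norm d \<le> R" using D(3) by (auto simp: bounded_iff)
  have shrink: "norm (exp (- a * p t) *\<^sub>R d) \<le> norm d" for t and d :: 'b
    using a0 p(1)[of t] by (simp add: mult_left_le_one_le)
  have T_app: "apply_bcontfun (T \<psi>) = (\<lambda>t. exp (- a * p t) *\<^sub>R duhamel \<Lambda> z0 (\<lambda>s. H (ph \<psi> s)) (p t))"
    if "\<psi> \<in> S" for \<psi>
    unfolding T_def
  proof (intro Bcontfun_inverse bcontfun_normI)
    show "continuous_on UNIV (\<lambda>t. exp (- a * p t) *\<^sub>R duhamel \<Lambda> z0 (\<lambda>s. H (ph \<psi> s)) (p t))"
      using p by (intro continuous_intros pc continuous_on_compose2[OF continuous_on_duhamel[OF Hc[OF that]] pc]) auto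
    show "norm (exp (- a * p t) *\<^sub>R duhamel \<Lambda> z0 (\<lambda>s. H (ph \<psi> s)) (p t)) \<le> R" for t
      using order_trans[OF shrink R[OF duD[OF that p(1)]]] .
  qed
  have ph_T: "ph (T \<psi>) t = duhamel \<Lambda> z0 (\<lambda>s. H (ph \<psi> s)) (p t)" if "\<psi> \<in> S" for \<psi> t
    by (simp add: ph_def T_app[OF that] exp_minus)
  have "\<exists>!\<psi>\<in>S. T \<psi> = \<psi>"
  proof (rule Banach_fix[OF Sc])
    have "Bcontfun (\<lambda>t. exp (- a * p t) *\<^sub>R z0) \<in> S"
    proof -
      have "apply_bcontfun (Bcontfun (\<lambda>t. exp (- a * p t) *\<^sub>R z0)) = (\<lambda>t. exp (- a * p t) *\<^sub>R z0)"
        using shrink by (intro Bcontfun_inverse bcontfun_normI[of _ "norm z0"] continuous_intros pc)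
      then show ?thesis using z0 by (simp add: S_iff ph_def exp_minus)
    qed
    then show "S \<noteq> {}" by auto
    show "T ` S \<subseteq> S" using duD p by (auto simp: S_iff[of "T _"] ph_T)
    show "0 \<le> L / (1 + L)" "L / (1 + L) < 1" using L0 by auto
    fix \<psi> \<phi> assume in_S: "\<psi> \<in> S" "\<phi> \<in> S"
    show "dist (T \<psi>) (T \<phi>) \<le> L / (1 + L) * dist \<psi> \<phi>"
    proof (rule dist_bound)
      fix t
      have "norm (H (ph \<psi> s) - H (ph \<phi> s)) \<le> L * dist \<psi> \<phi> * exp (a * s)" if "s \<ge> 0" for s
      proof -
        have le: "norm (H (ph \<psi> s) - H (ph \<phi> s)) \<le> L * norm (ph \<psi> s - ph \<phi> s)"
          using lipschitz_onD[OF lip, of "ph \<psi> s" "ph \<phi> s"] in_S by (simp add: S_iff dist_norm)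
        have "norm (ph \<psi> s - ph \<phi> s) = exp (a * s) * dist (\<psi> s) (\<phi> s)"
          using that p by (simp add: ph_def dist_norm scaleR_diff_right[symmetric])
        also have "\<dots> \<le> exp (a * s) * dist \<psi> \<phi>"
          by (intro mult_left_mono dist_bounded) auto
        finally have "L * norm (ph \<psi> s - ph \<phi> s) \<le> L * (exp (a * s) * dist \<psi> \<phi>)"
          using L0 by (intro mult_left_mono)
        with le show ?thesis by (simp add: mult_ac)
      qed
      from duhamel_diff_le[OF Hc[OF in_S(1)] Hc[OF in_S(2)] \<Lambda> a0 this p(1)[of t], where ?z0.0 = z0]
      have "norm (duhamel \<Lambda> z0 (\<lambda>s. H (ph \<psi> s)) (p t) - duhamel \<Lambda> z0 (\<lambda>s. H (ph \<phi> s)) (p t))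
          \<le> \<Lambda> / (\<Lambda> + a) * (L * dist \<psi> \<phi>) * exp (a * p t)" by auto
      also have "\<Lambda> / (\<Lambda> + a) * (L * dist \<psi> \<phi>) = L / (1 + L) * dist \<psi> \<phi>"
      proof -
        have "\<Lambda> + a = \<Lambda> * (1 + L)" by (simp add: a_def algebra_simps)
        then show ?thesis using \<Lambda> by simp
      qed
      finally have "exp (- a * p t) * norm (duhamel \<Lambda> z0 (\<lambda>s. H (ph \<psi> s)) (p t) - duhamel \<Lambda> z0 (\<lambda>s. H (ph \<phi> s)) (p t))
          \<le> exp (- a * p t) * (L / (1 + L) * dist \<psi> \<phi> * exp (a * p t))"
        by (intro mult_left_mono) auto
      also have "\<dots> = L / (1 + L) * dist \<psi> \<phi>" by (simp add: exp_minus)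
      finally show "dist (T \<psi> t) (T \<phi> t) \<le> L / (1 + L) * dist \<psi> \<phi>"
        using in_S by (simp add: T_app dist_norm scaleR_diff_right[symmetric])
    qed
  qed
  then obtain \<psi> where \<psi>: "\<psi> \<in> S" "T \<psi> = \<psi>" by auto
  let ?du = "duhamel \<Lambda> z0 (\<lambda>s. H (ph \<psi> s))"
  have fp: "ph \<psi> t = ?du t" if "t \<ge> 0" for t
    using ph_T[OF \<psi>(1), of t] \<psi>(2) that p by simp
  show thesis
  proof
    show "?du 0 = z0" by simp
    show "?du t \<in> D" if "t \<ge> 0" for t using duD[OF \<psi>(1) that] .
    show "(?du has_vector_derivative \<Lambda> *\<^sub>R (H (?du t) - ?du t)) (at t within {0..})" if "t \<ge> 0" for t
      using duhamel_has_vector_derivative[OF Hc[OF \<psi>(1)] that, of \<Lambda> z0] by (simp add: fp[OF that])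
  qed
qed

section \<open>Seminormed phase spaces\<close>

text \<open>What the two phase spaces share as seminormed function algebras. \<open>N_le\<close>
  asks for a bound on all of \<open>'a\<close> because representatives are total functions, part of
  whose values \<open>N\<close> ignores. \<open>Xplus_bounded_rep\<close> supplies starting values
  for the Banach space argument, and \<open>uniform_limit_mem\<close> makes the invariant set closed
  in it.\<close>

locale phase_space =
  fixes M :: "('a \<Rightarrow> real) set" and N :: "('a \<Rightarrow> real) \<Rightarrow> real"
  assumes const_mem: "(\<lambda>x. c) \<in> M"
    and add_mem: "z \<in> M \<Longrightarrow> w \<in> M \<Longrightarrow> (\<lambda>x. z x + w x) \<in> M"
    and mult_mem: "z \<in> M \<Longrightarrow> w \<in> M \<Longrightarrow> (\<lambda>x. z x * w x) \<in> M"
    and N_nonneg: "z \<in> M \<Longrightarrow> 0 \<le> N z"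
    and N_add: "z \<in> M \<Longrightarrow> w \<in> M \<Longrightarrow> N (\<lambda>x. z x + w x) \<le> N z + N w"
    and N_mult: "z \<in> M \<Longrightarrow> w \<in> M \<Longrightarrow> N (\<lambda>x. z x * w x) \<le> N z * N w"
    and N_le: "z \<in> M \<Longrightarrow> (\<And>x. \<bar>z x\<bar> \<le> b) \<Longrightarrow> N z \<le> b"
    and uniform_limit_mem: "(\<And>n::nat. W n \<in> M) \<Longrightarrow> uniform_limit UNIV W z sequentially \<Longrightarrow> z \<in> M"
    and Xplus_bounded_rep: "z \<in> Xplus M N \<Longrightarrow>
      \<exists>w\<in>M. (\<forall>x. 0 \<le> w x \<and> w x \<le> N z) \<and> N (\<lambda>x. z x - w x) = 0"
begin

lemma cmult_mem: "z \<in> M \<Longrightarrow> (\<lambda>x. c * z x) \<in> M"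
  using mult_mem[OF const_mem] by simp

lemma diff_mem: "z \<in> M \<Longrightarrow> w \<in> M \<Longrightarrow> (\<lambda>x. z x - w x) \<in> M"
  using add_mem[OF _ cmult_mem[of w "-1"], of z] by simp

lemma power2_mem: "z \<in> M \<Longrightarrow> (\<lambda>x. (z x)\<^sup>2) \<in> M"
  using mult_mem[of z z] by (simp add: power2_eq_square)

lemmas mem_intros = const_mem add_mem mult_mem diff_mem power2_mem

lemma N_cmult: "z \<in> M \<Longrightarrow> N (\<lambda>x. c * z x) \<le> \<bar>c\<bar> * N z"
proof -
  assume z: "z \<in> M"
  have "N (\<lambda>x. c * z x) \<le> N (\<lambda>x. c) * N z" using N_mult[OF const_mem z] .
  also have "\<dots> \<le> \<bar>c\<bar> * N z"
    using N_nonneg[OF z] by (intro mult_right_mono N_le const_mem) auto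
  finally show ?thesis .
qed

lemma N_zero [simp]: "N (\<lambda>x. 0) = 0"
  using N_le[OF const_mem, of 0 0] N_nonneg[OF const_mem, of 0] by simp

lemma N_diff: "z \<in> M \<Longrightarrow> w \<in> M \<Longrightarrow> N (\<lambda>x. z x - w x) \<le> N z + N w"
  using N_add[OF _ cmult_mem[of w "-1"], of z] N_cmult[of w "-1"] by simp

lemma N_diff_commute: "z \<in> M \<Longrightarrow> w \<in> M \<Longrightarrow> N (\<lambda>x. z x - w x) = N (\<lambda>x. w x - z x)"
  using N_cmult[OF diff_mem[of z w], of "-1"] N_cmult[OF diff_mem[of w z], of "-1"]
  by (simp add: algebra_simps)

lemma N_diff_triangle:
  "z \<in> M \<Longrightarrow> y \<in> M \<Longrightarrow> w \<in> M \<Longrightarrow> N (\<lambda>x. z x - w x) \<le> N (\<lambda>x. z x - y x) + N (\<lambda>x. y x - w x)"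
  using N_add[OF diff_mem[of z y] diff_mem[of y w]] by simp

lemma N_le_N_diff: "z \<in> M \<Longrightarrow> w \<in> M \<Longrightarrow> N z \<le> N w + N (\<lambda>x. z x - w x)"
  using N_add[of w, OF _ diff_mem[of z w]] by simp

lemma abs_N_diff_le: "z \<in> M \<Longrightarrow> w \<in> M \<Longrightarrow> \<bar>N z - N w\<bar> \<le> N (\<lambda>x. z x - w x)"
  using N_le_N_diff[of z w] N_le_N_diff[of w z] N_diff_commute[of z w] by simp

lemma Xeq_iff: "z \<in> M \<Longrightarrow> w \<in> M \<Longrightarrow> Xeq M N z w \<longleftrightarrow> N (\<lambda>x. z x - w x) = 0"
  by (simp add: Xeq_def diff_mem)

lemma Xplus_mem: "z \<in> Xplus M N \<Longrightarrow> z \<in> M"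
  by (simp add: Xplus_def)

lemma XplusI: "z \<in> M \<Longrightarrow> (\<And>x. 0 \<le> z x) \<Longrightarrow> z \<in> Xplus M N"
  by (simp add: Xplus_def min_absorb2)

text \<open>\<open>w\<close> is \<open>z\<close> minus the difference that \<open>Xeq\<close> places
  in \<open>M\<close>. In this way right-hand sides inherit membership from derivatives.\<close>

lemma Xeq_memD: "Xeq M N z w \<Longrightarrow> z \<in> M \<Longrightarrow> w \<in> M"
  using diff_mem[of z "\<lambda>x. z x - w x"] by (simp add: Xeq_def)

section \<open>Continuous and differentiable curves in a phase space\<close>

lemma X_cont_continuous_N:
  assumes "X_cont M N w"
  shows "continuous_on {0..} (\<lambda>t. N (w t))"
  unfolding continuous_on_iff
proof (intro ballI allI impI)
  fix t \<epsilon> :: real assume t: "t \<in> {0..}" and \<epsilon>: "\<epsilon> > 0"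
  with assms obtain \<delta> where \<delta>: "\<delta> > 0" "\<And>s. s \<ge> 0 \<Longrightarrow> \<bar>s - t\<bar> < \<delta> \<Longrightarrow> N (\<lambda>x. w s x - w t x) \<le> \<epsilon> / 2"
    unfolding X_cont_def by (metis atLeast_iff half_gt_zero)
  have M: "w s \<in> M" if "s \<ge> 0" for s using assms that by (auto simp: X_cont_def)
  have "dist (N (w s)) (N (w t)) < \<epsilon>" if "s \<ge> 0" "dist s t < \<delta>" for s
    using \<delta>(2)[of s] that abs_N_diff_le[OF M M, of s t] t \<epsilon> by (simp add: dist_real_def)
  then show "\<exists>d>0. \<forall>s\<in>{0..}. dist s t < d \<longrightarrow> dist (N (w s)) (N (w t)) < \<epsilon>"
    using \<delta>(1) by auto
qed

lemma X_cont_diff: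
  assumes w: "X_cont M N w" and p: "X_cont M N p"
  shows "X_cont M N (\<lambda>t x. w t x - p t x)"
  unfolding X_cont_def
proof (intro allI impI conjI)
  fix t :: real assume t: "t \<ge> 0"
  have M: "w s \<in> M" "p s \<in> M" if "s \<ge> 0" for s using assms that by (auto simp: X_cont_def)
  show "(\<lambda>x. w t x - p t x) \<in> M" using M t by (simp add: diff_mem)
  fix \<epsilon> :: real assume \<epsilon>: "\<epsilon> > 0"
  obtain \<delta>1 where \<delta>1: "\<delta>1 > 0" "\<And>s. s \<ge> 0 \<Longrightarrow> \<bar>s - t\<bar> < \<delta>1 \<Longrightarrow> N (\<lambda>x. w s x - w t x) \<le> \<epsilon> / 2"
    using w t \<epsilon> unfolding X_cont_def by (meson half_gt_zero)
  obtain \<delta>2 where \<delta>2: "\<delta>2 > 0" "\<And>s. s \<ge> 0 \<Longrightarrow> \<bar>s - t\<bar> < \<delta>2 \<Longrightarrow> N (\<lambda>x. p s x - p t x) \<le> \<epsilon> / 2"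
    using p t \<epsilon> unfolding X_cont_def by (meson half_gt_zero)
  have "N (\<lambda>x. (w s x - p s x) - (w t x - p t x)) \<le> \<epsilon>"
    if s: "s \<ge> 0" "\<bar>s - t\<bar> < min \<delta>1 \<delta>2" for s
  proof -
    have "N (\<lambda>x. (w s x - p s x) - (w t x - p t x)) = N (\<lambda>x. (w s x - w t x) - (p s x - p t x))"
      by (simp add: algebra_simps)
    also have "\<dots> \<le> N (\<lambda>x. w s x - w t x) + N (\<lambda>x. p s x - p t x)"
      using M s t by (intro N_diff diff_mem) auto
    finally show ?thesis using \<delta>1(2)[of s] \<delta>2(2)[of s] s by simp
  qed
  then show "\<exists>\<delta>>0. \<forall>s\<ge>0. \<bar>s - t\<bar> < \<delta> \<longrightarrow> N (\<lambda>x. (w s x - p s x) - (w t x - p t x)) \<le> \<epsilon>"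
    using \<delta>1(1) \<delta>2(1) by (intro exI[of _ "min \<delta>1 \<delta>2"]) auto
qed

lemma X_deriv_imp_X_cont:
  assumes u: "X_deriv M N u u'" and M: "\<And>t. t \<ge> 0 \<Longrightarrow> u t \<in> M"
  shows "X_cont M N u"
  unfolding X_cont_def
proof (intro allI impI conjI)
  fix t :: real assume t: "t \<ge> 0"
  then show "u t \<in> M" by (rule M)
  fix \<epsilon> :: real assume \<epsilon>: "\<epsilon> > 0"
  have u': "u' t \<in> M" using u t by (simp add: X_deriv_def)
  obtain \<delta> where \<delta>: "\<delta> > 0" "\<And>s. s \<ge> 0 \<Longrightarrow> \<bar>s - t\<bar> < \<delta> \<Longrightarrow>
      N (\<lambda>x. u s x - u t x - (s - t) * u' t x) \<le> 1 * \<bar>s - t\<bar>"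
    using u t unfolding X_deriv_def by (meson zero_less_one)
  \<comment> \<open>A Lipschitz constant at t: the slope \<open>N (u' t)\<close> plus the
    differentiability remainder taken with tolerance 1.\<close>
  define C where "C = 1 + N (u' t)"
  have C: "C > 0" using N_nonneg[OF u'] by (simp add: C_def)
  have "N (\<lambda>x. u s x - u t x) \<le> \<epsilon>" if s: "s \<ge> 0" "\<bar>s - t\<bar> < min \<delta> (\<epsilon> / C)" for s
  proof -
    have "N (\<lambda>x. u s x - u t x) \<le> N (\<lambda>x. u s x - u t x - (s - t) * u' t x) + N (\<lambda>x. (s - t) * u' t x)"
      using N_add[of "\<lambda>x. u s x - u t x - (s - t) * u' t x" "\<lambda>x. (s - t) * u' t x"] M[OF s(1)] M[OF t] u'
      by (auto simp: mem_intros)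
    also have "\<dots> \<le> 1 * \<bar>s - t\<bar> + \<bar>s - t\<bar> * N (u' t)"
      using s u' by (intro add_mono \<delta>(2) N_cmult) auto
    also have "\<dots> = \<bar>s - t\<bar> * C" by (simp add: C_def algebra_simps)
    also have "\<dots> \<le> \<epsilon>" using s C by (simp add: field_simps)
    finally show ?thesis .
  qed
  then show "\<exists>\<delta>>0. \<forall>s\<ge>0. \<bar>s - t\<bar> < \<delta> \<longrightarrow> N (\<lambda>x. u s x - u t x) \<le> \<epsilon>"
    using \<delta>(1) \<epsilon> C by (intro exI[of _ "min \<delta> (\<epsilon> / C)"]) auto
qed

text \<open>The seminorm of a difference of differentiable curves need not be differentiable in
  time. The triangle inequality still bounds its right increments, in the form that
  \<open>gronwall_dini\<close> takes.\<close>

lemma X_deriv_dini: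
  assumes u: "X_deriv M N u u'" and p: "X_deriv M N p p'"
    and M: "\<And>t. t \<ge> 0 \<Longrightarrow> u t \<in> M" "\<And>t. t \<ge> 0 \<Longrightarrow> p t \<in> M"
    and t: "t \<ge> 0" and \<epsilon>: "\<epsilon> > 0"
  obtains \<delta> where "\<delta> > 0" "\<And>s. t < s \<Longrightarrow> s < t + \<delta> \<Longrightarrow>
    N (\<lambda>x. u s x - p s x) \<le> N (\<lambda>x. u t x - p t x) + (s - t) * (N (\<lambda>x. u' t x - p' t x) + \<epsilon>)"
proof -
  have M': "u' t \<in> M" "p' t \<in> M" using u p t by (auto simp: X_deriv_def)
  obtain \<delta>1 where \<delta>1: "\<delta>1 > 0" "\<And>s. s \<ge> 0 \<Longrightarrow> \<bar>s - t\<bar> < \<delta>1 \<Longrightarrow>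
      N (\<lambda>x. u s x - u t x - (s - t) * u' t x) \<le> \<epsilon> / 2 * \<bar>s - t\<bar>"
    using u t \<epsilon> unfolding X_deriv_def by (meson half_gt_zero)
  obtain \<delta>2 where \<delta>2: "\<delta>2 > 0" "\<And>s. s \<ge> 0 \<Longrightarrow> \<bar>s - t\<bar> < \<delta>2 \<Longrightarrow>
      N (\<lambda>x. p s x - p t x - (s - t) * p' t x) \<le> \<epsilon> / 2 * \<bar>s - t\<bar>"
    using p t \<epsilon> unfolding X_deriv_def by (meson half_gt_zero)
  show thesis
  proof
    show "min \<delta>1 \<delta>2 > 0" using \<delta>1 \<delta>2 by simp
    fix s assume s: "t < s" "s < t + min \<delta>1 \<delta>2"
    have Ms: "u s \<in> M" "p s \<in> M" "u t \<in> M" "p t \<in> M" using M s t by auto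
    let ?a = "\<lambda>x. u s x - u t x - (s - t) * u' t x" and ?b = "\<lambda>x. p s x - p t x - (s - t) * p' t x"
    let ?c = "\<lambda>x. u t x - p t x" and ?d = "\<lambda>x. u' t x - p' t x"
    have ab: "?a \<in> M" "?b \<in> M" "?c \<in> M" "?d \<in> M" using Ms M' by (auto intro!: mem_intros)
    have "N (\<lambda>x. u s x - p s x) = N (\<lambda>x. (?c x + (s - t) * ?d x) + (?a x - ?b x))"
      by (simp add: algebra_simps)
    also have "\<dots> \<le> N (\<lambda>x. ?c x + (s - t) * ?d x) + N (\<lambda>x. ?a x - ?b x)"
      using ab by (intro N_add add_mem diff_mem[OF ab(1,2)] cmult_mem[OF ab(4)])
    also have "\<dots> \<le> (N ?c + \<bar>s - t\<bar> * N ?d) + (N ?a + N ?b)"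
      using N_add[OF ab(3) cmult_mem[OF ab(4)], of "s - t"] N_cmult[OF ab(4), of "s - t"] N_diff[OF ab(1,2)]
      by linarith
    also have "\<dots> \<le> N ?c + (s - t) * (N ?d + \<epsilon>)"
    proof -
      have "N ?a \<le> \<epsilon> / 2 * (s - t)" "N ?b \<le> \<epsilon> / 2 * (s - t)"
        using \<delta>1(2)[of s] \<delta>2(2)[of s] s t by simp_all
      then have "N ?a + N ?b \<le> (s - t) * \<epsilon>" by (simp add: field_simps)
      then show ?thesis using s by (simp add: distrib_left)
    qed
    finally show "N (\<lambda>x. u s x - p s x) \<le> N ?c + (s - t) * (N ?d + \<epsilon>)" .
  qed
qed

end

text \<open>On bounded representatives G z = K z - g * z up to N-null functions; the positivity of K is
  what the invariance argument uses, and it holds pointwise, unlike any property of G.\<close>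

locale nonlocal_operator = phase_space M N
  for M :: "('a \<Rightarrow> real) set" and N :: "('a \<Rightarrow> real) \<Rightarrow> real" +
  fixes G K :: "('a \<Rightarrow> real) \<Rightarrow> 'a \<Rightarrow> real" and g :: "'a \<Rightarrow> real" and c :: real
  assumes G_mem: "z \<in> M \<Longrightarrow> G z \<in> M"
    and G_lip: "z \<in> M \<Longrightarrow> w \<in> M \<Longrightarrow> N (\<lambda>x. G z x - G w x) \<le> 2 * c * N (\<lambda>x. z x - w x)"
    and K_mem: "z \<in> M \<Longrightarrow> (\<And>x. \<bar>z x\<bar> \<le> b) \<Longrightarrow> K z \<in> M"
    and K_lip: "z \<in> M \<Longrightarrow> w \<in> M \<Longrightarrow> (\<And>x. \<bar>z x\<bar> \<le> b) \<Longrightarrow> (\<And>x. \<bar>w x\<bar> \<le> b) \<Longrightarrow>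
      (\<And>x. \<bar>z x - w x\<bar> \<le> r) \<Longrightarrow> \<bar>K z x - K w x\<bar> \<le> c * r"
    and K_ge: "z \<in> M \<Longrightarrow> (\<And>x. 0 \<le> z x) \<Longrightarrow> (\<And>x. z x \<le> b) \<Longrightarrow> 0 \<le> K z x"
    and K_le: "z \<in> M \<Longrightarrow> (\<And>x. 0 \<le> z x) \<Longrightarrow> (\<And>x. z x \<le> b) \<Longrightarrow> K z x \<le> g x * b"
    and g_mem: "g \<in> M" and g_ge: "0 \<le> g x" and g_le: "g x \<le> c"
    and G_eq: "z \<in> M \<Longrightarrow> (\<And>x. \<bar>z x\<bar> \<le> b) \<Longrightarrow> N (\<lambda>x. (K z x - g x * z x) - G z x) = 0"

section \<open>All bounded functions as a Banach space\<close>

definition ev :: "('a discrete \<Rightarrow>\<^sub>C real) \<Rightarrow> 'a \<Rightarrow> real" where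
  "ev u x = apply_bcontfun u (discrete x)"

text \<open>In the discrete topology every function is continuous, so bounded continuous functions
  on \<open>'a discrete\<close> are all bounded functions on \<open>'a\<close>, with the supremum
  norm. \<open>emb\<close> is used on bounded \<open>h\<close> only, where \<open>ev\<close> inverts
  it.\<close>

definition emb :: "('a \<Rightarrow> real) \<Rightarrow> 'a discrete \<Rightarrow>\<^sub>C real" where
  "emb h = Bcontfun (\<lambda>p. h (of_discrete p))"

lemma ev_emb:
  assumes "\<And>x. \<bar>h x\<bar> \<le> b"
  shows "ev (emb h) = h"
proof -
  have "continuous_on UNIV (\<lambda>p. h (of_discrete p))"
    by (simp add: continuous_on_open_vimage open_discrete)
  then have "apply_bcontfun (emb h) = (\<lambda>p. h (of_discrete p))"
    unfolding emb_def using assms by (intro Bcontfun_inverse bcontfun_normI[of _ b]) auto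
  then show ?thesis by (auto simp: ev_def discrete_inverse)
qed

lemma ev_simps [simp]:
  "ev (u + v) x = ev u x + ev v x" "ev (u - v) x = ev u x - ev v x" "ev (r *\<^sub>R u) x = r * ev u x"
  by (simp_all add: ev_def)

lemma abs_ev_le_norm: "\<bar>ev u x\<bar> \<le> norm u"
  using norm_bounded[of u "discrete x"] by (simp add: ev_def)

lemma abs_ev_diff_le_dist: "\<bar>ev u x - ev v x\<bar> \<le> dist u v"
  using abs_ev_le_norm[of "u - v" x] by (simp add: dist_norm)

lemma norm_le_ev: "(\<And>x. \<bar>ev u x\<bar> \<le> b) \<Longrightarrow> norm u \<le> b"
  by (rule norm_bound) (metis ev_def of_discrete_inverse real_norm_def)

lemma dist_le_ev: "(\<And>x. \<bar>ev u x - ev v x\<bar> \<le> b) \<Longrightarrow> dist u v \<le> b"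
  unfolding dist_norm by (rule norm_le_ev) simp

lemma tendsto_ev_uniform_limit: "(f \<longlongrightarrow> l) F \<Longrightarrow> uniform_limit UNIV (\<lambda>n. ev (f n)) (ev l) F"
  by (drule tendsto_bcontfun_uniform_limit) (simp add: uniform_limit_iff ev_def, fast elim: eventually_mono)

lemma cubic_diff_eq: "u * v\<^sup>2 - p * q\<^sup>2 = (u - p) * v\<^sup>2 + p * (v - q) * (v + q)" for u v p q :: real
  by (simp add: power2_eq_square algebra_simps)

text \<open>In the splitting \<open>cubic_diff_eq\<close> the value u enters only through u - p, so
  bounds on p, v and q suffice; the factor v + q costs 2 * R.\<close>

lemma abs_cubic_diff_le:
  fixes u v p q :: real
  assumes "\<bar>p\<bar> \<le> R" "\<bar>v\<bar> \<le> R" "\<bar>q\<bar> \<le> R"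
  shows "\<bar>u * v\<^sup>2 - p * q\<^sup>2\<bar> \<le> 2 * R\<^sup>2 * (\<bar>u - p\<bar> + \<bar>v - q\<bar>)"
proof -
  have "\<bar>u * v\<^sup>2 - p * q\<^sup>2\<bar> \<le> \<bar>u - p\<bar> * \<bar>v\<bar>\<^sup>2 + \<bar>p\<bar> * \<bar>v - q\<bar> * \<bar>v + q\<bar>"
    unfolding cubic_diff_eq by (rule order_trans[OF abs_triangle_ineq]) (simp add: abs_mult)
  also have "\<dots> \<le> \<bar>u - p\<bar> * R\<^sup>2 + R * \<bar>v - q\<bar> * (2 * R)"
    using assms by (intro add_mono mult_mono power_mono) auto
  also have "\<dots> \<le> 2 * R\<^sup>2 * (\<bar>u - p\<bar> + \<bar>v - q\<bar>)"
  proof -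
    have "0 \<le> \<bar>u - p\<bar> * R\<^sup>2" by simp
    then show ?thesis by (simp add: power2_eq_square algebra_simps)
  qed
  finally show ?thesis .
qed

text \<open>Lets \<open>ode_closed_convex\<close> be applied to pairs of bounded functions.\<close>

instance bcontfun :: (metric_space, banach) banach ..

section \<open>The Gray--Scott system in an abstract phase space\<close>

locale gray_scott =
  A1: nonlocal_operator M N "Gam \<Omega> \<gamma>1" K1 g1 c + A2: nonlocal_operator M N "Gam \<Omega> \<gamma>2" K2 g2 c
  for M :: "('a::euclidean_space \<Rightarrow> real) set" and N :: "('a \<Rightarrow> real) \<Rightarrow> real"
    and \<Omega> :: "'a set" and \<gamma>1 \<gamma>2 :: "'a \<Rightarrow> 'a \<Rightarrow> real"
    and K1 K2 :: "('a \<Rightarrow> real) \<Rightarrow> 'a \<Rightarrow> real" and g1 g2 :: "'a \<Rightarrow> real" and c :: real +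
  fixes d1 d2 f \<kappa> :: real
  assumes pos: "d1 > 0" "d2 > 0" "f > 0" "\<kappa> > 0"
begin

abbreviation "solves \<equiv> GS_sol M N \<Omega> \<gamma>1 \<gamma>2 d1 d2 f \<kappa>"

definition rhs_u :: "('a \<Rightarrow> real) \<Rightarrow> ('a \<Rightarrow> real) \<Rightarrow> 'a \<Rightarrow> real" where
  "rhs_u u v = (\<lambda>x. d1 * Gam \<Omega> \<gamma>1 u x - u x * (v x)\<^sup>2 + f * (1 - u x))"

definition rhs_v :: "('a \<Rightarrow> real) \<Rightarrow> ('a \<Rightarrow> real) \<Rightarrow> 'a \<Rightarrow> real" where
  "rhs_v u v = (\<lambda>x. d2 * Gam \<Omega> \<gamma>2 v x + u x * (v x)\<^sup>2 - (f + \<kappa>) * v x)"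

lemma c_nonneg: "c \<ge> 0"
  using A1.g_ge A1.g_le order_trans by blast

lemma rhs_mem: "u \<in> M \<Longrightarrow> v \<in> M \<Longrightarrow> rhs_u u v \<in> M" "u \<in> M \<Longrightarrow> v \<in> M \<Longrightarrow> rhs_v u v \<in> M"
  unfolding rhs_u_def rhs_v_def by (auto intro!: A1.mem_intros A1.G_mem A2.G_mem)

lemma N_cubic_diff_le:
  assumes M: "u \<in> M" "v \<in> M" "p \<in> M" "q \<in> M" and R: "N v \<le> R" "N p \<le> R" "N q \<le> R"
  shows "N (\<lambda>x. u x * (v x)\<^sup>2 - p x * (q x)\<^sup>2) \<le> 2 * R\<^sup>2 * (N (\<lambda>x. u x - p x) + N (\<lambda>x. v x - q x))"
proof -
  have R0: "R \<ge> 0" using A1.N_nonneg[OF M(2)] R by simp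
  let ?a = "\<lambda>x. u x - p x" and ?b = "\<lambda>x. v x - q x" and ?s = "\<lambda>x. v x + q x"
  have mem: "?a \<in> M" "?b \<in> M" "?s \<in> M" "(\<lambda>x. v x * v x) \<in> M" "(\<lambda>x. ?b x * ?s x) \<in> M"
    using M by (auto intro!: A1.mem_intros)
  have nn: "0 \<le> N ?a" "0 \<le> N ?b" "0 \<le> N v" "0 \<le> N ?s" "0 \<le> N p" "0 \<le> N (\<lambda>x. ?b x * ?s x)"
    using M mem by (auto intro: A1.N_nonneg)
  have "N (\<lambda>x. u x * (v x)\<^sup>2 - p x * (q x)\<^sup>2) = N (\<lambda>x. ?a x * (v x * v x) + p x * (?b x * ?s x))"
    by (simp add: power2_eq_square algebra_simps)
  also have "\<dots> \<le> N (\<lambda>x. ?a x * (v x * v x)) + N (\<lambda>x. p x * (?b x * ?s x))"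
    using M mem by (intro A1.N_add A1.mult_mem)
  also have "\<dots> \<le> N ?a * (R * R) + R * (N ?b * (R + R))"
  proof (rule add_mono)
    have "N (\<lambda>x. v x * v x) \<le> R * R"
      using A1.N_mult[OF M(2,2)] mult_mono[OF R(1,1) R0 nn(3)] by linarith
    then show "N (\<lambda>x. ?a x * (v x * v x)) \<le> N ?a * (R * R)"
      using A1.N_mult[OF mem(1,4)] mult_left_mono[OF _ nn(1)] order_trans by blast
    have "N ?s \<le> R + R" using A1.N_add[OF M(2,4)] R by simp
    then have "N (\<lambda>x. ?b x * ?s x) \<le> N ?b * (R + R)"
      using A1.N_mult[OF mem(2,3)] mult_left_mono[OF _ nn(2)] order_trans by blast
    then have "N p * N (\<lambda>x. ?b x * ?s x) \<le> R * (N ?b * (R + R))"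
      using R nn R0 by (intro mult_mono)
    then show "N (\<lambda>x. p x * (?b x * ?s x)) \<le> R * (N ?b * (R + R))"
      using A1.N_mult[OF M(3) mem(5)] by linarith
  qed
  also have "\<dots> \<le> 2 * R\<^sup>2 * (N ?a + N ?b)"
    using mult_nonneg_nonneg[OF R0 mult_nonneg_nonneg[OF R0 nn(1)]] by (simp add: power2_eq_square algebra_simps)
  finally show ?thesis .
qed

text \<open>One constant serves both components and depends on the states only through
  \<open>R\<close>, so the sum of the two seminorms obeys a scalar Gronwall inequality.\<close>

lemma rhs_lipschitz:
  assumes M: "u \<in> M" "v \<in> M" "p \<in> M" "q \<in> M" and R: "N v \<le> R" "N p \<le> R" "N q \<le> R"
  defines "L \<equiv> 2 * d1 * c + 2 * d2 * c + 2 * R\<^sup>2 + f + \<kappa>"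
  shows "N (\<lambda>x. rhs_u u v x - rhs_u p q x) \<le> L * (N (\<lambda>x. u x - p x) + N (\<lambda>x. v x - q x))"
    and "N (\<lambda>x. rhs_v u v x - rhs_v p q x) \<le> L * (N (\<lambda>x. u x - p x) + N (\<lambda>x. v x - q x))"
proof -
  let ?a = "\<lambda>x. u x - p x" and ?b = "\<lambda>x. v x - q x"
  let ?r = "\<lambda>x. u x * (v x)\<^sup>2 - p x * (q x)\<^sup>2"
  let ?g = "\<lambda>x. Gam \<Omega> \<gamma>1 u x - Gam \<Omega> \<gamma>1 p x" and ?h = "\<lambda>x. Gam \<Omega> \<gamma>2 v x - Gam \<Omega> \<gamma>2 q x"
  have mem: "?a \<in> M" "?b \<in> M" "?r \<in> M" "?g \<in> M" "?h \<in> M"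
    using M by (auto intro!: A1.mem_intros A1.G_mem A2.G_mem)
  have nn: "0 \<le> N ?a" "0 \<le> N ?b" using mem by (auto intro: A1.N_nonneg)
  have r: "N ?r \<le> 2 * R\<^sup>2 * (N ?a + N ?b)" using M R by (rule N_cubic_diff_le)
  have p2: "0 \<le> d1 * c * N ?a" "0 \<le> d2 * c * N ?a" "0 \<le> d1 * c * N ?b" "0 \<le> d2 * c * N ?b"
    "0 \<le> f * N ?a" "0 \<le> f * N ?b" "0 \<le> \<kappa> * N ?a" "0 \<le> \<kappa> * N ?b"
    using pos c_nonneg nn by auto
  have "N (\<lambda>x. rhs_u u v x - rhs_u p q x) = N (\<lambda>x. (d1 * ?g x - ?r x) - f * ?a x)"
    by (simp add: rhs_u_def algebra_simps)
  also have "\<dots> \<le> (N (\<lambda>x. d1 * ?g x) + N ?r) + N (\<lambda>x. f * ?a x)"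
    using A1.N_diff[OF A1.diff_mem[OF A1.cmult_mem[OF mem(4)] mem(3)] A1.cmult_mem[OF mem(1)], of d1 f]
      A1.N_diff[OF A1.cmult_mem[OF mem(4)] mem(3), of d1] by linarith
  also have "\<dots> \<le> (\<bar>d1\<bar> * N ?g + 2 * R\<^sup>2 * (N ?a + N ?b)) + \<bar>f\<bar> * N ?a"
    using mem r by (intro add_mono A1.N_cmult)
  also have "\<dots> \<le> (\<bar>d1\<bar> * (2 * c * N ?a) + 2 * R\<^sup>2 * (N ?a + N ?b)) + \<bar>f\<bar> * N ?a"
    using M by (intro add_mono mult_left_mono A1.G_lip) auto
  also have "\<dots> \<le> L * (N ?a + N ?b)"
    using pos p2 by (simp add: L_def algebra_simps)
  finally show "N (\<lambda>x. rhs_u u v x - rhs_u p q x) \<le> L * (N ?a + N ?b)" .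
  have "N (\<lambda>x. rhs_v u v x - rhs_v p q x) = N (\<lambda>x. (d2 * ?h x + ?r x) - (f + \<kappa>) * ?b x)"
    by (simp add: rhs_v_def algebra_simps)
  also have "\<dots> \<le> (N (\<lambda>x. d2 * ?h x) + N ?r) + N (\<lambda>x. (f + \<kappa>) * ?b x)"
    using A1.N_diff[OF A1.add_mem[OF A1.cmult_mem[OF mem(5)] mem(3)] A1.cmult_mem[OF mem(2)], of d2 "f + \<kappa>"]
      A1.N_add[OF A1.cmult_mem[OF mem(5)] mem(3), of d2] by linarith
  also have "\<dots> \<le> (\<bar>d2\<bar> * N ?h + 2 * R\<^sup>2 * (N ?a + N ?b)) + \<bar>f + \<kappa>\<bar> * N ?b"
    using mem r by (intro add_mono A1.N_cmult)
  also have "\<dots> \<le> (\<bar>d2\<bar> * (2 * c * N ?b) + 2 * R\<^sup>2 * (N ?a + N ?b)) + \<bar>f + \<kappa>\<bar> * N ?b"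
    using M by (intro add_mono mult_left_mono A2.G_lip) auto
  also have "\<dots> \<le> L * (N ?a + N ?b)"
    using pos p2 by (simp add: L_def algebra_simps)
  finally show "N (\<lambda>x. rhs_v u v x - rhs_v p q x) \<le> L * (N ?a + N ?b)" .
qed

section \<open>Stability and uniqueness of solutions\<close>

lemma solves_mem:
  assumes "solves u0 v0 u v" "t \<ge> 0"
  shows "u t \<in> Xplus M N" "v t \<in> Xplus M N" "u t \<in> M" "v t \<in> M"
  using assms by (auto simp: GS_sol_def A1.Xplus_mem)

lemma solves_X_cont:
  assumes "solves u0 v0 u v"
  shows "X_cont M N u" "X_cont M N v"
proof -
  obtain u' v' where "X_deriv M N u u'" "X_deriv M N v v'" using assms by (auto simp: GS_sol_def)
  then show "X_cont M N u" "X_cont M N v"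
    using solves_mem[OF assms] by (auto intro: A1.X_deriv_imp_X_cont)
qed

text \<open>Gronwall for the sum of the two seminorms; equal data give uniqueness, nearby data
  continuous dependence. The factor 2 in \<open>L\<close> arises because each of the two components
  contributes the constant of \<open>rhs_lipschitz\<close> once.\<close>

lemma solves_stability:
  assumes sol: "solves u0 v0 u v" "solves p0 q0 p q"
    and R: "\<And>t. 0 \<le> t \<Longrightarrow> t \<le> T \<Longrightarrow> N (v t) \<le> R \<and> N (p t) \<le> R \<and> N (q t) \<le> R"
    and t: "0 \<le> t" "t \<le> T"
  defines "L \<equiv> 2 * (2 * d1 * c + 2 * d2 * c + 2 * R\<^sup>2 + f + \<kappa>)"
  shows "N (\<lambda>x. u t x - p t x) + N (\<lambda>x. v t x - q t x)
    \<le> (N (\<lambda>x. u0 x - p0 x) + N (\<lambda>x. v0 x - q0 x)) * exp (L * t)"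
proof -
  define e where "e = (\<lambda>t. N (\<lambda>x. u t x - p t x) + N (\<lambda>x. v t x - q t x))"
  obtain u' v' where uv': "X_deriv M N u u'" "X_deriv M N v v'"
    and uveq: "\<And>t. t > 0 \<Longrightarrow> Xeq M N (u' t) (rhs_u (u t) (v t))" "\<And>t. t > 0 \<Longrightarrow> Xeq M N (v' t) (rhs_v (u t) (v t))"
    and uv0: "Xeq M N (u 0) u0" "Xeq M N (v 0) v0"
    using sol(1) unfolding GS_sol_def rhs_u_def rhs_v_def by blast
  obtain p' q' where pq': "X_deriv M N p p'" "X_deriv M N q q'"
    and pqeq: "\<And>t. t > 0 \<Longrightarrow> Xeq M N (p' t) (rhs_u (p t) (q t))" "\<And>t. t > 0 \<Longrightarrow> Xeq M N (q' t) (rhs_v (p t) (q t))"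
    and pq0: "Xeq M N (p 0) p0" "Xeq M N (q 0) q0"
    using sol(2) unfolding GS_sol_def rhs_u_def rhs_v_def by blast
  note mem = solves_mem(3,4)[OF sol(1)] solves_mem(3,4)[OF sol(2)]
  \<comment> \<open>Derivatives match the right-hand sides only up to null functions, which do not
    affect the seminorm of a difference.\<close>
  have slope: "N (\<lambda>x. w x - y x) \<le> N (\<lambda>x. a x - b x)"
    if "Xeq M N w a" "Xeq M N y b" "w \<in> M" "y \<in> M" for w y a b
  proof -
    have ab: "a \<in> M" "b \<in> M" using that by (auto dest: A1.Xeq_memD)
    have "N (\<lambda>x. w x - y x) \<le> N (\<lambda>x. w x - a x) + (N (\<lambda>x. a x - b x) + N (\<lambda>x. b x - y x))"
      using A1.N_diff_triangle[of w a y] A1.N_diff_triangle[of a b y] that ab by simp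
    then show ?thesis using that ab A1.N_diff_commute[of b y] by (simp add: A1.Xeq_iff)
  qed
  have init: "e 0 \<le> N (\<lambda>x. u0 x - p0 x) + N (\<lambda>x. v0 x - q0 x)"
    unfolding e_def using uv0 pq0 mem[of 0] by (intro add_mono slope) auto
  have "e t \<le> e 0 * exp (L * t)"
  proof (rule gronwall_dini[OF _ _ t])
    show "continuous_on {0..T} e"
      unfolding e_def using solves_X_cont[OF sol(1)] solves_X_cont[OF sol(2)]
      by (intro continuous_on_subset[of "{0..}" _ "{0..T}"] continuous_on_add A1.X_cont_continuous_N A1.X_cont_diff) auto
    fix t \<epsilon> :: real assume t: "0 < t" "t < T" and \<epsilon>: "\<epsilon> > 0"
    have M': "u' t \<in> M" "v' t \<in> M" "p' t \<in> M" "q' t \<in> M"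
      using uv' pq' t by (auto simp: X_deriv_def)
    have L2: "L / 2 = 2 * d1 * c + 2 * d2 * c + 2 * R\<^sup>2 + f + \<kappa>" by (simp add: L_def)
    have Rt: "N (v t) \<le> R" "N (p t) \<le> R" "N (q t) \<le> R" using R[of t] t by auto
    have mt: "u t \<in> M" "v t \<in> M" "p t \<in> M" "q t \<in> M" using mem t by auto
    have "N (\<lambda>x. u' t x - p' t x) \<le> L / 2 * e t"
      using slope[OF uveq(1) pqeq(1) M'(1,3)] rhs_lipschitz(1)[OF mt Rt] t
      unfolding L2 e_def by linarith
    moreover have "N (\<lambda>x. v' t x - q' t x) \<le> L / 2 * e t"
      using slope[OF uveq(2) pqeq(2) M'(2,4)] rhs_lipschitz(2)[OF mt Rt] t
      unfolding L2 e_def by linarith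
    ultimately have sl: "N (\<lambda>x. u' t x - p' t x) + N (\<lambda>x. v' t x - q' t x) \<le> L * e t"
      by simp
    obtain \<delta>1 where \<delta>1: "\<delta>1 > 0" "\<And>s. t < s \<Longrightarrow> s < t + \<delta>1 \<Longrightarrow>
        N (\<lambda>x. u s x - p s x) \<le> N (\<lambda>x. u t x - p t x) + (s - t) * (N (\<lambda>x. u' t x - p' t x) + \<epsilon> / 2)"
      using A1.X_deriv_dini[OF uv'(1) pq'(1) mem(1,3), of t "\<epsilon> / 2"] t \<epsilon> by auto
    obtain \<delta>2 where \<delta>2: "\<delta>2 > 0" "\<And>s. t < s \<Longrightarrow> s < t + \<delta>2 \<Longrightarrow>
        N (\<lambda>x. v s x - q s x) \<le> N (\<lambda>x. v t x - q t x) + (s - t) * (N (\<lambda>x. v' t x - q' t x) + \<epsilon> / 2)"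
      using A1.X_deriv_dini[OF uv'(2) pq'(2) mem(2,4), of t "\<epsilon> / 2"] t \<epsilon> by auto
    have "e s \<le> e t + (s - t) * (L * e t + \<epsilon>)" if s: "t < s" "s < t + min \<delta>1 \<delta>2" for s
    proof -
      have "e s \<le> e t + (s - t) * ((N (\<lambda>x. u' t x - p' t x) + N (\<lambda>x. v' t x - q' t x)) + \<epsilon>)"
      proof -
        have "(s - t) * ((a + b) + \<epsilon>) = (s - t) * (a + \<epsilon> / 2) + (s - t) * (b + \<epsilon> / 2)" for a b
          by (simp add: field_simps)
        moreover have "s < t + \<delta>1" "s < t + \<delta>2" using s by auto
        ultimately show ?thesis using \<delta>1(2)[OF s(1)] \<delta>2(2)[OF s(1)] unfolding e_def by simp
      qed
      also have "\<dots> \<le> e t + (s - t) * (L * e t + \<epsilon>)"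
        using sl s by (intro add_mono mult_left_mono) auto
      finally show ?thesis .
    qed
    then show "\<exists>\<delta>>0. \<forall>s. t < s \<and> s < t + \<delta> \<longrightarrow> e s \<le> e t + (s - t) * (L * e t + \<epsilon>)"
      using \<delta>1(1) \<delta>2(1) by (intro exI[of _ "min \<delta>1 \<delta>2"]) auto
  qed
  also have "\<dots> \<le> (N (\<lambda>x. u0 x - p0 x) + N (\<lambda>x. v0 x - q0 x)) * exp (L * t)"
    using init by (intro mult_right_mono) auto
  finally show ?thesis by (simp add: e_def)
qed

text \<open>Seminorms along solutions are continuous, hence bounded on {0..t}. This bound serves as
  \<open>R\<close> in \<open>solves_stability\<close>, and with equal data the right-hand side there
  vanishes.\<close>

lemma solves_unique:
  assumes u0: "u0 \<in> M" "v0 \<in> M" and sol: "solves u0 v0 u v" "solves u0 v0 p q" and t: "t \<ge> 0"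
  shows "Xeq M N (u t) (p t) \<and> Xeq M N (v t) (q t)"
proof -
  have bdd: "\<exists>B. \<forall>s\<in>{0..t}. N (w s) \<le> B" if "X_cont M N w" for w
  proof -
    have "compact ((\<lambda>s. N (w s)) ` {0..t})"
      by (intro compact_continuous_image continuous_on_subset[OF A1.X_cont_continuous_N[OF that]]) auto
    then have "bdd_above ((\<lambda>s. N (w s)) ` {0..t})" by (intro bounded_imp_bdd_above compact_imp_bounded)
    then obtain B where "\<forall>y\<in>(\<lambda>s. N (w s)) ` {0..t}. y \<le> B" unfolding bdd_above_def by blast
    then show ?thesis by (intro exI[of _ B]) simp
  qed
  obtain B1 where B1: "\<forall>s\<in>{0..t}. N (v s) \<le> B1" using bdd[OF solves_X_cont(2)[OF sol(1)]] ..
  obtain B2 where B2: "\<forall>s\<in>{0..t}. N (p s) \<le> B2" using bdd[OF solves_X_cont(1)[OF sol(2)]] ..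
  obtain B3 where B3: "\<forall>s\<in>{0..t}. N (q s) \<le> B3" using bdd[OF solves_X_cont(2)[OF sol(2)]] ..
  define R where "R = max B1 (max B2 B3)"
  have "N (v s) \<le> R \<and> N (p s) \<le> R \<and> N (q s) \<le> R" if "0 \<le> s" "s \<le> t" for s
    using bspec[OF B1, of s] bspec[OF B2, of s] bspec[OF B3, of s] that by (auto simp: R_def)
  note stab = solves_stability[OF sol this t order_refl]
  have "N (\<lambda>x. u t x - p t x) + N (\<lambda>x. v t x - q t x) \<le> 0" using stab by simp
  moreover have mem: "u t \<in> M" "v t \<in> M" "p t \<in> M" "q t \<in> M"
    using solves_mem(3,4)[OF sol(1) t] solves_mem(3,4)[OF sol(2) t] by auto
  moreover have "0 \<le> N (\<lambda>x. u t x - p t x)" "0 \<le> N (\<lambda>x. v t x - q t x)"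
    using A1.N_nonneg[OF A1.diff_mem[OF mem(1,3)]] A1.N_nonneg[OF A1.diff_mem[OF mem(2,4)]] .
  ultimately have "N (\<lambda>x. u t x - p t x) = 0" "N (\<lambda>x. v t x - q t x) = 0" by linarith+
  with mem show ?thesis by (simp add: A1.Xeq_iff)
qed

section \<open>Translation in time\<close>

lemma X_deriv_shift:
  assumes "X_deriv M N u u'" "r \<ge> 0"
  shows "X_deriv M N (\<lambda>t. u (t + r)) (\<lambda>t. u' (t + r))"
  unfolding X_deriv_def
proof (intro allI impI conjI)
  fix t :: real assume t: "t \<ge> 0"
  show "u' (t + r) \<in> M" using assms t by (simp add: X_deriv_def)
  fix \<epsilon> :: real assume "\<epsilon> > 0"
  then obtain \<delta> where \<delta>: "\<delta> > 0" "\<And>s. s \<ge> 0 \<Longrightarrow> \<bar>s - (t + r)\<bar> < \<delta> \<Longrightarrow>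
      N (\<lambda>x. u s x - u (t + r) x - (s - (t + r)) * u' (t + r) x) \<le> \<epsilon> * \<bar>s - (t + r)\<bar>"
    using assms(1)[unfolded X_deriv_def, rule_format, of "t + r"] assms(2) t by auto
  show "\<exists>\<delta>>0. \<forall>s\<ge>0. \<bar>s - t\<bar> < \<delta> \<longrightarrow>
      N (\<lambda>x. u (s + r) x - u (t + r) x - (s - t) * u' (t + r) x) \<le> \<epsilon> * \<bar>s - t\<bar>"
  proof (intro exI[of _ \<delta>] conjI allI impI \<delta>(1))
    fix s :: real assume "s \<ge> 0" "\<bar>s - t\<bar> < \<delta>"
    then show "N (\<lambda>x. u (s + r) x - u (t + r) x - (s - t) * u' (t + r) x) \<le> \<epsilon> * \<bar>s - t\<bar>"
      using \<delta>(2)[of "s + r"] assms(2) by simp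
  qed
qed

lemma X_cont_shift:
  assumes "X_cont M N w" "r \<ge> 0"
  shows "X_cont M N (\<lambda>t. w (t + r))"
  unfolding X_cont_def
proof (intro allI impI conjI)
  fix t :: real assume t: "t \<ge> 0"
  show "w (t + r) \<in> M" using assms t by (simp add: X_cont_def)
  fix \<epsilon> :: real assume "\<epsilon> > 0"
  then obtain \<delta> where \<delta>: "\<delta> > 0" "\<And>s. s \<ge> 0 \<Longrightarrow> \<bar>s - (t + r)\<bar> < \<delta> \<Longrightarrow>
      N (\<lambda>x. w s x - w (t + r) x) \<le> \<epsilon>"
    using assms(1)[unfolded X_cont_def, rule_format, of "t + r"] assms(2) t by auto
  show "\<exists>\<delta>>0. \<forall>s\<ge>0. \<bar>s - t\<bar> < \<delta> \<longrightarrow> N (\<lambda>x. w (s + r) x - w (t + r) x) \<le> \<epsilon>"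
  proof (intro exI[of _ \<delta>] conjI allI impI \<delta>(1))
    fix s :: real assume "s \<ge> 0" "\<bar>s - t\<bar> < \<delta>"
    then show "N (\<lambda>x. w (s + r) x - w (t + r) x) \<le> \<epsilon>"
      using \<delta>(2)[of "s + r"] assms(2) by simp
  qed
qed

text \<open>The system is autonomous, so translates of the two derivatives witness the claim. This
  is one half of the semigroup law.\<close>

lemma solves_shift:
  assumes sol: "solves u0 v0 u v" and r: "r \<ge> 0"
  shows "solves (u r) (v r) (\<lambda>t. u (t + r)) (\<lambda>t. v (t + r))"
proof -
  obtain u' v' where uv': "X_deriv M N u u'" "X_deriv M N v v'" "X_cont M N u'" "X_cont M N v'"
    and eqs: "\<And>t. t > 0 \<Longrightarrow> Xeq M N (u' t) (rhs_u (u t) (v t))" "\<And>t. t > 0 \<Longrightarrow> Xeq M N (v' t) (rhs_v (u t) (v t))"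
    using sol unfolding GS_sol_def rhs_u_def rhs_v_def by blast
  have "Xeq M N (u r) (u r)" "Xeq M N (v r) (v r)"
    using solves_mem(3,4)[OF sol r] by (auto simp: A1.Xeq_iff)
  then show ?thesis
    unfolding GS_sol_def rhs_u_def[symmetric] rhs_v_def[symmetric]
    using solves_mem(1,2)[OF sol] r eqs
    by (intro conjI exI[of _ "\<lambda>t. u' (t + r)"] exI[of _ "\<lambda>t. v' (t + r)"] X_deriv_shift X_cont_shift uv') auto
qed

section \<open>The invariant region of the pointwise system\<close>

definition reac_u :: "('a \<Rightarrow> real) \<Rightarrow> ('a \<Rightarrow> real) \<Rightarrow> 'a \<Rightarrow> real" where
  "reac_u u v = (\<lambda>x. d1 * (K1 u x - g1 x * u x) - u x * (v x)\<^sup>2 + f * (1 - u x))"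

definition reac_v :: "('a \<Rightarrow> real) \<Rightarrow> ('a \<Rightarrow> real) \<Rightarrow> 'a \<Rightarrow> real" where
  "reac_v u v = (\<lambda>x. d2 * (K2 v x - g2 x * v x) + u x * (v x)\<^sup>2 - (f + \<kappa>) * v x)"

text \<open>The bounds are asked at every point of \<open>'a\<close> rather than almost everywhere,
  so that convexity and limits can be treated pointwise. \<open>v\<close> is bounded above only
  through the sum.\<close>

definition in_region :: "real \<Rightarrow> real \<Rightarrow> ('a \<Rightarrow> real) \<Rightarrow> ('a \<Rightarrow> real) \<Rightarrow> bool" where
  "in_region m k u v \<longleftrightarrow> u \<in> M \<and> v \<in> M \<and>
    (\<forall>x. 0 \<le> u x \<and> u x \<le> m \<and> 0 \<le> v x \<and> u x + v x \<le> k)"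

lemma in_regionD:
  assumes "in_region m k u v"
  shows "u \<in> M" "v \<in> M" "0 \<le> u x" "u x \<le> m" "0 \<le> v x" "u x + v x \<le> k" "u x \<le> k" "v x \<le> k"
    "\<bar>u x\<bar> \<le> k" "\<bar>v x\<bar> \<le> k"
proof -
  show "u \<in> M" "v \<in> M" using assms by (auto simp: in_region_def)
  show "0 \<le> u x" "u x \<le> m" "0 \<le> v x" "u x + v x \<le> k" using assms by (auto simp: in_region_def)
  then show "u x \<le> k" "v x \<le> k" "\<bar>u x\<bar> \<le> k" "\<bar>v x\<bar> \<le> k" by auto
qed

lemma reac_mem:
  assumes "in_region m k u v"
  shows "reac_u u v \<in> M" "reac_v u v \<in> M"
proof -
  note M = in_regionD(1,2)[OF assms]
  have K: "K1 u \<in> M" "K2 v \<in> M"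
    using A1.K_mem[OF M(1) in_regionD(9)[OF assms]] A2.K_mem[OF M(2) in_regionD(10)[OF assms]] .
  show "reac_u u v \<in> M" "reac_v u v \<in> M"
    unfolding reac_u_def reac_v_def
    by (intro A1.mem_intros M K A1.g_mem A2.g_mem)+
qed

text \<open>\<open>reac_u\<close> and \<open>reac_v\<close> arise from \<open>rhs_u\<close> and
  \<open>rhs_v\<close> when \<open>Gam\<close> is replaced by K z - g * z, which by
  \<open>G_eq\<close> changes them by null functions. Pointwise estimates are made for the former,
  while solutions are defined through the latter.\<close>

lemma reac_Xeq_rhs:
  assumes "in_region m k u v"
  shows "Xeq M N (reac_u u v) (rhs_u u v)" "Xeq M N (reac_v u v) (rhs_v u v)"
proof -
  note M = in_regionD(1,2)[OF assms]
  have K: "K1 u \<in> M" "K2 v \<in> M"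
    using A1.K_mem[OF M(1) in_regionD(9)[OF assms]] A2.K_mem[OF M(2) in_regionD(10)[OF assms]] .
  have *: "N (\<lambda>x. d * h x) = 0" if "h \<in> M" "N h = 0" for d h
    using A1.N_cmult[OF that(1), of d] A1.N_nonneg[OF A1.cmult_mem[OF that(1), of d]] that(2) by simp
  have "N (\<lambda>x. d1 * ((K1 u x - g1 x * u x) - Gam \<Omega> \<gamma>1 u x)) = 0"
    by (rule *[OF _ A1.G_eq[OF M(1) in_regionD(9)[OF assms]]]) (intro A1.mem_intros M K A1.g_mem A1.G_mem)
  then show "Xeq M N (reac_u u v) (rhs_u u v)"
    by (subst A1.Xeq_iff[OF reac_mem(1)[OF assms] rhs_mem(1)[OF M]])
      (simp add: reac_u_def rhs_u_def algebra_simps)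
  have "N (\<lambda>x. d2 * ((K2 v x - g2 x * v x) - Gam \<Omega> \<gamma>2 v x)) = 0"
    by (rule *[OF _ A2.G_eq[OF M(2) in_regionD(10)[OF assms]]]) (intro A1.mem_intros M K A2.g_mem A2.G_mem)
  then show "Xeq M N (reac_v u v) (rhs_v u v)"
    by (subst A1.Xeq_iff[OF reac_mem(2)[OF assms] rhs_mem(2)[OF M]])
      (simp add: reac_v_def rhs_v_def algebra_simps)
qed

lemma reac_lipschitz:
  assumes uv: "in_region m k u v" and pq: "in_region m k p q"
    and a: "\<And>x. \<bar>u x - p x\<bar> \<le> a" and b: "\<And>x. \<bar>v x - q x\<bar> \<le> b"
  defines "L \<equiv> 2 * d1 * c + 2 * d2 * c + 2 * k\<^sup>2 + f + \<kappa>"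
  shows "\<bar>reac_u u v x - reac_u p q x\<bar> \<le> L * (a + b)"
    and "\<bar>reac_v u v x - reac_v p q x\<bar> \<le> L * (a + b)"
proof -
  have ab: "0 \<le> a" "0 \<le> b" using order_trans[OF abs_ge_zero a] order_trans[OF abs_ge_zero b] .
  have cub: "\<bar>u x * (v x)\<^sup>2 - p x * (q x)\<^sup>2\<bar> \<le> 2 * k\<^sup>2 * (a + b)"
    by (rule order_trans[OF abs_cubic_diff_le[OF in_regionD(9)[OF pq] in_regionD(10)[OF uv] in_regionD(10)[OF pq]]])
      (intro mult_left_mono add_mono a b, simp)
  have nn: "0 \<le> d1 * (c * a)" "0 \<le> d2 * (c * a)" "0 \<le> d1 * (c * b)" "0 \<le> d2 * (c * b)" "0 \<le> f * a" "0 \<le> f * b" "0 \<le> \<kappa> * a" "0 \<le> \<kappa> * b"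
    using pos c_nonneg ab by auto
  \<comment> \<open>K and multiplication by g each have Lipschitz constant c, whence the factor
    2.\<close>
  have lin: "\<bar>(P - g * y) - (Q - g * z)\<bar> \<le> 2 * c * r"
    if "\<bar>P - Q\<bar> \<le> c * r" "0 \<le> g" "g \<le> c" "\<bar>y - z\<bar> \<le> r" for P Q g y z r :: real
  proof -
    have "\<bar>g * (y - z)\<bar> \<le> c * r"
      unfolding abs_mult using that by (intro mult_mono) auto
    moreover have "(P - g * y) - (Q - g * z) = (P - Q) - g * (y - z)" by (simp add: algebra_simps)
    ultimately show ?thesis using that(1) by linarith
  qed
  have "\<bar>(K1 u x - g1 x * u x) - (K1 p x - g1 x * p x)\<bar> \<le> 2 * c * a"
    by (rule lin[OF A1.K_lip[OF in_regionD(1)[OF uv] in_regionD(1)[OF pq] in_regionD(9)[OF uv] in_regionD(9)[OF pq] a] A1.g_ge A1.g_le a])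
  then have l1: "\<bar>d1 * ((K1 u x - g1 x * u x) - (K1 p x - g1 x * p x))\<bar> \<le> d1 * (2 * c * a)"
    using pos by (simp add: abs_mult)
  have "\<bar>(K2 v x - g2 x * v x) - (K2 q x - g2 x * q x)\<bar> \<le> 2 * c * b"
    by (rule lin[OF A2.K_lip[OF in_regionD(2)[OF uv] in_regionD(2)[OF pq] in_regionD(10)[OF uv] in_regionD(10)[OF pq] b] A2.g_ge A2.g_le b])
  then have l2: "\<bar>d2 * ((K2 v x - g2 x * v x) - (K2 q x - g2 x * q x))\<bar> \<le> d2 * (2 * c * b)"
    using pos by (simp add: abs_mult)
  have l3: "\<bar>f * (u x - p x)\<bar> \<le> f * a" "\<bar>(f + \<kappa>) * (v x - q x)\<bar> \<le> (f + \<kappa>) * b"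
    using pos a[of x] b[of x] by (auto simp: abs_mult)
  have "reac_u u v x - reac_u p q x = d1 * ((K1 u x - g1 x * u x) - (K1 p x - g1 x * p x))
      - (u x * (v x)\<^sup>2 - p x * (q x)\<^sup>2) - f * (u x - p x)"
    by (simp add: reac_u_def algebra_simps)
  then have "\<bar>reac_u u v x - reac_u p q x\<bar> \<le> d1 * (2 * c * a) + 2 * k\<^sup>2 * (a + b) + f * a"
    using l1 cub l3 by linarith
  also have "\<dots> \<le> L * (a + b)" using nn by (simp add: L_def algebra_simps)
  finally show "\<bar>reac_u u v x - reac_u p q x\<bar> \<le> L * (a + b)" .
  have "reac_v u v x - reac_v p q x = d2 * ((K2 v x - g2 x * v x) - (K2 q x - g2 x * q x))
      + (u x * (v x)\<^sup>2 - p x * (q x)\<^sup>2) - (f + \<kappa>) * (v x - q x)"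
    by (simp add: reac_v_def algebra_simps)
  then have "\<bar>reac_v u v x - reac_v p q x\<bar> \<le> d2 * (2 * c * b) + 2 * k\<^sup>2 * (a + b) + (f + \<kappa>) * b"
    using l2 cub l3 by linarith
  also have "\<dots> \<le> L * (a + b)" using nn by (simp add: L_def algebra_simps)
  finally show "\<bar>reac_v u v x - reac_v p q x\<bar> \<le> L * (a + b)" .
qed

text \<open>Scaled by \<Lambda>, each bound becomes an identity whose terms can be estimated
  separately: positivity of K gives the lower bounds, K z \<le> g * b the upper ones, and \<Lambda>
  makes the coefficients of u, v, m - u and k - (u + v) nonnegative. The summand k^2 of \<Lambda>
  absorbs the loss u * v^2.\<close>

lemma in_region_step:
  assumes uv: "in_region m k u v" and m: "m \<ge> 1"
    and k: "d1 * c * m + d2 * c * m + f \<le> f * k"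
    and \<Lambda>: "\<Lambda> \<ge> d1 * c + d2 * c + k\<^sup>2 + f + \<kappa>"
  shows "in_region m k (\<lambda>x. u x + (1 / \<Lambda>) * reac_u u v x) (\<lambda>x. v x + (1 / \<Lambda>) * reac_v u v x)"
proof -
  have dc: "0 \<le> d1 * c" "0 \<le> d2 * c" using pos c_nonneg by auto
  have \<Lambda>0: "\<Lambda> > 0" using \<Lambda> dc pos zero_le_power2[of k] by linarith
  have ineq: "0 \<le> \<Lambda> * u x + reac_u u v x" "\<Lambda> * u x + reac_u u v x \<le> \<Lambda> * m"
    "0 \<le> \<Lambda> * v x + reac_v u v x"
    "(\<Lambda> * u x + reac_u u v x) + (\<Lambda> * v x + reac_v u v x) \<le> \<Lambda> * k" for x
  proof -
    note b = in_regionD(3-10)[OF uv, of x]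
    have v2: "(v x)\<^sup>2 \<le> k\<^sup>2" using b by (intro power_mono)
    have dg1: "0 \<le> d1 * g1 x" "d1 * g1 x \<le> d1 * c" and dg2: "0 \<le> d2 * g2 x" "d2 * g2 x \<le> d2 * c"
      using pos A1.g_ge A1.g_le A2.g_ge A2.g_le by auto
    have K1: "0 \<le> d1 * K1 u x" "d1 * K1 u x \<le> d1 * (g1 x * m)"
      using pos A1.K_ge[OF in_regionD(1,3,4)[OF uv]] A1.K_le[OF in_regionD(1,3,4)[OF uv]] by auto
    have K2: "0 \<le> d2 * K2 v x" "d2 * K2 v x \<le> d2 * (g2 x * k)"
      using pos A2.K_ge[OF in_regionD(2,5,8)[OF uv]] A2.K_le[OF in_regionD(2,5,8)[OF uv]] by auto
    have uv2: "0 \<le> u x * (v x)\<^sup>2" using b by simp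
    have "0 \<le> u x * (\<Lambda> - d1 * g1 x - (v x)\<^sup>2 - f)"
      using b(1) \<Lambda> dg1 v2 dc pos by (intro mult_nonneg_nonneg) linarith+
    moreover have "\<Lambda> * u x + reac_u u v x = d1 * K1 u x + f + u x * (\<Lambda> - d1 * g1 x - (v x)\<^sup>2 - f)"
      by (simp add: reac_u_def algebra_simps)
    ultimately show "0 \<le> \<Lambda> * u x + reac_u u v x" using K1 pos by linarith
    \<comment> \<open>At level m the kernel gain is at most the kernel loss, and the feed f is at
      most f * m because m \<ge> 1.\<close>
    have "0 \<le> (m - u x) * (\<Lambda> - d1 * g1 x - f)"
      using b(2) \<Lambda> dg1 dc pos zero_le_power2[of k] by (intro mult_nonneg_nonneg) linarith+
    moreover have "f \<le> f * m" using pos m by simp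
    moreover have "\<Lambda> * m - (\<Lambda> * u x + reac_u u v x) =
        (m - u x) * (\<Lambda> - d1 * g1 x - f) + (d1 * (g1 x * m) - d1 * K1 u x) + u x * (v x)\<^sup>2 + (f * m - f)"
      by (simp add: reac_u_def algebra_simps)
    ultimately show "\<Lambda> * u x + reac_u u v x \<le> \<Lambda> * m" using K1 uv2 by linarith
    have "0 \<le> v x * (\<Lambda> - d2 * g2 x - (f + \<kappa>))"
      using b(3) \<Lambda> dg2 dc pos zero_le_power2[of k] by (intro mult_nonneg_nonneg) linarith+
    moreover have "\<Lambda> * v x + reac_v u v x = d2 * K2 v x + u x * (v x)\<^sup>2 + v x * (\<Lambda> - d2 * g2 x - (f + \<kappa>))"
      by (simp add: reac_v_def algebra_simps)
    ultimately show "0 \<le> \<Lambda> * v x + reac_v u v x" using K2 uv2 by linarith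
    \<comment> \<open>The cubic terms cancel in the sum. The loss d2 * g2 * v is written as d2 * g2
      * (u + v) minus d2 * g2 * u, and K2 v is compared with g2 * k. What remains, d1 * K1 u + d2 *
      g2 * u + f, is at most d1 * c * m + d2 * c * m + f, and assumption \<open>k\<close> bounds
      this by f * k.\<close>
    have "0 \<le> (k - (u x + v x)) * (\<Lambda> - d2 * g2 x - f)"
      using b(4) \<Lambda> dg2 dc pos zero_le_power2[of k] by (intro mult_nonneg_nonneg) linarith+
    moreover have "d1 * (g1 x * m) \<le> d1 * c * m"
      using dg1 m by (simp add: mult_right_mono mult.assoc[symmetric])
    moreover have "d2 * g2 x * u x \<le> d2 * c * m" by (rule mult_mono[OF dg2(2) b(2) dc(2) b(1)])
    moreover have "0 \<le> \<kappa> * v x" "0 \<le> d1 * g1 x * u x" using pos b dg1 by auto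
    moreover have "\<Lambda> * k - ((\<Lambda> * u x + reac_u u v x) + (\<Lambda> * v x + reac_v u v x)) =
        (k - (u x + v x)) * (\<Lambda> - d2 * g2 x - f) + (d2 * (g2 x * k) - d2 * K2 v x) - d2 * g2 x * u x
        - d1 * K1 u x + d1 * g1 x * u x + \<kappa> * v x + f * k - f"
      by (simp add: reac_u_def reac_v_def algebra_simps)
    ultimately show "(\<Lambda> * u x + reac_u u v x) + (\<Lambda> * v x + reac_v u v x) \<le> \<Lambda> * k"
      using K1 K2 k by linarith
  qed
  have scale: "w + (1 / \<Lambda>) * y = (\<Lambda> * w + y) / \<Lambda>" for w y using \<Lambda>0 by (simp add: field_simps)
  have "0 \<le> u x + (1 / \<Lambda>) * reac_u u v x \<and> u x + (1 / \<Lambda>) * reac_u u v x \<le> m \<and>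
      0 \<le> v x + (1 / \<Lambda>) * reac_v u v x \<and>
      u x + (1 / \<Lambda>) * reac_u u v x + (v x + (1 / \<Lambda>) * reac_v u v x) \<le> k" for x
    unfolding scale add_divide_distrib[symmetric] using ineq[of x] \<Lambda>0
    by (simp add: pos_divide_le_eq mult.commute)
  then show ?thesis
    unfolding in_region_def
    using A1.add_mem[OF in_regionD(1)[OF uv] A1.cmult_mem[OF reac_mem(1)[OF uv]]]
      A1.add_mem[OF in_regionD(2)[OF uv] A1.cmult_mem[OF reac_mem(2)[OF uv]]] by blast
qed

section \<open>The region as a closed convex subset of a Banach space, and existence\<close>

definition region :: "real \<Rightarrow> real \<Rightarrow> (('a discrete \<Rightarrow>\<^sub>C real) \<times> ('a discrete \<Rightarrow>\<^sub>C real)) set" where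
  "region m k = {z. in_region m k (ev (fst z)) (ev (snd z))}"

lemma convex_region: "convex (region m k)"
proof (rule convexI)
  fix z w :: "('a discrete \<Rightarrow>\<^sub>C real) \<times> ('a discrete \<Rightarrow>\<^sub>C real)" and a b :: real
  assume z: "z \<in> region m k" and w: "w \<in> region m k" and ab: "0 \<le> a" "0 \<le> b" "a + b = 1"
  have ev: "ev (fst (a *\<^sub>R z + b *\<^sub>R w)) = (\<lambda>x. a * ev (fst z) x + b * ev (fst w) x)"
    "ev (snd (a *\<^sub>R z + b *\<^sub>R w)) = (\<lambda>x. a * ev (snd z) x + b * ev (snd w) x)" by auto
  have iz: "in_region m k (ev (fst z)) (ev (snd z))" and iw: "in_region m k (ev (fst w)) (ev (snd w))"
    using z w by (auto simp: region_def)
  have conv: "a * y + b * y' \<le> r" if "y \<le> r" "y' \<le> r" for y y' r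
    using convex_bound_le[OF that ab] .
  show "a *\<^sub>R z + b *\<^sub>R w \<in> region m k"
    unfolding region_def in_region_def mem_Collect_eq ev
  proof (intro conjI allI)
    show "(\<lambda>x. a * ev (fst z) x + b * ev (fst w) x) \<in> M" "(\<lambda>x. a * ev (snd z) x + b * ev (snd w) x) \<in> M"
      by (intro A1.mem_intros in_regionD(1)[OF iz] in_regionD(1)[OF iw] in_regionD(2)[OF iz] in_regionD(2)[OF iw])+
    fix x
    show "0 \<le> a * ev (fst z) x + b * ev (fst w) x" "0 \<le> a * ev (snd z) x + b * ev (snd w) x"
      using ab in_regionD(3,5)[OF iz, of x] in_regionD(3,5)[OF iw, of x] by auto
    show "a * ev (fst z) x + b * ev (fst w) x \<le> m"
      by (rule conv[OF in_regionD(4)[OF iz] in_regionD(4)[OF iw]])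
    show "a * ev (fst z) x + b * ev (fst w) x + (a * ev (snd z) x + b * ev (snd w) x) \<le> k"
      using conv[OF in_regionD(6)[OF iz, of x] in_regionD(6)[OF iw, of x]] by (simp add: algebra_simps)
  qed
qed

text \<open>Norm convergence is uniform convergence of the evaluations, which preserves membership
  in \<open>M\<close>; the inequalities pass to pointwise limits.\<close>

lemma closed_region: "closed (region m k)"
  unfolding closed_sequential_limits
proof (intro allI impI)
  fix Z l assume Z: "(\<forall>n. Z n \<in> region m k) \<and> Z \<longlonglongrightarrow> l"
  have u: "uniform_limit UNIV (\<lambda>n. ev (fst (Z n))) (ev (fst l)) sequentially"
    "uniform_limit UNIV (\<lambda>n. ev (snd (Z n))) (ev (snd l)) sequentially"
    using Z by (auto intro!: tendsto_ev_uniform_limit tendsto_fst tendsto_snd)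
  have in_reg: "in_region m k (ev (fst (Z n))) (ev (snd (Z n)))" for n using Z by (simp add: region_def)
  have lim: "(\<lambda>n. ev (fst (Z n)) x) \<longlonglongrightarrow> ev (fst l) x" "(\<lambda>n. ev (snd (Z n)) x) \<longlonglongrightarrow> ev (snd l) x" for x
    using tendsto_uniform_limitI[OF u(1)] tendsto_uniform_limitI[OF u(2)] by auto
  show "l \<in> region m k"
    unfolding region_def in_region_def mem_Collect_eq
  proof (intro conjI allI)
    show "ev (fst l) \<in> M" by (rule A1.uniform_limit_mem[OF in_regionD(1)[OF in_reg] u(1)])
    show "ev (snd l) \<in> M" by (rule A1.uniform_limit_mem[OF in_regionD(2)[OF in_reg] u(2)])
    fix x
    show "0 \<le> ev (fst l) x" using LIMSEQ_le_const[OF lim(1)] in_regionD(3)[OF in_reg] by blast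
    show "ev (fst l) x \<le> m" using LIMSEQ_le_const2[OF lim(1)] in_regionD(4)[OF in_reg] by blast
    show "0 \<le> ev (snd l) x" using LIMSEQ_le_const[OF lim(2)] in_regionD(5)[OF in_reg] by blast
    show "ev (fst l) x + ev (snd l) x \<le> k"
      using LIMSEQ_le_const2[OF tendsto_add[OF lim]] in_regionD(6)[OF in_reg] by blast
  qed
qed

lemma bounded_region: "bounded (region m k)"
proof (rule boundedI)
  fix z assume "z \<in> region m k"
  then have iz: "in_region m k (ev (fst z)) (ev (snd z))" by (simp add: region_def)
  have "norm z \<le> norm (fst z) + norm (snd z)" using norm_Pair_le[of "fst z" "snd z"] by simp
  also have "\<dots> \<le> k + k"
    by (intro add_mono norm_le_ev in_regionD(9)[OF iz] in_regionD(10)[OF iz])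
  finally show "norm z \<le> k + k" .
qed

text \<open>\<open>B\<close> is fixed before the data, since m, k and \<Lambda> depend on them only
  through \<open>R\<close>. This uniformity is what continuous dependence later draws on.\<close>

lemma solves_exists:
  assumes R: "R \<ge> 0"
  obtains B where "\<And>u0 v0. u0 \<in> Xplus M N \<Longrightarrow> v0 \<in> Xplus M N \<Longrightarrow> N u0 \<le> R \<Longrightarrow> N v0 \<le> R \<Longrightarrow>
    \<exists>u v. solves u0 v0 u v \<and> (\<forall>t\<ge>0. N (u t) + N (v t) \<le> B)"
proof -
  \<comment> \<open>The source f * (1 - u) can raise u towards 1 whatever the data are, hence the
    1.\<close>
  define m where "m = max 1 R"
  \<comment> \<open>2 * R leaves room for the sum of the initial values, and the fraction meets the
    condition on k in \<open>in_region_step\<close>.\<close>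
  define k where "k = 2 * R + (d1 * c * m + d2 * c * m + f) / f"
  define \<Lambda> where "\<Lambda> = d1 * c + d2 * c + k\<^sup>2 + f + \<kappa>"
  define L where "L = 2 * d1 * c + 2 * d2 * c + 2 * k\<^sup>2 + f + \<kappa>"
  have m: "m \<ge> 1" "R \<le> m" by (auto simp: m_def)
  have dc: "0 \<le> d1 * c" "0 \<le> d2 * c" using pos c_nonneg by auto
  have k: "d1 * c * m + d2 * c * m + f \<le> f * k" "2 * R \<le> k"
  proof -
    have "f * k = 2 * f * R + (d1 * c * m + d2 * c * m + f)" using pos by (simp add: k_def field_simps)
    then show "d1 * c * m + d2 * c * m + f \<le> f * k" using pos R by simp
    have "0 \<le> d1 * c * m + d2 * c * m + f" using dc m pos by simp
    then show "2 * R \<le> k" using pos by (simp add: k_def)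
  qed
  have \<Lambda>: "\<Lambda> > 0" using dc pos by (simp add: \<Lambda>_def add_nonneg_pos add_pos_pos)
  have L: "L \<ge> 0" using dc pos by (simp add: L_def)
  define hu where "hu = (\<lambda>z x. ev (fst z) x + (1 / \<Lambda>) * reac_u (ev (fst z)) (ev (snd z)) x)"
  define hv where "hv = (\<lambda>z x. ev (snd z) x + (1 / \<Lambda>) * reac_v (ev (fst z)) (ev (snd z)) x)"
  \<comment> \<open>H z is z + F z / \<Lambda> with F given by \<open>reac_u\<close> and
    \<open>reac_v\<close>, so \<Lambda> * (H z - z) is F z. On the region its values are bounded, so
    \<open>emb\<close> loses nothing.\<close>
  define H where "H = (\<lambda>z. (emb (hu z), emb (hv z)))"
  have h_reg: "in_region m k (hu z) (hv z)" if "z \<in> region m k" for z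
    using that in_region_step[OF _ m(1) k(1), of "ev (fst z)" "ev (snd z)" \<Lambda>]
    by (simp add: hu_def hv_def region_def \<Lambda>_def)
  have ev_H: "ev (fst (H z)) = hu z" "ev (snd (H z)) = hv z" if "z \<in> region m k" for z
    unfolding H_def fst_conv snd_conv
    by (rule ev_emb[OF in_regionD(9)[OF h_reg[OF that]]], rule ev_emb[OF in_regionD(10)[OF h_reg[OF that]]])
  have reac_lip: "\<bar>reac_u (ev (fst z)) (ev (snd z)) x - reac_u (ev (fst w)) (ev (snd w)) x\<bar> \<le> 2 * L * dist z w"
    "\<bar>reac_v (ev (fst z)) (ev (snd z)) x - reac_v (ev (fst w)) (ev (snd w)) x\<bar> \<le> 2 * L * dist z w"
    if "z \<in> region m k" "w \<in> region m k" for z w x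
  proof -
    have zw: "in_region m k (ev (fst z)) (ev (snd z))" "in_region m k (ev (fst w)) (ev (snd w))"
      using that by (auto simp: region_def)
    have "L * (dist (fst z) (fst w) + dist (snd z) (snd w)) \<le> L * (dist z w + dist z w)"
      by (intro mult_left_mono add_mono dist_fst_le dist_snd_le L)
    then have le: "L * (dist (fst z) (fst w) + dist (snd z) (snd w)) \<le> 2 * L * dist z w"
      by (simp add: algebra_simps)
    note lip = reac_lipschitz[OF zw abs_ev_diff_le_dist abs_ev_diff_le_dist, of x, folded L_def]
    show "\<bar>reac_u (ev (fst z)) (ev (snd z)) x - reac_u (ev (fst w)) (ev (snd w)) x\<bar> \<le> 2 * L * dist z w"
      "\<bar>reac_v (ev (fst z)) (ev (snd z)) x - reac_v (ev (fst w)) (ev (snd w)) x\<bar> \<le> 2 * L * dist z w"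
      using order_trans[OF lip(1) le] order_trans[OF lip(2) le] .
  qed
  have H_lip: "(2 * (1 + 2 * L / \<Lambda>))-lipschitz_on (region m k) H"
  proof (rule lipschitz_onI)
    show "0 \<le> 2 * (1 + 2 * L / \<Lambda>)" using L \<Lambda> by simp
    fix z w assume zw: "z \<in> region m k" "w \<in> region m k"
    have step: "\<bar>(y + (1 / \<Lambda>) * r) - (y' + (1 / \<Lambda>) * r')\<bar> \<le> (1 + 2 * L / \<Lambda>) * dist z w"
      if "\<bar>y - y'\<bar> \<le> dist z w" "\<bar>r - r'\<bar> \<le> 2 * L * dist z w" for y y' r r' :: real
    proof -
      have "\<bar>(1 / \<Lambda>) * (r - r')\<bar> \<le> (1 / \<Lambda>) * (2 * L * dist z w)"
        unfolding abs_mult using that \<Lambda> by (intro mult_mono) auto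
      moreover have "(y + (1 / \<Lambda>) * r) - (y' + (1 / \<Lambda>) * r') = (y - y') + (1 / \<Lambda>) * (r - r')"
        by (simp add: algebra_simps diff_divide_distrib)
      moreover have "(1 + 2 * L / \<Lambda>) * dist z w = dist z w + (1 / \<Lambda>) * (2 * L * dist z w)"
        by (simp add: algebra_simps)
      ultimately show ?thesis using that(1) by linarith
    qed
    have "dist (fst (H z)) (fst (H w)) \<le> (1 + 2 * L / \<Lambda>) * dist z w"
      by (rule dist_le_ev, unfold ev_H[OF zw(1)] ev_H[OF zw(2)] hu_def)
        (intro step reac_lip zw order_trans[OF abs_ev_diff_le_dist dist_fst_le])
    moreover have "dist (snd (H z)) (snd (H w)) \<le> (1 + 2 * L / \<Lambda>) * dist z w"
      by (rule dist_le_ev, unfold ev_H[OF zw(1)] ev_H[OF zw(2)] hv_def)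
        (intro step reac_lip zw order_trans[OF abs_ev_diff_le_dist dist_snd_le])
    moreover have "dist (H z) (H w) \<le> dist (fst (H z)) (fst (H w)) + dist (snd (H z)) (snd (H w))"
      using norm_Pair_le[of "fst (H z) - fst (H w)" "snd (H z) - snd (H w)"]
      by (simp add: dist_norm minus_prod_def)
    ultimately show "dist (H z) (H w) \<le> 2 * (1 + 2 * L / \<Lambda>) * dist z w" by linarith
  qed
  have H_reg: "H z \<in> region m k" if "z \<in> region m k" for z
    using h_reg[OF that] by (simp add: region_def ev_H[OF that])
  show thesis
  proof (rule that[of "2 * k"])
    fix u0 v0 assume init: "u0 \<in> Xplus M N" "v0 \<in> Xplus M N" "N u0 \<le> R" "N v0 \<le> R"
    \<comment> \<open>The solution starts at representatives that obey the bounds at every point;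
      they agree with \<open>u0\<close> and \<open>v0\<close> in the phase space.\<close>
    obtain a where a: "a \<in> M" "\<And>x. 0 \<le> a x" "\<And>x. a x \<le> N u0" "N (\<lambda>x. u0 x - a x) = 0"
      using A1.Xplus_bounded_rep[OF init(1)] by blast
    obtain b where b: "b \<in> M" "\<And>x. 0 \<le> b x" "\<And>x. b x \<le> N v0" "N (\<lambda>x. v0 x - b x) = 0"
      using A1.Xplus_bounded_rep[OF init(2)] by blast
    have aR: "a x \<le> R" and bR: "b x \<le> R" for x
      using order_trans[OF a(3) init(3)] order_trans[OF b(3) init(4)] by auto
    have ab_reg: "in_region m k a b"
      unfolding in_region_def
    proof (intro conjI allI a(1) b(1) a(2) b(2))
      fix x show "a x \<le> m" using aR[of x] m by linarith
      show "a x + b x \<le> k" using aR[of x] bR[of x] k(2) by linarith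
    qed
    have ev_ab: "ev (emb a) = a" "ev (emb b) = b"
      using ev_emb[OF in_regionD(9)[OF ab_reg]] ev_emb[OF in_regionD(10)[OF ab_reg]] .
    have z0: "(emb a, emb b) \<in> region m k" using ab_reg by (simp add: region_def ev_ab)
    obtain z where z: "z 0 = (emb a, emb b)" "\<And>t. t \<ge> 0 \<Longrightarrow> z t \<in> region m k"
      "\<And>t. t \<ge> 0 \<Longrightarrow> (z has_vector_derivative \<Lambda> *\<^sub>R (H (z t) - z t)) (at t within {0..})"
      using ode_closed_convex[OF closed_region convex_region bounded_region H_reg H_lip \<Lambda> z0] by blast
    define u where "u = (\<lambda>t. ev (fst (z t)))"
    define v where "v = (\<lambda>t. ev (snd (z t)))"
    have reg: "in_region m k (u t) (v t)" if "t \<ge> 0" for t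
      using z(2)[OF that] by (simp add: u_def v_def region_def)
    have slope: "ev (fst (\<Lambda> *\<^sub>R (H (z t) - z t))) x = reac_u (u t) (v t) x"
      "ev (snd (\<Lambda> *\<^sub>R (H (z t) - z t))) x = reac_v (u t) (v t) x" if "t \<ge> 0" for t x
      using \<Lambda> by (simp_all add: ev_H[OF z(2)[OF that]] hu_def hv_def u_def v_def)
    have deriv: "\<exists>\<delta>>0. \<forall>s\<ge>0. \<bar>s - t\<bar> < \<delta> \<longrightarrow>
        norm (z s - z t - (s - t) *\<^sub>R (\<Lambda> *\<^sub>R (H (z t) - z t))) \<le> \<epsilon> * \<bar>s - t\<bar>"
      if "t \<ge> 0" "\<epsilon> > 0" for t \<epsilon>
      using z(3)[OF that(1)] that(2) unfolding has_vector_derivative_def has_derivative_within_alt by fastforce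
    have norm_comp: "norm (fst y) \<le> norm y" "norm (snd y) \<le> norm y"
      for y :: "('a discrete \<Rightarrow>\<^sub>C real) \<times> ('a discrete \<Rightarrow>\<^sub>C real)"
      by (cases y; simp add: norm_fst_le norm_snd_le)+
    have zc: "continuous_on {0..} z"
      unfolding continuous_on_eq_continuous_within
      using z(3) has_vector_derivative_continuous by (metis atLeast_iff)
    \<comment> \<open>Transfer from the Banach space to \<open>N\<close>, which the supremum
      dominates: the remainder of the single curve z controls either component.\<close>
    have X_derivI: "X_deriv M N w w'"
      if mem: "\<And>t. t \<ge> 0 \<Longrightarrow> w t \<in> M" "\<And>t. t \<ge> 0 \<Longrightarrow> w' t \<in> M"
        and le: "\<And>s t x. s \<ge> 0 \<Longrightarrow> t \<ge> 0 \<Longrightarrow> \<bar>w s x - w t x - (s - t) * w' t x\<bar> \<le>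
            norm (z s - z t - (s - t) *\<^sub>R (\<Lambda> *\<^sub>R (H (z t) - z t)))" for w w'
      unfolding X_deriv_def
    proof (intro allI impI conjI)
      fix t :: real assume t: "t \<ge> 0"
      show "w' t \<in> M" by (rule mem(2)[OF t])
      fix \<epsilon> :: real assume "\<epsilon> > 0"
      then obtain \<delta> where \<delta>: "\<delta> > 0" "\<And>s. s \<ge> 0 \<Longrightarrow> \<bar>s - t\<bar> < \<delta> \<Longrightarrow>
          norm (z s - z t - (s - t) *\<^sub>R (\<Lambda> *\<^sub>R (H (z t) - z t))) \<le> \<epsilon> * \<bar>s - t\<bar>"
        using deriv[OF t] by blast
      show "\<exists>\<delta>>0. \<forall>s\<ge>0. \<bar>s - t\<bar> < \<delta> \<longrightarrow> N (\<lambda>x. w s x - w t x - (s - t) * w' t x) \<le> \<epsilon> * \<bar>s - t\<bar>"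
      proof (intro exI[of _ \<delta>] conjI allI impI \<delta>(1) A1.N_le)
        fix s x assume s: "(0::real) \<le> s" "\<bar>s - t\<bar> < \<delta>"
        show "(\<lambda>x. w s x - w t x - (s - t) * w' t x) \<in> M"
          by (intro A1.mem_intros mem s t)
        show "\<bar>w s x - w t x - (s - t) * w' t x\<bar> \<le> \<epsilon> * \<bar>s - t\<bar>"
          using order_trans[OF le[OF s(1) t] \<delta>(2)[OF s]] .
      qed
    qed
    have X_contI: "X_cont M N w"
      if mem: "\<And>t. t \<ge> 0 \<Longrightarrow> w t \<in> M"
        and le: "\<And>s t x. s \<ge> 0 \<Longrightarrow> t \<ge> 0 \<Longrightarrow> \<bar>w s x - w t x\<bar> \<le> 2 * L * dist (z s) (z t)" for w
      unfolding X_cont_def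
    proof (intro allI impI conjI)
      fix t :: real assume t: "t \<ge> 0"
      show "w t \<in> M" by (rule mem[OF t])
      fix \<epsilon> :: real assume \<epsilon>: "\<epsilon> > 0"
      \<comment> \<open>The summand 1 makes the denominator positive from L \<ge> 0 alone.\<close>
      then have "\<epsilon> / (2 * L + 1) > 0" using L by simp
      then obtain \<delta> where \<delta>: "\<delta> > 0" "\<And>s. s \<in> {0..} \<Longrightarrow> dist s t < \<delta> \<Longrightarrow> dist (z s) (z t) < \<epsilon> / (2 * L + 1)"
        using zc t unfolding continuous_on_iff by (meson atLeast_iff)
      show "\<exists>\<delta>>0. \<forall>s\<ge>0. \<bar>s - t\<bar> < \<delta> \<longrightarrow> N (\<lambda>x. w s x - w t x) \<le> \<epsilon>"
      proof (intro exI[of _ \<delta>] conjI allI impI \<delta>(1) A1.N_le)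
        fix s x assume s: "(0::real) \<le> s" "\<bar>s - t\<bar> < \<delta>"
        show "(\<lambda>x. w s x - w t x) \<in> M" by (intro A1.diff_mem mem s t)
        have "dist (z s) (z t) \<le> \<epsilon> / (2 * L + 1)" using \<delta>(2)[of s] s by (simp add: dist_real_def)
        then have "(2 * L + 1) * dist (z s) (z t) \<le> \<epsilon>" using L by (simp add: field_simps)
        then have "2 * L * dist (z s) (z t) \<le> \<epsilon>"
          using zero_le_dist[of "z s" "z t"] unfolding distrib_right by linarith
        then show "\<bar>w s x - w t x\<bar> \<le> \<epsilon>" using le[OF s(1) t, of x] by linarith
      qed
    qed
    have plus: "u t \<in> Xplus M N" "v t \<in> Xplus M N" if "t \<ge> 0" for t
      using A1.XplusI[OF in_regionD(1,3)[OF reg[OF that]]] A1.XplusI[OF in_regionD(2,5)[OF reg[OF that]]] .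
    have du: "X_deriv M N u (\<lambda>t. reac_u (u t) (v t))"
    proof (rule X_derivI)
      fix s t :: real and x assume "s \<ge> 0" and t: "t \<ge> 0"
      have "u s x - u t x - (s - t) * reac_u (u t) (v t) x =
          ev (fst (z s - z t - (s - t) *\<^sub>R (\<Lambda> *\<^sub>R (H (z t) - z t)))) x"
        using slope(1)[OF t, of x] by (simp add: u_def)
      then show "\<bar>u s x - u t x - (s - t) * reac_u (u t) (v t) x\<bar> \<le>
          norm (z s - z t - (s - t) *\<^sub>R (\<Lambda> *\<^sub>R (H (z t) - z t)))"
        by (simp only: order_trans[OF abs_ev_le_norm norm_comp(1)])
    qed (use reg in \<open>blast intro: in_regionD(1) reac_mem(1)\<close>)+
    have dv: "X_deriv M N v (\<lambda>t. reac_v (u t) (v t))"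
    proof (rule X_derivI)
      fix s t :: real and x assume "s \<ge> 0" and t: "t \<ge> 0"
      have "v s x - v t x - (s - t) * reac_v (u t) (v t) x =
          ev (snd (z s - z t - (s - t) *\<^sub>R (\<Lambda> *\<^sub>R (H (z t) - z t)))) x"
        using slope(2)[OF t, of x] by (simp add: v_def)
      then show "\<bar>v s x - v t x - (s - t) * reac_v (u t) (v t) x\<bar> \<le>
          norm (z s - z t - (s - t) *\<^sub>R (\<Lambda> *\<^sub>R (H (z t) - z t)))"
        by (simp only: order_trans[OF abs_ev_le_norm norm_comp(2)])
    qed (use reg in \<open>blast intro: in_regionD(2) reac_mem(2)\<close>)+
    have cont: "X_cont M N (\<lambda>t. reac_u (u t) (v t))" "X_cont M N (\<lambda>t. reac_v (u t) (v t))"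
      using reac_lip[OF z(2) z(2)]
      by (intro X_contI reac_mem[OF reg]; simp add: u_def v_def)+
    have eqs: "Xeq M N (reac_u (u t) (v t)) (rhs_u (u t) (v t))" "Xeq M N (reac_v (u t) (v t)) (rhs_v (u t) (v t))"
      if "t > 0" for t
      using reac_Xeq_rhs[OF reg[of t]] that by simp_all
    have ini: "Xeq M N (u 0) u0" "Xeq M N (v 0) v0"
      using a(1,4) b(1,4) init(1,2) A1.N_diff_commute[of a u0] A1.N_diff_commute[of b v0]
      by (simp_all add: u_def v_def z(1) ev_ab A1.Xeq_iff A1.Xplus_mem)
    have "solves u0 v0 u v"
      unfolding GS_sol_def rhs_u_def[symmetric] rhs_v_def[symmetric]
    proof (rule conjI[OF _ conjI[OF _ conjI[OF ini]]])
      show "\<forall>t\<ge>0. u t \<in> Xplus M N \<and> v t \<in> Xplus M N" using plus by simp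
      show "\<exists>u' v'. X_deriv M N u u' \<and> X_deriv M N v v' \<and> X_cont M N u' \<and> X_cont M N v' \<and>
          (\<forall>t>0. Xeq M N (u' t) (rhs_u (u t) (v t)) \<and> Xeq M N (v' t) (rhs_v (u t) (v t)))"
        by (rule exI[of _ "\<lambda>t. reac_u (u t) (v t)"], rule exI[of _ "\<lambda>t. reac_v (u t) (v t)"])
          (simp add: du dv cont eqs)
    qed
    moreover have "N (u t) + N (v t) \<le> 2 * k" if "t \<ge> 0" for t
      using A1.N_le[OF in_regionD(1,9)[OF reg[OF that]]] A1.N_le[OF in_regionD(2,10)[OF reg[OF that]]] by linarith
    ultimately show "\<exists>u v. solves u0 v0 u v \<and> (\<forall>t\<ge>0. N (u t) + N (v t) \<le> 2 * k)" by blast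
  qed
qed

section \<open>The semiflow\<close>

definition flow :: "real \<Rightarrow> ('a \<Rightarrow> real) \<times> ('a \<Rightarrow> real) \<Rightarrow> ('a \<Rightarrow> real) \<times> ('a \<Rightarrow> real)" where
  "flow t z = (let w = (SOME w. solves (fst z) (snd z) (fst w) (snd w)) in (fst w t, snd w t))"

text \<open>The choice in \<open>flow\<close> depends on the data and not on the time, so one and
  the same solution is followed for all t. Different representatives of the same data may receive
  different choices; uniqueness reconciles them up to null functions.\<close>

lemma flow_solves:
  assumes "u0 \<in> Xplus M N" "v0 \<in> Xplus M N"
  shows "solves u0 v0 (\<lambda>t. fst (flow t (u0, v0))) (\<lambda>t. snd (flow t (u0, v0)))"
proof -
  have "0 \<le> N u0" using A1.N_nonneg[OF A1.Xplus_mem[OF assms(1)]] .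
  then have "max (N u0) (N v0) \<ge> 0" by simp
  then obtain u v where "solves u0 v0 u v"
    using solves_exists[of "max (N u0) (N v0)"] assms by (metis max.cobounded1 max.cobounded2)
  then have "\<exists>w. solves u0 v0 (fst w) (snd w)" by (intro exI[of _ "(u, v)"]) simp
  from someI_ex[OF this] show ?thesis by (simp add: flow_def Let_def)
qed

text \<open>The bound of \<open>solves_exists\<close> belongs to some solution. Uniqueness moves it
  to the chosen one, since null differences leave \<open>N\<close> unchanged.\<close>

lemma flow_bounded:
  assumes R: "R \<ge> 0"
  obtains B where "\<And>u0 v0 t. u0 \<in> Xplus M N \<Longrightarrow> v0 \<in> Xplus M N \<Longrightarrow> N u0 \<le> R \<Longrightarrow> N v0 \<le> R \<Longrightarrow> t \<ge> 0 \<Longrightarrow>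
    N (fst (flow t (u0, v0))) \<le> B \<and> N (snd (flow t (u0, v0))) \<le> B"
proof -
  obtain B where B: "\<And>u0 v0. u0 \<in> Xplus M N \<Longrightarrow> v0 \<in> Xplus M N \<Longrightarrow> N u0 \<le> R \<Longrightarrow> N v0 \<le> R \<Longrightarrow>
    \<exists>u v. solves u0 v0 u v \<and> (\<forall>t\<ge>0. N (u t) + N (v t) \<le> B)"
    using solves_exists[OF R] by blast
  show thesis
  proof (rule that[of B])
    fix u0 v0 and t :: real
    assume i: "u0 \<in> Xplus M N" "v0 \<in> Xplus M N" "N u0 \<le> R" "N v0 \<le> R" and t: "t \<ge> 0"
    obtain u v where uv: "solves u0 v0 u v" "\<forall>t\<ge>0. N (u t) + N (v t) \<le> B" using B[OF i] by blast
    let ?p = "fst (flow t (u0, v0))" and ?q = "snd (flow t (u0, v0))"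
    have mem: "?p \<in> M" "?q \<in> M" "u t \<in> M" "v t \<in> M"
      using solves_mem(3,4)[OF flow_solves[OF i(1,2)] t] solves_mem(3,4)[OF uv(1) t] by auto
    have "Xeq M N ?p (u t) \<and> Xeq M N ?q (v t)"
      by (rule solves_unique[OF A1.Xplus_mem[OF i(1)] A1.Xplus_mem[OF i(2)] flow_solves[OF i(1,2)] uv(1) t])
    then have "N (\<lambda>x. ?p x - u t x) = 0" "N (\<lambda>x. ?q x - v t x) = 0" by (auto simp: Xeq_def)
    then have "N ?p \<le> N (u t)" "N ?q \<le> N (v t)"
      using A1.N_le_N_diff[OF mem(1,3)] A1.N_le_N_diff[OF mem(2,4)] by auto
    moreover have "N (u t) + N (v t) \<le> B" using uv(2) t by simp
    ultimately show "N ?p \<le> B \<and> N ?q \<le> B"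
      using A1.N_nonneg[OF mem(3)] A1.N_nonneg[OF mem(4)] by linarith
  qed
qed

text \<open>The translated solution and the one chosen for the state at time s solve the same
  initial value problem.\<close>

lemma flow_semigroup:
  assumes i: "u0 \<in> Xplus M N" "v0 \<in> Xplus M N" and "s \<ge> 0" "t \<ge> 0"
  shows "Xeq M N (fst (flow (t + s) (u0, v0))) (fst (flow t (flow s (u0, v0)))) \<and>
    Xeq M N (snd (flow (t + s) (u0, v0))) (snd (flow t (flow s (u0, v0))))"
proof -
  note sol = flow_solves[OF i]
  note ms = solves_mem[OF sol \<open>s \<ge> 0\<close>]
  show ?thesis
    using solves_unique[OF ms(3,4) solves_shift[OF sol \<open>s \<ge> 0\<close>] flow_solves[OF ms(1,2)] \<open>t \<ge> 0\<close>] by simp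
qed

text \<open>The difference is split at the unperturbed solution at time t: the change of data costs
  less than \<epsilon> / 2 by \<open>solves_stability\<close>, the change of time at most \<epsilon>
  / 4 by continuity of that solution.\<close>

lemma flow_continuous:
  assumes t0: "t0 \<ge> 0" and i0: "u0 \<in> Xplus M N" "v0 \<in> Xplus M N" and \<epsilon>: "\<epsilon> > 0"
  shows "\<exists>\<delta>>0. \<forall>t\<ge>0. \<forall>u1\<in>Xplus M N. \<forall>v1\<in>Xplus M N.
    \<bar>t - t0\<bar> < \<delta> \<and> N (\<lambda>x. u1 x - u0 x) < \<delta> \<and> N (\<lambda>x. v1 x - v0 x) < \<delta> \<longrightarrow>
      N (\<lambda>x. fst (flow t (u1, v1)) x - fst (flow t0 (u0, v0)) x) < \<epsilon> \<and>
      N (\<lambda>x. snd (flow t (u1, v1)) x - snd (flow t0 (u0, v0)) x) < \<epsilon>"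
proof -
  note m0 = A1.Xplus_mem[OF i0(1)] A1.Xplus_mem[OF i0(2)]
  \<comment> \<open>The extra 1 admits all data within distance \<delta> \<le> 1, so that a single
    B, and with it a single L, covers both solutions.\<close>
  define R where "R = max (N u0) (N v0) + 1"
  have "N u0 \<ge> 0" using A1.N_nonneg[OF m0(1)] .
  then have R: "R \<ge> 0" "N u0 + 1 \<le> R" "N v0 + 1 \<le> R" by (auto simp: R_def)
  obtain B where B: "\<And>u0 v0 t. u0 \<in> Xplus M N \<Longrightarrow> v0 \<in> Xplus M N \<Longrightarrow> N u0 \<le> R \<Longrightarrow> N v0 \<le> R \<Longrightarrow> t \<ge> 0 \<Longrightarrow>
    N (fst (flow t (u0, v0))) \<le> B \<and> N (snd (flow t (u0, v0))) \<le> B"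
    using flow_bounded[OF R(1)] by blast
  define L where "L = 2 * (2 * d1 * c + 2 * d2 * c + 2 * B\<^sup>2 + f + \<kappa>)"
  have L: "L \<ge> 0" using pos c_nonneg by (simp add: L_def)
  \<comment> \<open>Dominates the Gronwall factor for all t \<le> t0 + 1.\<close>
  define C where "C = exp (L * (t0 + 1))"
  have C: "C > 0" by (simp add: C_def)
  let ?u = "\<lambda>t. fst (flow t (u0, v0))" and ?v = "\<lambda>t. snd (flow t (u0, v0))"
  note sol0 = flow_solves[OF i0]
  have e4: "\<epsilon> / 4 > 0" using \<epsilon> by simp
  obtain \<delta>1 where \<delta>1: "\<delta>1 > 0" "\<And>s. s \<ge> 0 \<Longrightarrow> \<bar>s - t0\<bar> < \<delta>1 \<Longrightarrow> N (\<lambda>x. ?u s x - ?u t0 x) \<le> \<epsilon> / 4"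
    using solves_X_cont(1)[OF sol0, unfolded X_cont_def, rule_format, OF t0] e4 by blast
  obtain \<delta>2 where \<delta>2: "\<delta>2 > 0" "\<And>s. s \<ge> 0 \<Longrightarrow> \<bar>s - t0\<bar> < \<delta>2 \<Longrightarrow> N (\<lambda>x. ?v s x - ?v t0 x) \<le> \<epsilon> / 4"
    using solves_X_cont(2)[OF sol0, unfolded X_cont_def, rule_format, OF t0] e4 by blast
  \<comment> \<open>Two data differences below \<delta>, multiplied by C, add up to at most
    \<epsilon> / 2; this is the origin of \<epsilon> / (4 * C).\<close>
  define \<delta> where "\<delta> = Min {1, \<delta>1, \<delta>2, \<epsilon> / (4 * C)}"
  have \<delta>: "\<delta> > 0" "\<delta> \<le> 1" "\<delta> \<le> \<delta>1" "\<delta> \<le> \<delta>2" "\<delta> \<le> \<epsilon> / (4 * C)"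
    using \<delta>1(1) \<delta>2(1) \<epsilon> C by (auto simp: \<delta>_def)
  show ?thesis
  proof (rule exI[of _ \<delta>], rule conjI[OF \<delta>(1)], intro allI ballI impI)
    fix t :: real and u1 v1
    assume t0': "t \<ge> 0" and i1: "u1 \<in> Xplus M N" "v1 \<in> Xplus M N"
      and close: "\<bar>t - t0\<bar> < \<delta> \<and> N (\<lambda>x. u1 x - u0 x) < \<delta> \<and> N (\<lambda>x. v1 x - v0 x) < \<delta>"
    have t: "t \<ge> 0" "\<bar>t - t0\<bar> < \<delta>"
      and d: "N (\<lambda>x. u1 x - u0 x) < \<delta>" "N (\<lambda>x. v1 x - v0 x) < \<delta>"
      using t0' close by auto
    note m1 = A1.Xplus_mem[OF i1(1)] A1.Xplus_mem[OF i1(2)]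
    have n1: "N u1 \<le> R" "N v1 \<le> R"
      using A1.N_le_N_diff[OF m1(1) m0(1)] A1.N_le_N_diff[OF m1(2) m0(2)] d \<delta>(2) R by linarith+
    have n0: "N u0 \<le> R" "N v0 \<le> R" using R by auto
    let ?p = "\<lambda>t. fst (flow t (u1, v1))" and ?q = "\<lambda>t. snd (flow t (u1, v1))"
    note sol1 = flow_solves[OF i1]
    have bd: "N (?q s) \<le> B \<and> N (?u s) \<le> B \<and> N (?v s) \<le> B" if "0 \<le> s" "s \<le> t" for s
      using B[OF i1 n1 that(1)] B[OF i0 n0 that(1)] by simp
    have nn: "0 \<le> N (\<lambda>x. u1 x - u0 x) + N (\<lambda>x. v1 x - v0 x)"
      using A1.N_nonneg[OF A1.diff_mem[OF m1(1) m0(1)]] A1.N_nonneg[OF A1.diff_mem[OF m1(2) m0(2)]] by simp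
    have "L * t \<le> L * (t0 + 1)" using t \<delta>(2) by (intro mult_left_mono L) linarith
    then have eC: "exp (L * t) \<le> C" by (simp add: C_def)
    have "N (\<lambda>x. ?p t x - ?u t x) + N (\<lambda>x. ?q t x - ?v t x)
        \<le> (N (\<lambda>x. u1 x - u0 x) + N (\<lambda>x. v1 x - v0 x)) * exp (L * t)"
      using solves_stability[OF sol1 sol0 bd t(1) order_refl] unfolding L_def .
    also have "\<dots> \<le> (N (\<lambda>x. u1 x - u0 x) + N (\<lambda>x. v1 x - v0 x)) * C"
      by (rule mult_left_mono[OF eC nn])
    also have "\<dots> < 2 * \<delta> * C"
      using d C by (intro mult_strict_right_mono) auto
    also have "\<dots> \<le> \<epsilon> / 2"
      using \<delta>(5) C by (simp add: field_simps)
    finally have le: "N (\<lambda>x. ?p t x - ?u t x) + N (\<lambda>x. ?q t x - ?v t x) < \<epsilon> / 2" .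
    note mt = solves_mem(3,4)[OF sol1 t(1)] solves_mem(3,4)[OF sol0 t(1)] solves_mem(3,4)[OF sol0 t0]
    have "0 \<le> N (\<lambda>x. ?p t x - ?u t x)" "0 \<le> N (\<lambda>x. ?q t x - ?v t x)"
      using A1.N_nonneg[OF A1.diff_mem[OF mt(1,3)]] A1.N_nonneg[OF A1.diff_mem[OF mt(2,4)]] .
    moreover have "N (\<lambda>x. ?u t x - ?u t0 x) \<le> \<epsilon> / 4" "N (\<lambda>x. ?v t x - ?v t0 x) \<le> \<epsilon> / 4"
      using \<delta>1(2)[OF t(1)] \<delta>2(2)[OF t(1)] t(2) \<delta>(3,4) by auto
    ultimately show "N (\<lambda>x. ?p t x - ?u t0 x) < \<epsilon> \<and> N (\<lambda>x. ?q t x - ?v t0 x) < \<epsilon>"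
      using A1.N_diff_triangle[OF mt(1,3,5)] A1.N_diff_triangle[OF mt(2,4,6)] le \<epsilon> by linarith
  qed
qed

theorem wellposed: "GS_wellposed M N \<Omega> \<gamma>1 \<gamma>2 d1 d2 f \<kappa>"
  unfolding GS_wellposed_def
proof (intro conjI ballI)
  fix u0 v0 assume i: "u0 \<in> Xplus M N" "v0 \<in> Xplus M N"
  have "0 \<le> N u0" using A1.N_nonneg[OF A1.Xplus_mem[OF i(1)]] .
  then have "max (N u0) (N v0) \<ge> 0" by simp
  then obtain B where B: "\<And>t. t \<ge> 0 \<Longrightarrow> N (fst (flow t (u0, v0))) \<le> B \<and> N (snd (flow t (u0, v0))) \<le> B"
    using flow_bounded[of "max (N u0) (N v0)"] i by (metis max.cobounded1 max.cobounded2)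
  have "\<exists>B. \<forall>t\<ge>0. N (fst (flow t (u0, v0))) + N (snd (flow t (u0, v0))) \<le> B"
    using B by (intro exI[of _ "2 * B"]) fastforce
  moreover have "\<forall>t\<ge>0. Xeq M N (p t) (fst (flow t (u0, v0))) \<and> Xeq M N (q t) (snd (flow t (u0, v0)))"
    if "solves u0 v0 p q" for p q
    using solves_unique[OF A1.Xplus_mem[OF i(1)] A1.Xplus_mem[OF i(2)] that flow_solves[OF i]] by simp
  ultimately show "\<exists>u v. solves u0 v0 u v \<and> (\<exists>B. \<forall>t\<ge>0. N (u t) + N (v t) \<le> B) \<and>
      (\<forall>u2 v2. solves u0 v0 u2 v2 \<longrightarrow> (\<forall>t\<ge>0. Xeq M N (u2 t) (u t) \<and> Xeq M N (v2 t) (v t)))"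
    using flow_solves[OF i]
    by (intro exI[of _ "\<lambda>t. fst (flow t (u0, v0))"] exI[of _ "\<lambda>t. snd (flow t (u0, v0))"]) simp
next
  show "\<exists>\<Phi>. (\<forall>u0\<in>Xplus M N. \<forall>v0\<in>Xplus M N. solves u0 v0 (\<lambda>t. fst (\<Phi> t (u0, v0))) (\<lambda>t. snd (\<Phi> t (u0, v0)))) \<and>
      (\<forall>u0\<in>Xplus M N. \<forall>v0\<in>Xplus M N. \<forall>s\<ge>0. \<forall>t\<ge>0.
         Xeq M N (fst (\<Phi> (t + s) (u0, v0))) (fst (\<Phi> t (\<Phi> s (u0, v0)))) \<and>
         Xeq M N (snd (\<Phi> (t + s) (u0, v0))) (snd (\<Phi> t (\<Phi> s (u0, v0))))) \<and>
      (\<forall>t0\<ge>0. \<forall>u0\<in>Xplus M N. \<forall>v0\<in>Xplus M N. \<forall>\<epsilon>>0. \<exists>\<delta>>0.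
         \<forall>t\<ge>0. \<forall>u1\<in>Xplus M N. \<forall>v1\<in>Xplus M N.
           \<bar>t - t0\<bar> < \<delta> \<and> N (\<lambda>x. u1 x - u0 x) < \<delta> \<and> N (\<lambda>x. v1 x - v0 x) < \<delta> \<longrightarrow>
             N (\<lambda>x. fst (\<Phi> t (u1, v1)) x - fst (\<Phi> t0 (u0, v0)) x) < \<epsilon> \<and>
             N (\<lambda>x. snd (\<Phi> t (u1, v1)) x - snd (\<Phi> t0 (u0, v0)) x) < \<epsilon>)"
    using flow_solves flow_semigroup flow_continuous by (intro exI[of _ flow] conjI ballI allI impI) blast+
qed

end

section \<open>Integral kernels\<close>

lemma integrable_mult_AE_bounded:
  fixes h z :: "'a \<Rightarrow> real"
  assumes h: "integrable \<mu> h" and z: "z \<in> borel_measurable \<mu>" "AE y in \<mu>. \<bar>z y\<bar> \<le> b"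
  shows "integrable \<mu> (\<lambda>y. h y * z y)"
proof (rule Bochner_Integration.integrable_bound)
  show "integrable \<mu> (\<lambda>y. b * h y)" using h by simp
  show "(\<lambda>y. h y * z y) \<in> borel_measurable \<mu>" using h z by measurable
  show "AE y in \<mu>. norm (h y * z y) \<le> norm (b * h y)"
    using z(2)
  proof eventually_elim
    case (elim y)
    then have "\<bar>h y\<bar> * \<bar>z y\<bar> \<le> \<bar>h y\<bar> * \<bar>b\<bar>" by (intro mult_left_mono) auto
    then show ?case by (simp add: abs_mult mult.commute)
  qed
qed

lemma abs_integral_mult_le:
  fixes h z :: "'a \<Rightarrow> real"
  assumes h: "integrable \<mu> h" "AE y in \<mu>. 0 \<le> h y" and c: "integral\<^sup>L \<mu> h \<le> c"
    and z: "z \<in> borel_measurable \<mu>" "AE y in \<mu>. \<bar>z y\<bar> \<le> b" and b: "b \<ge> 0"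
  shows "\<bar>\<integral>y. h y * z y \<partial>\<mu>\<bar> \<le> c * b"
proof -
  have i: "integrable \<mu> (\<lambda>y. h y * z y)" by (rule integrable_mult_AE_bounded[OF h(1) z])
  have "\<bar>\<integral>y. h y * z y \<partial>\<mu>\<bar> \<le> (\<integral>y. \<bar>h y * z y\<bar> \<partial>\<mu>)"
    by (rule integral_abs_bound)
  also have "\<dots> \<le> (\<integral>y. h y * b \<partial>\<mu>)"
  proof (rule integral_mono_AE)
    show "integrable \<mu> (\<lambda>y. \<bar>h y * z y\<bar>)" using i by simp
    show "integrable \<mu> (\<lambda>y. h y * b)" using h by simp
    show "AE y in \<mu>. \<bar>h y * z y\<bar> \<le> h y * b"
      using h(2) z(2) by eventually_elim (simp add: abs_mult mult_left_mono)
  qed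
  also have "\<dots> \<le> c * b" using c b by (simp add: mult_right_mono)
  finally show ?thesis .
qed

text \<open>Both parts of the increment are integrable, so it may be split. This is the source of
  the form K z - g * z.\<close>

lemma integral_kernel_increment:
  fixes h z :: "'a \<Rightarrow> real"
  assumes h: "integrable \<mu> h" and z: "z \<in> borel_measurable \<mu>" "AE y in \<mu>. \<bar>z y\<bar> \<le> b"
  shows "(\<integral>y. h y * (z y - r) \<partial>\<mu>) = (\<integral>y. h y * z y \<partial>\<mu>) - integral\<^sup>L \<mu> h * r"
proof -
  have "(\<integral>y. h y * (z y - r) \<partial>\<mu>) = (\<integral>y. h y * z y - h y * r \<partial>\<mu>)"
    by (simp add: right_diff_distrib)
  also have "\<dots> = (\<integral>y. h y * z y \<partial>\<mu>) - integral\<^sup>L \<mu> h * r"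
    using integrable_mult_AE_bounded[OF h z] h by (subst Bochner_Integration.integral_diff) auto
  finally show ?thesis .
qed

text \<open>Nonnegative rows make K monotone, and their mass bounds it by c. The Lipschitz constant
  2 * c of G is c for K plus c for multiplication by g, transported to G across null
  functions.\<close>

lemma (in phase_space) nonlocal_operator_kernelI:
  fixes \<mu> :: "'a measure" and k :: "'a \<Rightarrow> 'a \<Rightarrow> real" and G :: "('a \<Rightarrow> real) \<Rightarrow> 'a \<Rightarrow> real" and c :: real
  defines "K \<equiv> \<lambda>z x. \<integral>y. k x y * z y \<partial>\<mu>" and "g \<equiv> \<lambda>x. integral\<^sup>L \<mu> (k x)"
  assumes meas: "\<And>z. z \<in> M \<Longrightarrow> z \<in> borel_measurable \<mu>"
    and bdd: "\<And>z. z \<in> M \<Longrightarrow> AE y in \<mu>. \<bar>z y\<bar> \<le> N z"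
    and k: "\<And>x. integrable \<mu> (k x)" "\<And>x. AE y in \<mu>. 0 \<le> k x y" "\<And>x. integral\<^sup>L \<mu> (k x) \<le> c"
    and K_mem: "\<And>z. z \<in> M \<Longrightarrow> K z \<in> M"
    and G_mem: "\<And>z. z \<in> M \<Longrightarrow> G z \<in> M"
    and G_eq: "\<And>z. z \<in> M \<Longrightarrow> N (\<lambda>x. (K z x - g x * z x) - G z x) = 0"
  shows "nonlocal_operator M N G K g c"
proof -
  \<comment> \<open>\<open>g\<close> is K applied to the constant 1.\<close>
  have g_mem: "g \<in> M" using K_mem[OF const_mem[of 1]] by (simp add: K_def g_def)
  have g_ge: "0 \<le> g x" and g_le: "g x \<le> c" for x
    unfolding g_def using k by (auto intro: integral_nonneg_AE)
  have c: "c \<ge> 0" using g_ge g_le order_trans by blast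
  have K_diff: "K z x - K w x = K (\<lambda>y. z y - w y) x" if "z \<in> M" "w \<in> M" for z w x
    unfolding K_def right_diff_distrib
    using Bochner_Integration.integral_diff[OF integrable_mult_AE_bounded[OF k(1) meas bdd] integrable_mult_AE_bounded[OF k(1) meas bdd], OF that(1) that(1) that(2) that(2)]
    by simp
  have K_abs: "\<bar>K z x\<bar> \<le> c * b" if "z \<in> M" "AE y in \<mu>. \<bar>z y\<bar> \<le> b" "b \<ge> 0" for z x b
    unfolding K_def by (rule abs_integral_mult_le[OF k meas that(2,3)]) (rule that)
  show ?thesis
  proof
    show "G z \<in> M" if "z \<in> M" for z by (rule G_mem[OF that])
    show "K z \<in> M" if "z \<in> M" for z by (rule K_mem[OF that])
    show "g \<in> M" "0 \<le> g x" "g x \<le> c" for x by (rule g_mem g_ge g_le)+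
    show "N (\<lambda>x. K z x - g x * z x - G z x) = 0" if "z \<in> M" for z by (rule G_eq[OF that])
    show "\<bar>K z x - K w x\<bar> \<le> c * r" if "z \<in> M" "w \<in> M" "\<And>x. \<bar>z x - w x\<bar> \<le> r" for z w r x
    proof -
      have "r \<ge> 0" using order_trans[OF abs_ge_zero that(3)] .
      then show ?thesis unfolding K_diff[OF that(1,2)]
        using that(3) by (intro K_abs diff_mem that) auto
    qed
    show "0 \<le> K z x" if "z \<in> M" "\<And>x. 0 \<le> z x" for z x
      unfolding K_def
    proof (rule integral_nonneg_AE)
      show "AE y in \<mu>. 0 \<le> k x y * z y" using k(2)[of x] by eventually_elim (simp add: that(2))
    qed
    show "K z x \<le> g x * b" if "z \<in> M" "\<And>x. 0 \<le> z x" "\<And>x. z x \<le> b" for z x b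
    proof -
      have "AE y in \<mu>. k x y * z y \<le> k x y * b"
        using k(2)[of x] by eventually_elim (simp add: mult_left_mono that(3))
      then have "K z x \<le> (\<integral>y. k x y * b \<partial>\<mu>)"
        unfolding K_def using k(1)
        by (intro integral_mono_AE integrable_mult_AE_bounded[OF k(1) meas[OF that(1)] bdd[OF that(1)]]) auto
      then show ?thesis by (simp add: g_def)
    qed
    show "N (\<lambda>x. G z x - G w x) \<le> 2 * c * N (\<lambda>x. z x - w x)" if z: "z \<in> M" and w: "w \<in> M" for z w
    proof -
      let ?d = "\<lambda>x. z x - w x"
      have d: "?d \<in> M" by (rule diff_mem[OF z w])
      let ?P = "\<lambda>z x. K z x - g x * z x"
      have P_mem: "?P z \<in> M" if "z \<in> M" for z
        by (rule diff_mem[OF K_mem[OF that] mult_mem[OF g_mem that]])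
      have eq: "(\<lambda>x. ?P z x - ?P w x) = ?P ?d"
        using K_diff[OF z w] by (auto simp: algebra_simps)
      have "N (\<lambda>x. g x * ?d x) \<le> N g * N ?d" by (rule N_mult[OF g_mem d])
      also have "\<dots> \<le> c * N ?d"
        using g_ge g_le by (intro mult_right_mono N_le g_mem N_nonneg d) auto
      finally have gd: "N (\<lambda>x. g x * ?d x) \<le> c * N ?d" .
      have "N (K ?d) \<le> c * N ?d"
        by (intro N_le K_mem d K_abs bdd N_nonneg)
      then have Pd: "N (?P ?d) \<le> 2 * c * N ?d"
        using N_diff[OF K_mem[OF d] mult_mem[OF g_mem d]] gd by linarith
      have "N (\<lambda>x. G z x - G w x) \<le> N (\<lambda>x. G z x - ?P z x) + N (\<lambda>x. ?P z x - G w x)"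
        by (intro N_diff_triangle G_mem P_mem z w)
      also have "N (\<lambda>x. ?P z x - G w x) \<le> N (\<lambda>x. ?P z x - ?P w x) + N (\<lambda>x. ?P w x - G w x)"
        by (intro N_diff_triangle G_mem P_mem z w)
      also have "N (\<lambda>x. G z x - ?P z x) = 0"
        using N_diff_commute[OF G_mem[OF z] P_mem[OF z]] G_eq[OF z] by simp
      also have "N (\<lambda>x. ?P w x - G w x) = 0" by (rule G_eq[OF w])
      finally show ?thesis using Pd eq by simp
    qed
  qed
qed

section \<open>Continuous functions on the closure\<close>

lemma Cbar_norm_ge:
  assumes "bounded \<Omega>" "z \<in> Cbar_space \<Omega>" "x \<in> closure \<Omega>"
  shows "\<bar>z x\<bar> \<le> Cbar_norm \<Omega> z"
proof -
  have "compact ((\<lambda>x. \<bar>z x\<bar>) ` closure \<Omega>)"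
    using assms by (intro compact_continuous_image continuous_intros) (auto simp: Cbar_space_def)
  then have "bdd_above ((\<lambda>x. \<bar>z x\<bar>) ` closure \<Omega>)"
    by (intro bounded_imp_bdd_above compact_imp_bounded)
  then show ?thesis unfolding Cbar_norm_def using assms by (intro cSup_upper) auto
qed

lemma Cbar_norm_le:
  assumes "\<Omega> \<noteq> {}" "\<And>x. x \<in> closure \<Omega> \<Longrightarrow> \<bar>z x\<bar> \<le> b"
  shows "Cbar_norm \<Omega> z \<le> b"
  unfolding Cbar_norm_def using assms by (intro cSup_least) auto

lemma Cbar_phase_space:
  fixes \<Omega> :: "'a::euclidean_space set"
  assumes \<Omega>: "bounded \<Omega>" "\<Omega> \<noteq> {}"
  shows "phase_space (Cbar_space \<Omega>) (Cbar_norm \<Omega>)"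
proof
  note ge = Cbar_norm_ge[OF \<Omega>(1)] and le = Cbar_norm_le[OF \<Omega>(2)]
  obtain a where a: "a \<in> closure \<Omega>" using \<Omega>(2) closure_subset by blast
  let ?M = "Cbar_space \<Omega>" and ?N = "Cbar_norm \<Omega>"
  show "(\<lambda>x. c) \<in> ?M" for c by (simp add: Cbar_space_def)
  show "(\<lambda>x. z x + w x) \<in> ?M" "(\<lambda>x. z x * w x) \<in> ?M" if "z \<in> ?M" "w \<in> ?M" for z w
    using that by (auto simp: Cbar_space_def intro!: continuous_intros)
  show nn: "0 \<le> ?N z" if "z \<in> ?M" for z using ge[OF that a] by linarith
  show "?N (\<lambda>x. z x + w x) \<le> ?N z + ?N w" if "z \<in> ?M" "w \<in> ?M" for z w
    by (rule le) (use ge[OF that(1)] ge[OF that(2)] abs_triangle_ineq in \<open>smt (verit)\<close>)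
  show "?N (\<lambda>x. z x * w x) \<le> ?N z * ?N w" if "z \<in> ?M" "w \<in> ?M" for z w
    unfolding abs_mult by (intro le) (auto simp: abs_mult intro!: mult_mono ge that nn)
  show "?N z \<le> b" if "\<And>x. \<bar>z x\<bar> \<le> b" for z b by (rule le) (rule that)
  show "z \<in> ?M" if "\<And>n. W n \<in> ?M" "uniform_limit UNIV W z sequentially" for W :: "nat \<Rightarrow> 'a \<Rightarrow> real" and z
    unfolding Cbar_space_def mem_Collect_eq
    by (rule uniform_limit_theorem[OF _ uniform_limit_on_subset[OF that(2)]]) (use that(1) in \<open>auto simp: Cbar_space_def\<close>)
  show "\<exists>w\<in>?M. (\<forall>x. 0 \<le> w x \<and> w x \<le> ?N z) \<and> ?N (\<lambda>x. z x - w x) = 0" if "z \<in> Xplus ?M ?N" for z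
  proof -
    have z: "z \<in> ?M" "?N (\<lambda>x. min (z x) 0) = 0" using that by (auto simp: Xplus_def)
    have m: "(\<lambda>x. min (z x) 0) \<in> ?M" using z(1) by (auto simp: Cbar_space_def intro!: continuous_intros)
    have z0: "0 \<le> z x" if "x \<in> closure \<Omega>" for x using ge[OF m that] z(2) by simp
    \<comment> \<open>On the closure z already lies between 0 and its norm, so clipping changes
      nothing there; elsewhere it enforces the bounds.\<close>
    define w where "w = (\<lambda>x. max 0 (min (z x) (?N z)))"
    have w: "w \<in> ?M" using z(1) by (auto simp: Cbar_space_def w_def intro!: continuous_intros)
    have eq: "z x - w x = 0" if "x \<in> closure \<Omega>" for x
      using z0[OF that] ge[OF z(1) that] by (simp add: w_def)
    have d: "(\<lambda>x. z x - w x) \<in> ?M" using z(1) w by (auto simp: Cbar_space_def intro!: continuous_intros)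
    have "?N (\<lambda>x. z x - w x) \<le> 0" by (rule le) (simp add: eq)
    then have "?N (\<lambda>x. z x - w x) = 0" using nn[OF d] by linarith
    moreover have "\<forall>x. 0 \<le> w x \<and> w x \<le> ?N z" using nn[OF z(1)] by (simp add: w_def)
    ultimately show ?thesis using w by blast
  qed
qed

text \<open>C times the volume of \<Omega> bounds the row integrals at boundary points too, where K
  and g also have to be controlled.\<close>

lemma Cbar_nonlocal_operator:
  fixes \<Omega> :: "'a::euclidean_space set" and \<gamma> :: "'a \<Rightarrow> 'a \<Rightarrow> real"
  assumes \<Omega>: "open \<Omega>" "bounded \<Omega>" "\<Omega> \<noteq> {}"
    and nonneg: "\<And>x y. x \<in> \<Omega> \<Longrightarrow> y \<in> \<Omega> \<Longrightarrow> 0 \<le> \<gamma> x y"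
    and cont: "continuous_on (closure \<Omega> \<times> closure \<Omega>) (\<lambda>(x, y). \<gamma> x y)"
    and C: "\<And>x y. x \<in> closure \<Omega> \<Longrightarrow> y \<in> closure \<Omega> \<Longrightarrow> \<gamma> x y \<le> C"
  shows "\<exists>K g. nonlocal_operator (Cbar_space \<Omega>) (Cbar_norm \<Omega>) (Gam \<Omega> \<gamma>) K g (C * measure lebesgue \<Omega>)"
proof -
  interpret phase_space "Cbar_space \<Omega>" "Cbar_norm \<Omega>" by (rule Cbar_phase_space[OF \<Omega>(2,3)])
  note ge = Cbar_norm_ge[OF \<Omega>(2)] and le = Cbar_norm_le[OF \<Omega>(3)]
  let ?\<mu> = "lebesgue_on \<Omega>"
  have \<Omega>L: "\<Omega> \<in> lmeasurable" using \<Omega> by (simp add: lmeasurable_open)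
  then have \<Omega>s: "\<Omega> \<in> sets lebesgue" by blast
  have fin: "finite_measure ?\<mu>" using \<Omega>L by (simp add: finite_measure_lebesgue_on)
  have sp: "space ?\<mu> = \<Omega>" by simp
  have sub: "\<Omega> \<subseteq> closure \<Omega>" by (rule closure_subset)
  \<comment> \<open>Rows outside the closure are set to 0, because the bounds of
    \<open>nonlocal_operator\<close> are asked at every point of the ambient space.\<close>
  define k where "k = (\<lambda>x y. if x \<in> closure \<Omega> then \<gamma> x y else 0)"
  have \<gamma>0: "0 \<le> \<gamma> x y" if "x \<in> closure \<Omega>" "y \<in> closure \<Omega>" for x y
    using continuous_ge_on_closure[of "\<Omega> \<times> \<Omega>" "\<lambda>(x, y). \<gamma> x y" "(x, y)" 0] cont that nonneg
    by (auto simp: closure_Times)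
  have C0: "C \<ge> 0"
  proof -
    obtain a where "a \<in> closure \<Omega>" using \<Omega>(3) sub by blast
    then show ?thesis using \<gamma>0[of a a] C[of a a] by linarith
  qed
  have k_bd: "0 \<le> k x y" "k x y \<le> C" if "y \<in> \<Omega>" for x y
    using that \<gamma>0[of x y] C[of x y] C0 sub by (auto simp: k_def)
  have \<gamma>y: "continuous_on (closure \<Omega>) (\<gamma> x)" if x: "x \<in> closure \<Omega>" for x
  proof -
    have "continuous_on (closure \<Omega>) (\<lambda>y. (x, y))" by (intro continuous_intros)
    from continuous_on_compose2[OF cont this] x show ?thesis by auto
  qed
  have \<gamma>x: "continuous_on (closure \<Omega>) (\<lambda>x. \<gamma> x y)" if y: "y \<in> closure \<Omega>" for y
  proof -
    have "continuous_on (closure \<Omega>) (\<lambda>x. (x, y))" by (intro continuous_intros)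
    from continuous_on_compose2[OF cont this] y show ?thesis by auto
  qed
  have meas: "z \<in> borel_measurable ?\<mu>" if "continuous_on (closure \<Omega>) z" for z :: "'a \<Rightarrow> real"
    by (rule continuous_imp_measurable_on_sets_lebesgue[OF continuous_on_subset[OF that sub] \<Omega>s])
  have k_meas: "k x \<in> borel_measurable ?\<mu>" for x
    using meas[OF \<gamma>y] by (cases "x \<in> closure \<Omega>") (auto simp: k_def)
  have int_const: "integrable ?\<mu> (\<lambda>y. r)" for r :: real
    using finite_measure.integrable_const[OF fin] .
  have k_int: "integrable ?\<mu> (k x)" for x
    by (rule Bochner_Integration.integrable_bound[OF int_const[of C] k_meas]) (use k_bd C0 sp in \<open>auto intro!: AE_I2\<close>)
  have k_le: "integral\<^sup>L ?\<mu> (k x) \<le> C * measure lebesgue \<Omega>" for x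
  proof -
    have "integral\<^sup>L ?\<mu> (k x) \<le> (\<integral>y. C \<partial>?\<mu>)"
      by (intro integral_mono k_int int_const) (use k_bd sp in auto)
    also have "\<dots> = C * measure lebesgue \<Omega>" using \<Omega>s by (simp add: measure_restrict_space)
    finally show ?thesis .
  qed
  let ?K = "\<lambda>z x. \<integral>y. k x y * z y \<partial>?\<mu>" and ?g = "\<lambda>x. integral\<^sup>L ?\<mu> (k x)"
  have bdd: "AE y in ?\<mu>. \<bar>z y\<bar> \<le> Cbar_norm \<Omega> z" if "z \<in> Cbar_space \<Omega>" for z
    using ge[OF that] sub by (auto intro!: AE_I2)
  have zm: "z \<in> borel_measurable ?\<mu>" if "z \<in> Cbar_space \<Omega>" for z
    using that meas by (simp add: Cbar_space_def)
  \<comment> \<open>Sequential continuity by dominated convergence; the constant majorant is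
    integrable because \<Omega> has finite measure.\<close>
  have K_mem: "?K z \<in> Cbar_space \<Omega>" if z: "z \<in> Cbar_space \<Omega>" for z
    unfolding Cbar_space_def mem_Collect_eq continuous_on_sequentially
  proof (intro allI ballI impI, elim conjE)
    fix X x assume x: "x \<in> closure \<Omega>" and X: "\<forall>n. X n \<in> closure \<Omega>" "X \<longlonglongrightarrow> x"
    have "(\<lambda>n. ?K z (X n)) \<longlonglongrightarrow> ?K z x"
    proof (rule integral_dominated_convergence[where w = "\<lambda>y. C * Cbar_norm \<Omega> z"])
      show "(\<lambda>y. k x y * z y) \<in> borel_measurable ?\<mu>" "(\<lambda>y. k (X n) y * z y) \<in> borel_measurable ?\<mu>" for n
        using k_meas zm[OF z] by auto
      show "integrable ?\<mu> (\<lambda>y. C * Cbar_norm \<Omega> z)" by (rule int_const)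
      show "AE y in ?\<mu>. (\<lambda>n. k (X n) y * z y) \<longlonglongrightarrow> k x y * z y"
      proof (rule AE_I2)
        fix y assume "y \<in> space ?\<mu>"
        then have y: "y \<in> closure \<Omega>" using sub by auto
        have "(\<lambda>n. \<gamma> (X n) y) \<longlonglongrightarrow> \<gamma> x y"
          using \<gamma>x[OF y] x X unfolding continuous_on_sequentially comp_def by blast
        then show "(\<lambda>n. k (X n) y * z y) \<longlonglongrightarrow> k x y * z y"
          using x X(1) by (auto simp: k_def intro!: tendsto_intros)
      qed
      show "AE y in ?\<mu>. norm (k (X n) y * z y) \<le> C * Cbar_norm \<Omega> z" for n
      proof (rule AE_I2)
        fix y assume "y \<in> space ?\<mu>"
        then have y: "y \<in> \<Omega>" "y \<in> closure \<Omega>" using sub by auto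
        show "norm (k (X n) y * z y) \<le> C * Cbar_norm \<Omega> z"
          unfolding real_norm_def abs_mult
          using k_bd[OF y(1)] ge[OF z y(2)] C0 by (intro mult_mono) auto
      qed
    qed
    then show "((\<lambda>x. ?K z x) \<circ> X) \<longlonglongrightarrow> ?K z x" by (simp add: comp_def)
  qed
  have G_eq: "Gam \<Omega> \<gamma> z x = ?K z x - ?g x * z x" if "z \<in> Cbar_space \<Omega>" "x \<in> closure \<Omega>" for z x
  proof -
    have "Gam \<Omega> \<gamma> z x = (\<integral>y. k x y * (z y - z x) \<partial>?\<mu>)" using that by (simp add: Gam_def k_def)
    then show ?thesis using integral_kernel_increment[OF k_int zm[OF that(1)] bdd[OF that(1)]] by simp
  qed
  have g_mem: "?g \<in> Cbar_space \<Omega>" using K_mem[OF const_mem[of 1]] by simp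
  have G_mem: "Gam \<Omega> \<gamma> z \<in> Cbar_space \<Omega>" if "z \<in> Cbar_space \<Omega>" for z
  proof -
    have "(\<lambda>x. ?K z x - ?g x * z x) \<in> Cbar_space \<Omega>"
      by (rule diff_mem[OF K_mem[OF that] mult_mem[OF g_mem that]])
    moreover have "continuous_on (closure \<Omega>) (Gam \<Omega> \<gamma> z) \<longleftrightarrow> continuous_on (closure \<Omega>) (\<lambda>x. ?K z x - ?g x * z x)"
      by (rule continuous_on_cong) (simp_all add: G_eq[OF that])
    ultimately show ?thesis by (simp add: Cbar_space_def)
  qed
  have "nonlocal_operator (Cbar_space \<Omega>) (Cbar_norm \<Omega>) (Gam \<Omega> \<gamma>) ?K ?g (C * measure lebesgue \<Omega>)"
  proof (rule nonlocal_operator_kernelI[where \<mu> = ?\<mu>])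
    show "AE y in ?\<mu>. 0 \<le> k x y" for x using k_bd(1) by (auto intro!: AE_I2)
    fix z assume z: "z \<in> Cbar_space \<Omega>"
    let ?d = "\<lambda>x. (?K z x - ?g x * z x) - Gam \<Omega> \<gamma> z x"
    have d: "?d \<in> Cbar_space \<Omega>"
      by (rule diff_mem[OF diff_mem[OF K_mem[OF z] mult_mem[OF g_mem z]] G_mem[OF z]])
    have "Cbar_norm \<Omega> ?d \<le> 0" by (rule le) (simp add: G_eq[OF z])
    then show "Cbar_norm \<Omega> ?d = 0" using N_nonneg[OF d] by linarith
  qed (fact zm bdd k_int k_le K_mem G_mem)+
  then show ?thesis by blast
qed

section \<open>Essentially bounded functions\<close>

text \<open>Completeness of Lebesgue measure, applied to the extension by zero. It makes sections of
  \<gamma> and the functions Gam z measurable, which are known only up to null sets.\<close>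

lemma borel_measurable_lebesgue_on_AE:
  fixes f g :: "'a::euclidean_space \<Rightarrow> real"
  assumes f: "f \<in> borel_measurable (lebesgue_on \<Omega>)" and S: "\<Omega> \<in> sets lebesgue"
    and ae: "AE x in lebesgue_on \<Omega>. f x = g x"
  shows "g \<in> borel_measurable (lebesgue_on \<Omega>)"
proof -
  have "(\<lambda>x. if x \<in> \<Omega> then f x else 0) \<in> borel_measurable lebesgue"
    using f S by (simp add: borel_measurable_if)
  moreover have "AE x in lebesgue. (if x \<in> \<Omega> then f x else 0) = (if x \<in> \<Omega> then g x else 0)"
    using ae S by (auto simp: AE_restrict_space_iff)
  ultimately have "(\<lambda>x. if x \<in> \<Omega> then g x else 0) \<in> borel_measurable lebesgue"
    by (rule borel_measurable_AE)
  then show ?thesis using S by (simp add: borel_measurable_if)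
qed

lemma Linf_spaceI:
  assumes "z \<in> borel_measurable (lebesgue_on \<Omega>)" "AE x in lebesgue_on \<Omega>. \<bar>z x\<bar> \<le> b"
  shows "z \<in> Linf_space \<Omega>"
proof -
  have "(\<lambda>x. ereal \<bar>z x\<bar>) \<in> borel_measurable (lebesgue_on \<Omega>)" using assms(1) by measurable
  then have "esssup (lebesgue_on \<Omega>) (\<lambda>x. ereal \<bar>z x\<bar>) \<le> ereal b"
    using assms(2) by (intro esssup_I) auto
  then show ?thesis using assms(1) by (auto simp: Linf_space_def)
qed

text \<open>Over a null set the essential supremum would be minus infinity; a nonempty open set has
  positive measure.\<close>

lemma esssup_abs_nonneg:
  fixes z :: "'a::euclidean_space \<Rightarrow> real"
  assumes "open \<Omega>" "\<Omega> \<noteq> {}"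
  shows "0 \<le> esssup (lebesgue_on \<Omega>) (\<lambda>x. ereal \<bar>z x\<bar>)"
proof -
  have "\<not> negligible \<Omega>" using open_not_negligible assms by blast
  then have "emeasure lebesgue \<Omega> \<noteq> 0"
    using assms by (simp add: negligible_iff_null_sets null_sets_def lmeasurable_iff_integrable)
  then have "emeasure (lebesgue_on \<Omega>) (space (lebesgue_on \<Omega>)) \<noteq> 0"
    using assms by (simp add: emeasure_restrict_space)
  then have "0 = esssup (lebesgue_on \<Omega>) (\<lambda>x. 0 :: ereal)" by (simp add: esssup_const)
  also have "\<dots> \<le> esssup (lebesgue_on \<Omega>) (\<lambda>x. ereal \<bar>z x\<bar>)" by (rule esssup_mono) auto
  finally show ?thesis .
qed

lemma Linf_norm_nonneg: "open \<Omega> \<Longrightarrow> \<Omega> \<noteq> {} \<Longrightarrow> 0 \<le> Linf_norm \<Omega> z"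
  using esssup_abs_nonneg[of \<Omega> z] by (simp add: Linf_norm_def real_of_ereal_pos)

lemma AE_abs_le_Linf_norm:
  assumes "open \<Omega>" "\<Omega> \<noteq> {}" "z \<in> Linf_space \<Omega>"
  shows "AE x in lebesgue_on \<Omega>. \<bar>z x\<bar> \<le> Linf_norm \<Omega> z"
proof -
  let ?e = "esssup (lebesgue_on \<Omega>) (\<lambda>x. ereal \<bar>z x\<bar>)"
  \<comment> \<open>Finiteness makes \<open>real_of_ereal\<close> faithful here.\<close>
  have "0 \<le> ?e" "?e < \<infinity>" using assms esssup_abs_nonneg by (auto simp: Linf_space_def)
  then have "ereal (Linf_norm \<Omega> z) = ?e" by (auto simp: Linf_norm_def ereal_real)
  then have "AE x in lebesgue_on \<Omega>. ereal \<bar>z x\<bar> \<le> ereal (Linf_norm \<Omega> z)"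
    using esssup_AE[of "\<lambda>x. ereal \<bar>z x\<bar>" "lebesgue_on \<Omega>"] by simp
  then show ?thesis by simp
qed

lemma Linf_norm_le:
  assumes "open \<Omega>" "\<Omega> \<noteq> {}" "z \<in> borel_measurable (lebesgue_on \<Omega>)" "AE x in lebesgue_on \<Omega>. \<bar>z x\<bar> \<le> b"
  shows "Linf_norm \<Omega> z \<le> b"
proof -
  let ?e = "esssup (lebesgue_on \<Omega>) (\<lambda>x. ereal \<bar>z x\<bar>)"
  have "(\<lambda>x. ereal \<bar>z x\<bar>) \<in> borel_measurable (lebesgue_on \<Omega>)" using assms(3) by measurable
  then have "?e \<le> ereal b" using assms(4) by (intro esssup_I) auto
  moreover have "0 \<le> ?e" using assms esssup_abs_nonneg by auto
  ultimately show ?thesis by (cases ?e) (auto simp: Linf_norm_def)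
qed

lemma Linf_space_measurable: "z \<in> Linf_space \<Omega> \<Longrightarrow> z \<in> borel_measurable (lebesgue_on \<Omega>)"
  by (simp add: Linf_space_def)

lemma Linf_phase_space:
  fixes \<Omega> :: "'a::euclidean_space set"
  assumes \<Omega>: "open \<Omega>" "\<Omega> \<noteq> {}"
  shows "phase_space (Linf_space \<Omega>) (Linf_norm \<Omega>)"
proof
  let ?M = "Linf_space \<Omega>" and ?N = "Linf_norm \<Omega>" and ?\<mu> = "lebesgue_on \<Omega>"
  note ge = AE_abs_le_Linf_norm[OF \<Omega>] and le = Linf_norm_le[OF \<Omega>] and nn = Linf_norm_nonneg[OF \<Omega>]
    and meas = Linf_space_measurable[of _ \<Omega>]
  show "(\<lambda>x. c) \<in> ?M" for c by (rule Linf_spaceI[of _ _ "\<bar>c\<bar>"]) auto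
  have add: "AE x in ?\<mu>. \<bar>z x + w x\<bar> \<le> ?N z + ?N w" if "z \<in> ?M" "w \<in> ?M" for z w
    using ge[OF that(1)] ge[OF that(2)] by eventually_elim linarith
  have mult: "AE x in ?\<mu>. \<bar>z x * w x\<bar> \<le> ?N z * ?N w" if "z \<in> ?M" "w \<in> ?M" for z w
    using ge[OF that(1)] ge[OF that(2)] by eventually_elim (auto simp: abs_mult intro!: mult_mono nn)
  have m: "(\<lambda>x. z x + w x) \<in> borel_measurable ?\<mu>" "(\<lambda>x. z x * w x) \<in> borel_measurable ?\<mu>"
    if "z \<in> ?M" "w \<in> ?M" for z w
    using meas[OF that(1)] meas[OF that(2)] by auto
  show "(\<lambda>x. z x + w x) \<in> ?M" "(\<lambda>x. z x * w x) \<in> ?M"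
    "?N (\<lambda>x. z x + w x) \<le> ?N z + ?N w" "?N (\<lambda>x. z x * w x) \<le> ?N z * ?N w"
    if "z \<in> ?M" "w \<in> ?M" for z w
    using Linf_spaceI[OF m(1) add] Linf_spaceI[OF m(2) mult] le[OF m(1) add] le[OF m(2) mult] that by blast+
  show "0 \<le> ?N z" for z by (rule nn)
  show "?N z \<le> b" if "z \<in> ?M" "\<And>x. \<bar>z x\<bar> \<le> b" for z b using le[OF meas[OF that(1)]] that(2) by simp
  show "z \<in> ?M" if W: "\<And>n. W n \<in> ?M" "uniform_limit UNIV W z sequentially" for W :: "nat \<Rightarrow> 'a \<Rightarrow> real" and z
  proof -
    have "z \<in> borel_measurable ?\<mu>"
      by (rule borel_measurable_LIMSEQ_real[OF _ meas[OF W(1)]]) (rule tendsto_uniform_limitI[OF W(2)], simp)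
    \<comment> \<open>A single function within distance 1 of the limit already bounds it.\<close>
    moreover obtain n where n: "\<And>x. dist (W n x) (z x) < 1"
      using uniform_limitD[OF W(2), of 1] by (auto simp: eventually_sequentially)
    have "AE x in ?\<mu>. \<bar>z x\<bar> \<le> ?N (W n) + 1"
      using ge[OF W(1)[of n]]
    proof eventually_elim
      case (elim x)
      then show ?case using n[of x] by (simp add: dist_real_def)
    qed
    ultimately show ?thesis by (rule Linf_spaceI)
  qed
  show "\<exists>w\<in>?M. (\<forall>x. 0 \<le> w x \<and> w x \<le> ?N z) \<and> ?N (\<lambda>x. z x - w x) = 0" if "z \<in> Xplus ?M ?N" for z
  proof -
    have z: "z \<in> ?M" "?N (\<lambda>x. min (z x) 0) = 0" using that by (auto simp: Xplus_def)
    note [measurable] = meas[OF z(1)]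
    have mm: "(\<lambda>x. min (z x) 0) \<in> ?M"
    proof (rule Linf_spaceI)
      show "AE x in ?\<mu>. \<bar>min (z x) 0\<bar> \<le> ?N z" using ge[OF z(1)] by eventually_elim auto
    qed measurable
    define w where "w = (\<lambda>x. max 0 (min (z x) (?N z)))"
    have w_meas[measurable]: "w \<in> borel_measurable ?\<mu>" unfolding w_def by measurable
    have wb: "0 \<le> w x \<and> w x \<le> ?N z" for x using nn[of z] by (simp add: w_def)
    have "w \<in> ?M" using wb by (intro Linf_spaceI[OF w_meas, of "?N z"] AE_I2) auto
    \<comment> \<open>The negative part vanishes almost everywhere and |z| is at most its norm
      almost everywhere, so clipping alters z on a null set only.\<close>
    moreover have "AE x in ?\<mu>. \<bar>z x - w x\<bar> \<le> 0"
      using ge[OF z(1)] ge[OF mm] by eventually_elim (auto simp: z(2) w_def)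
    then have "?N (\<lambda>x. z x - w x) \<le> 0" by (intro le) measurable
    then have "?N (\<lambda>x. z x - w x) = 0" using nn[of "\<lambda>x. z x - w x"] by linarith
    ultimately show ?thesis using wb by blast
  qed
qed

text \<open>Only almost every section of a Lebesgue measurable kernel is measurable. A Borel version, set to 0
  on the exceptional rows, makes the integral operator well behaved at every point.\<close>

lemma kernel_borel_version:
  fixes \<Omega> :: "'a::euclidean_space set"
  assumes \<Omega>: "open \<Omega>" and ker: "kernel_cond \<Omega> \<gamma>inf \<gamma>"
  obtains k where "case_prod k \<in> borel_measurable (lborel \<Otimes>\<^sub>M lborel)" "\<And>x y. 0 \<le> k x y"
    "\<And>x. (\<integral>\<^sup>+ y. ennreal (k x y) \<partial>lborel) \<le> ennreal \<gamma>inf"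
    "AE x in lebesgue_on \<Omega>. AE y in lebesgue_on \<Omega>. k x y = \<gamma> x y"
proof -
  have \<Omega>L: "\<Omega> \<in> sets lebesgue" and \<Omega>\<Omega>: "\<Omega> \<times> \<Omega> \<in> sets lebesgue" using \<Omega> by (auto simp: open_Times)
  have \<gamma>0: "\<And>x y. x \<in> \<Omega> \<Longrightarrow> y \<in> \<Omega> \<Longrightarrow> 0 \<le> \<gamma> x y"
    and \<gamma>m: "(\<lambda>(x, y). \<gamma> x y) \<in> borel_measurable (lebesgue_on (\<Omega> \<times> \<Omega>))"
    and \<gamma>b: "\<And>x. x \<in> \<Omega> \<Longrightarrow> (\<integral>\<^sup>+ y. ennreal (\<gamma> x y) \<partial>(lebesgue_on \<Omega>)) \<le> ennreal \<gamma>inf"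
    using ker by (auto simp: kernel_cond_def)
  define h where "h = (\<lambda>p. if p \<in> \<Omega> \<times> \<Omega> then case_prod \<gamma> p else 0)"
  have "h \<in> borel_measurable lebesgue"
    unfolding h_def using \<gamma>m \<Omega>\<Omega> by (simp add: borel_measurable_if)
  then obtain h' where h': "h' \<in> borel_measurable lborel" and ae: "AE p in lborel. h p = h' p"
    using completion_ex_borel_measurable_real by blast
  have [measurable]: "h' \<in> borel_measurable (lborel \<Otimes>\<^sub>M lborel)" using h' by (simp add: lborel_prod)
  \<comment> \<open>\<open>lborel\<close> on the product type is the product measure, so the
    exceptional null set has null sections over almost every x.\<close>
  have "AE p in lborel \<Otimes>\<^sub>M lborel. h p = h' p" unfolding lborel_prod by (rule ae)
  then have AE2: "AE x in lborel. AE y in lborel. h (x, y) = h' (x, y)"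
    by (rule lborel_pair.AE_pair)
  define I where "I = (\<lambda>x. \<integral>\<^sup>+ y. ennreal (max 0 (h' (x, y))) \<partial>lborel)"
  have [measurable]: "I \<in> borel_measurable lborel" unfolding I_def by measurable
  \<comment> \<open>The test on \<open>I x\<close> is Borel, so \<open>k\<close> stays measurable
    while every row has mass at most \<open>\<gamma>inf\<close>. For almost every x in \<Omega>,
    \<open>I x\<close> is the row mass of \<gamma>, and the test succeeds.\<close>
  define k where "k = (\<lambda>x y. if I x \<le> ennreal \<gamma>inf then max 0 (h' (x, y)) else 0)"
  show thesis
  proof (rule that[of k])
    show "case_prod k \<in> borel_measurable (lborel \<Otimes>\<^sub>M lborel)" unfolding k_def by measurable
    show "0 \<le> k x y" for x y by (simp add: k_def)
    show "(\<integral>\<^sup>+ y. ennreal (k x y) \<partial>lborel) \<le> ennreal \<gamma>inf" for x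
      by (cases "I x \<le> ennreal \<gamma>inf") (simp_all add: k_def, simp add: I_def)
    have "AE x in lborel. x \<in> \<Omega> \<longrightarrow> (AE y in lborel. y \<in> \<Omega> \<longrightarrow> k x y = \<gamma> x y)"
      using AE2
    proof (eventually_elim, intro impI)
      fix x assume x: "AE y in lborel. h (x, y) = h' (x, y)" "x \<in> \<Omega>"
      have "I x = (\<integral>\<^sup>+ y. ennreal (\<gamma> x y) * indicator \<Omega> y \<partial>lborel)"
        unfolding I_def
      proof (rule nn_integral_cong_AE)
        show "AE y in lborel. ennreal (max 0 (h' (x, y))) = ennreal (\<gamma> x y) * indicator \<Omega> y"
          using x(1)
        proof eventually_elim
          case (elim y)
          then show ?case using x(2) \<gamma>0[of x y] by (cases "y \<in> \<Omega>") (auto simp: h_def)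
        qed
      qed
      also have "\<dots> = (\<integral>\<^sup>+ y. ennreal (\<gamma> x y) \<partial>(lebesgue_on \<Omega>))"
        using \<Omega>L by (simp add: nn_integral_restrict_space nn_integral_completion)
      finally have I: "I x \<le> ennreal \<gamma>inf" using \<gamma>b[OF x(2)] by simp
      show "AE y in lborel. y \<in> \<Omega> \<longrightarrow> k x y = \<gamma> x y"
        using x(1)
      proof eventually_elim
        case (elim y)
        then show ?case using x(2) \<gamma>0[of x y] I by (auto simp: k_def h_def)
      qed
    qed
    then show "AE x in lebesgue_on \<Omega>. AE y in lebesgue_on \<Omega>. k x y = \<gamma> x y"
      using \<Omega>L by (simp add: AE_restrict_space_iff AE_completion_iff)
  qed
qed

text \<open>K and g are built from the Borel version of the kernel, so their bounds hold at every
  point; Gam keeps the original kernel and agrees with K z - g * z almost everywhere.\<close>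

lemma Linf_nonlocal_operator:
  fixes \<Omega> :: "'a::euclidean_space set"
  assumes \<Omega>: "open \<Omega>" "\<Omega> \<noteq> {}" and ker: "kernel_cond \<Omega> \<gamma>inf \<gamma>" and inf: "\<gamma>inf \<ge> 0"
  shows "\<exists>K g. nonlocal_operator (Linf_space \<Omega>) (Linf_norm \<Omega>) (Gam \<Omega> \<gamma>) K g \<gamma>inf"
proof -
  interpret phase_space "Linf_space \<Omega>" "Linf_norm \<Omega>" by (rule Linf_phase_space[OF \<Omega>])
  let ?M = "Linf_space \<Omega>" and ?N = "Linf_norm \<Omega>" and ?\<mu> = "lebesgue_on \<Omega>"
  note ge = AE_abs_le_Linf_norm[OF \<Omega>] and le = Linf_norm_le[OF \<Omega>] and nn = Linf_norm_nonneg[OF \<Omega>]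
    and meas = Linf_space_measurable[of _ \<Omega>]
  have \<Omega>L: "\<Omega> \<in> sets lebesgue" using \<Omega> by auto
  obtain k where k[measurable]: "case_prod k \<in> borel_measurable (lborel \<Otimes>\<^sub>M lborel)" and k0: "\<And>x y. 0 \<le> k x y"
    and kb: "\<And>x. (\<integral>\<^sup>+ y. ennreal (k x y) \<partial>lborel) \<le> ennreal \<gamma>inf"
    and k\<gamma>: "AE x in ?\<mu>. AE y in ?\<mu>. k x y = \<gamma> x y"
    using kernel_borel_version[OF \<Omega>(1) ker] by blast
  have lift: "f \<in> borel_measurable ?\<mu>" if "f \<in> borel_measurable lborel" for f :: "'a \<Rightarrow> real"
    by (rule measurable_restrict_space1[OF measurable_completion[OF that]])
  have kx[measurable]: "k x \<in> borel_measurable lborel" for x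
    using measurable_compose[OF measurable_Pair1' k, of x] by simp
  have k_meas: "k x \<in> borel_measurable ?\<mu>" for x by (rule lift[OF kx])
  have k_nn: "(\<integral>\<^sup>+ y. ennreal (k x y) \<partial>?\<mu>) \<le> ennreal \<gamma>inf" for x
  proof -
    have "(\<integral>\<^sup>+ y. ennreal (k x y) \<partial>?\<mu>) = (\<integral>\<^sup>+ y. ennreal (k x y) * indicator \<Omega> y \<partial>lborel)"
      using \<Omega>L by (simp add: nn_integral_restrict_space nn_integral_completion)
    also have "\<dots> \<le> (\<integral>\<^sup>+ y. ennreal (k x y) \<partial>lborel)"
      by (intro nn_integral_mono) (auto simp: indicator_def)
    finally show ?thesis using kb[of x] by simp
  qed
  have k_int: "integrable ?\<mu> (k x)" for x
    using k_meas k0 le_less_trans[OF k_nn[of x] ennreal_less_top] by (intro integrableI_nonneg) auto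
  have k_le: "integral\<^sup>L ?\<mu> (k x) \<le> \<gamma>inf" for x
    using k_nn[of x] nn_integral_eq_integral[OF k_int, of x] k0 inf by (simp add: ennreal_le_iff)
  let ?K = "\<lambda>z x. \<integral>y. k x y * z y \<partial>?\<mu>" and ?g = "\<lambda>x. integral\<^sup>L ?\<mu> (k x)"
  have K_mem: "?K z \<in> ?M" if z: "z \<in> ?M" for z
  proof (rule Linf_spaceI)
    \<comment> \<open>Measurability in x of an integral over y is taken from the product of Borel
      measures, so z too is replaced by a Borel version, which changes none of the
      integrals.\<close>
    have zL: "(\<lambda>y. if y \<in> \<Omega> then z y else 0) \<in> borel_measurable lebesgue"
      using meas[OF z] \<Omega>L by (simp add: borel_measurable_if)
    then obtain z' where z'[measurable]: "z' \<in> borel_measurable lborel"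
      and zz': "AE y in lborel. (if y \<in> \<Omega> then z y else 0) = z' y"
      using completion_ex_borel_measurable_real by blast
    have "?K z x = (\<integral>y. k x y * z' y \<partial>lborel)" for x
    proof -
      have "?K z x = (\<integral>y. indicator \<Omega> y *\<^sub>R (k x y * z y) \<partial>lebesgue)"
        using \<Omega>L by (simp add: integral_restrict_space)
      also have "\<dots> = (\<integral>y. k x y * (if y \<in> \<Omega> then z y else 0) \<partial>lebesgue)"
        by (intro Bochner_Integration.integral_cong) (auto simp: indicator_def)
      also have "\<dots> = (\<integral>y. k x y * z' y \<partial>lebesgue)"
      proof (rule integral_cong_AE)
        show "(\<lambda>y. k x y * (if y \<in> \<Omega> then z y else 0)) \<in> borel_measurable lebesgue"
          by (intro borel_measurable_times zL measurable_completion kx)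
        show "(\<lambda>y. k x y * z' y) \<in> borel_measurable lebesgue"
          by (intro borel_measurable_times measurable_completion kx z')
        show "AE y in lebesgue. k x y * (if y \<in> \<Omega> then z y else 0) = k x y * z' y"
          using AE_completion[OF zz'] by eventually_elim simp
      qed
      also have "\<dots> = (\<integral>y. k x y * z' y \<partial>lborel)" by (rule integral_completion) measurable
      finally show ?thesis .
    qed
    moreover have "(\<lambda>x. \<integral>y. k x y * z' y \<partial>lborel) \<in> borel_measurable lborel" by measurable
    ultimately show "?K z \<in> borel_measurable ?\<mu>" by (intro lift) simp
    show "AE x in ?\<mu>. \<bar>?K z x\<bar> \<le> \<gamma>inf * ?N z"
      using k0 by (intro AE_I2 abs_integral_mult_le[OF k_int _ k_le meas[OF z] ge[OF z] nn]) auto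
  qed
  have g_mem: "?g \<in> ?M" using K_mem[OF const_mem[of 1]] by simp
  have P_mem: "(\<lambda>x. ?K z x - ?g x * z x) \<in> ?M" if "z \<in> ?M" for z
    by (rule diff_mem[OF K_mem[OF that] mult_mem[OF g_mem that]])
  have G_eq: "AE x in ?\<mu>. ?K z x - ?g x * z x = Gam \<Omega> \<gamma> z x" if z: "z \<in> ?M" for z
    using k\<gamma>
  proof eventually_elim
    case (elim x)
    \<comment> \<open>At this x the section of \<gamma> equals that of k almost everywhere and
      inherits its measurability.\<close>
    have \<gamma>x: "\<gamma> x \<in> borel_measurable ?\<mu>"
      by (rule borel_measurable_lebesgue_on_AE[OF k_meas \<Omega>L elim])
    have "Gam \<Omega> \<gamma> z x = (\<integral>y. k x y * (z y - z x) \<partial>?\<mu>)"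
      unfolding Gam_def
    proof (rule integral_cong_AE)
      show "(\<lambda>y. \<gamma> x y * (z y - z x)) \<in> borel_measurable ?\<mu>" "(\<lambda>y. k x y * (z y - z x)) \<in> borel_measurable ?\<mu>"
        using \<gamma>x k_meas[of x] meas[OF z] by auto
      show "AE y in ?\<mu>. \<gamma> x y * (z y - z x) = k x y * (z y - z x)" using elim by eventually_elim simp
    qed
    then show ?case using integral_kernel_increment[OF k_int meas[OF z] ge[OF z], of x "z x"] by simp
  qed
  have G_meas: "Gam \<Omega> \<gamma> z \<in> borel_measurable ?\<mu>" if "z \<in> ?M" for z
    by (rule borel_measurable_lebesgue_on_AE[OF meas[OF P_mem[OF that]] \<Omega>L G_eq[OF that]])
  have G_mem: "Gam \<Omega> \<gamma> z \<in> ?M" if z: "z \<in> ?M" for z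
  proof (rule Linf_spaceI[OF G_meas[OF z]])
    show "AE x in ?\<mu>. \<bar>Gam \<Omega> \<gamma> z x\<bar> \<le> ?N (\<lambda>x. ?K z x - ?g x * z x)"
      using ge[OF P_mem[OF z]] G_eq[OF z] by eventually_elim simp
  qed
  have "nonlocal_operator ?M ?N (Gam \<Omega> \<gamma>) ?K ?g \<gamma>inf"
  proof (rule nonlocal_operator_kernelI[where \<mu> = ?\<mu>])
    show "AE y in ?\<mu>. 0 \<le> k x y" for x using k0 by simp
    fix z assume z: "z \<in> ?M"
    let ?d = "\<lambda>x. (?K z x - ?g x * z x) - Gam \<Omega> \<gamma> z x"
    have d: "?d \<in> ?M" by (rule diff_mem[OF P_mem[OF z] G_mem[OF z]])
    have "AE x in ?\<mu>. \<bar>?d x\<bar> \<le> 0" using G_eq[OF z] by eventually_elim simp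
    then have "?N ?d \<le> 0" by (rule le[OF meas[OF d]])
    then show "?N ?d = 0" using nn[of ?d] by linarith
  qed (fact meas ge k_int k_le K_mem G_mem)+
  then show ?thesis by blast
qed

theorem theorem1p1:
  fixes \<Omega> :: "'a::euclidean_space set"
    and \<gamma>1 \<gamma>2 :: "'a \<Rightarrow> 'a \<Rightarrow> real"
    and d1 d2 f \<kappa> \<gamma>inf :: real
  assumes "open \<Omega>" "connected \<Omega>" "bounded \<Omega>" "\<Omega> \<noteq> {}"
    and "d1 > 0" "d2 > 0" "f > 0" "\<kappa> > 0"
    and "\<gamma>inf \<ge> 1"
    and "kernel_cond \<Omega> \<gamma>inf \<gamma>1" "kernel_cond \<Omega> \<gamma>inf \<gamma>2"
  shows "GS_wellposed (Linf_space \<Omega>) (Linf_norm \<Omega>) \<Omega> \<gamma>1 \<gamma>2 d1 d2 f \<kappa> \<and>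
         ((continuous_on (closure \<Omega> \<times> closure \<Omega>) (\<lambda>(x, y). \<gamma>1 x y) \<and>
           continuous_on (closure \<Omega> \<times> closure \<Omega>) (\<lambda>(x, y). \<gamma>2 x y)) \<longrightarrow>
          GS_wellposed (Cbar_space \<Omega>) (Cbar_norm \<Omega>) \<Omega> \<gamma>1 \<gamma>2 d1 d2 f \<kappa>)"
proof (intro conjI impI)
  obtain K1 g1 where A1: "nonlocal_operator (Linf_space \<Omega>) (Linf_norm \<Omega>) (Gam \<Omega> \<gamma>1) K1 g1 \<gamma>inf"
    using Linf_nonlocal_operator[of \<Omega> \<gamma>inf \<gamma>1] assms by auto
  obtain K2 g2 where A2: "nonlocal_operator (Linf_space \<Omega>) (Linf_norm \<Omega>) (Gam \<Omega> \<gamma>2) K2 g2 \<gamma>inf"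
    using Linf_nonlocal_operator[of \<Omega> \<gamma>inf \<gamma>2] assms by auto
  interpret gray_scott "Linf_space \<Omega>" "Linf_norm \<Omega>" \<Omega> \<gamma>1 \<gamma>2 K1 K2 g1 g2 \<gamma>inf d1 d2 f \<kappa>
    using A1 A2 assms by (intro gray_scott.intro gray_scott_axioms.intro)
  show "GS_wellposed (Linf_space \<Omega>) (Linf_norm \<Omega>) \<Omega> \<gamma>1 \<gamma>2 d1 d2 f \<kappa>" by (rule wellposed)
next
  assume cont: "continuous_on (closure \<Omega> \<times> closure \<Omega>) (\<lambda>(x, y). \<gamma>1 x y) \<and>
    continuous_on (closure \<Omega> \<times> closure \<Omega>) (\<lambda>(x, y). \<gamma>2 x y)"
  have compact: "compact (closure \<Omega> \<times> closure \<Omega>)" using assms by (intro compact_Times) auto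
  have "\<exists>C. \<forall>x\<in>closure \<Omega>. \<forall>y\<in>closure \<Omega>. \<gamma> x y \<le> C"
    if "continuous_on (closure \<Omega> \<times> closure \<Omega>) (\<lambda>(x, y). \<gamma> x y)" for \<gamma> :: "'a \<Rightarrow> 'a \<Rightarrow> real"
  proof -
    have "bdd_above ((\<lambda>(x, y). \<gamma> x y) ` (closure \<Omega> \<times> closure \<Omega>))"
      by (intro bounded_imp_bdd_above compact_imp_bounded compact_continuous_image that compact)
    then show ?thesis by (auto simp: bdd_above_def)
  qed
  then obtain C1 C2 where C: "\<And>x y. x \<in> closure \<Omega> \<Longrightarrow> y \<in> closure \<Omega> \<Longrightarrow> \<gamma>1 x y \<le> C1"
    "\<And>x y. x \<in> closure \<Omega> \<Longrightarrow> y \<in> closure \<Omega> \<Longrightarrow> \<gamma>2 x y \<le> C2"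
    using cont by metis
  \<comment> \<open>\<open>gray_scott\<close> takes one constant for both operators.\<close>
  define C where "C = max C1 C2"
  obtain K1 g1 where A1: "nonlocal_operator (Cbar_space \<Omega>) (Cbar_norm \<Omega>) (Gam \<Omega> \<gamma>1) K1 g1 (C * measure lebesgue \<Omega>)"
    using Cbar_nonlocal_operator[of \<Omega> \<gamma>1 C] assms cont C(1)
    by (auto simp: kernel_cond_def C_def le_max_iff_disj)
  obtain K2 g2 where A2: "nonlocal_operator (Cbar_space \<Omega>) (Cbar_norm \<Omega>) (Gam \<Omega> \<gamma>2) K2 g2 (C * measure lebesgue \<Omega>)"
    using Cbar_nonlocal_operator[of \<Omega> \<gamma>2 C] assms cont C(2)
    by (auto simp: kernel_cond_def C_def le_max_iff_disj)
  interpret gray_scott "Cbar_space \<Omega>" "Cbar_norm \<Omega>" \<Omega> \<gamma>1 \<gamma>2 K1 K2 g1 g2 "C * measure lebesgue \<Omega>" d1 d2 f \<kappa>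
    using A1 A2 assms by (intro gray_scott.intro gray_scott_axioms.intro)
  show "GS_wellposed (Cbar_space \<Omega>) (Cbar_norm \<Omega>) \<Omega> \<gamma>1 \<gamma>2 d1 d2 f \<kappa>" by (rule wellposed)
qed

end
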